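(* Let $T$ be a process defined on an unknown probability space $(\Omega,\mathcal{A},\mathbb{P})$, $\omega\mapsto T(\omega,\cdot)$, with values in some admissible family of deformations acting on a subset $\mathcal{I}\subset\mathbb{R}^d$. Assume that $T$ is bounded and has a finite moment $\varphi(\cdot)=\mathbb{E}(T(\cdot))$. Let $T_j$, $j=1,\dots,J$, be a random sample (i.i.d.) of realizations of the process $T$. Let $\mu$ be a probability measure on $\mathcal{I}$, absolutely continuous with respect to Lebesgue measure, and let $\mu_j=(T_j)_\#\mu$ for all $j$. Assume that $\mu$ is compactly supported. As soon as $\varphi=\mathrm{id}$, the barycenter $\mu_B$ of the $\mu_j$'s with weights $1/J$ is a consistent estimate of $\mu$ when $J$ tends to infinity, in the sense that almost surely $$W_2^2(\mu_B,\mu)\longrightarrow 0\quad\text{as }J\to\infty .$$ Moreover, assuming that $\|T-\mathrm{id}\|_{L^2(\mu)}\le M$ almost surely, the following error bound holds: $$\mathbb{P}\big(W_2(\mu_B,\mu)\ge\varepsilon\big)\le 2\exp\left(-J\,\frac{\varepsilon^2}{M^2(1+c\,\varepsilon/M)}\right),$$ where $c$ is a constant (whose value is not specified).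
   Context: $T_\#\mu$ is the push-forward, $T_\#\mu(A)=\mu(T^{-1}(A))$ for measurable $A$. $\mathcal{P}_2(\mathbb{R}^d)$ is the set of probability measures on $\mathbb{R}^d$ with finite second-order moment, and $W_2$ is the 2-Wasserstein distance: $W_2^2(\mu,\nu)$ is the infimum of $\int|x-y|^2\,d\pi$ over all probability measures $\pi$ on the product space with first marginal $\mu$ and second marginal $\nu$. The barycenter of $\mu_1,\dots,\mu_J$ with weights $1/J$ is the minimizer over $\nu\in\mathcal{P}_2(\mathbb{R}^d)$ of $\frac1J\sum_{j=1}^J W_2^2(\nu,\mu_j)$. $\|S\|_{L^2(\mu)}^2=\int|S(x)|^2\mu(dx)$. $GCF(\mathcal{I})$ is the set of all gradients of convex functions, that is, the set of all maps $S:\mathcal{I}\to\mathbb{R}^d$ such that there exists a proper convex lower semi-continuous function $\phi:\mathcal{I}\to\mathbb{R}$ with $S=\nabla\phi$. A family $(S_i)_{i\in I}$ of maps on $\mathcal{I}$ is an admissible family of deformations if: (1) there exists $i_0\in I$ with $S_{i_0}=\mathrm{Id}$; (2) the maps $S_i:\mathcal{I}\to\mathcal{I}$ are one-to-one and onto; (3) $S_i\circ S_j^{-1}\in GCF(\mathcal{I})$ for all $i,j\in I$.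
   Formalization: The error bound fails for a fixed constant c (random shifts ±v, |v|=M, ε=2M/√J, J→∞); here c may depend on the ratio ε/M only, with 0 < c(r) ≤ 1/r + C for an absolute C, so that the denominator is at most M²(2+Cε/M). *)

theory Defs
  imports "HOL-Probability.Probability"
begin

section \<open>Wasserstein distance and barycenters\<close>

definition couplings :: "'a::euclidean_space measure \<Rightarrow> 'a measure \<Rightarrow> ('a \<times> 'a) measure set" where
  "couplings \<mu> \<nu> =
     {\<pi>. sets \<pi> = sets (borel \<Otimes>\<^sub>M borel) \<and> prob_space \<pi> \<and>
         distr \<pi> borel fst = \<mu> \<and> distr \<pi> borel snd = \<nu>}"

definition wasserstein2_sq :: "'a::euclidean_space measure \<Rightarrow> 'a measure \<Rightarrow> ennreal" where
  "wasserstein2_sq \<mu> \<nu> = (INF \<pi>\<in>couplings \<mu> \<nu>. \<integral>\<^sup>+z. ennreal ((norm (fst z - snd z))\<^sup>2) \<partial>\<pi>)"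

text \<open>Meaningful only when \<^const>\<open>wasserstein2_sq\<close> is finite, in particular on \<open>P2\<close> below;
  barycenters are therefore defined through the extended-valued \<^const>\<open>wasserstein2_sq\<close>.\<close>

definition wasserstein2 :: "'a::euclidean_space measure \<Rightarrow> 'a measure \<Rightarrow> real" where
  "wasserstein2 \<mu> \<nu> = sqrt (enn2real (wasserstein2_sq \<mu> \<nu>))"

definition P2 :: "'a::euclidean_space measure set" where
  "P2 = {\<nu>. sets \<nu> = sets borel \<and> prob_space \<nu> \<and> (\<integral>\<^sup>+x. ennreal ((norm x)\<^sup>2) \<partial>\<nu>) < \<infinity>}"

definition barycenter_cost ::
    "nat \<Rightarrow> (nat \<Rightarrow> 'a::euclidean_space measure) \<Rightarrow> 'a measure \<Rightarrow> ennreal" where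
  "barycenter_cost J m \<nu> = ennreal (1 / real J) * (\<Sum>j\<in>{1..J}. wasserstein2_sq \<nu> (m j))"

definition is_barycenter ::
    "nat \<Rightarrow> (nat \<Rightarrow> 'a::euclidean_space measure) \<Rightarrow> 'a measure \<Rightarrow> bool" where
  "is_barycenter J m \<nu> \<longleftrightarrow>
     \<nu> \<in> P2 \<and> (\<forall>\<nu>'\<in>P2. barycenter_cost J m \<nu> \<le> barycenter_cost J m \<nu>')"

definition barycenter :: "nat \<Rightarrow> (nat \<Rightarrow> 'a::euclidean_space measure) \<Rightarrow> 'a measure" where
  "barycenter J m = (THE \<nu>. is_barycenter J m \<nu>)"

text \<open>The squared norm of \<open>L\<^sup>2(\<mu>)\<close> as a nonnegative integral, so that it is \<open>\<infinity>\<close> (and not \<open>0\<close>)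
  for maps that are not square integrable.\<close>

definition L2_norm_sq :: "'a measure \<Rightarrow> ('a \<Rightarrow> 'b::real_normed_vector) \<Rightarrow> ennreal" where
  "L2_norm_sq \<mu> S = (\<integral>\<^sup>+x. ennreal ((norm (S x))\<^sup>2) \<partial>\<mu>)"

section \<open>Admissible deformations\<close>

text \<open>A finite-valued \<open>\<phi>\<close> on a nonempty set is proper. The set \<open>I\<close> need not be open, so the gradient
  is taken within \<open>I\<close>; at interior points this is the usual gradient. Note that
  \<^const>\<open>convex_on\<close> includes convexity of the domain.\<close>

definition GCF :: "'a::euclidean_space set \<Rightarrow> ('a \<Rightarrow> 'a) set" where
  "GCF I = {S. \<exists>\<phi>::'a \<Rightarrow> real.
       convex_on I \<phi> \<and>
       (\<forall>x\<in>I. \<forall>a<\<phi> x. \<forall>\<^sub>F y in at x within I. a < \<phi> y) \<and>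
       (\<forall>x\<in>I. (\<phi> has_derivative (\<lambda>h. S x \<bullet> h)) (at x within I))}"

definition admissible_family :: "'i set \<Rightarrow> ('i \<Rightarrow> 'a::euclidean_space \<Rightarrow> 'a) \<Rightarrow> 'a set \<Rightarrow> bool" where
  "admissible_family A S I \<longleftrightarrow>
     (\<exists>i\<^sub>0\<in>A. \<forall>x\<in>I. S i\<^sub>0 x = x) \<and>
     (\<forall>i\<in>A. bij_betw (S i) I I) \<and>
     (\<forall>i\<in>A. \<forall>j\<in>A. S i \<circ> inv_into I (S j) \<in> GCF I)"

section \<open>Random deformations\<close>

text \<open>The process, viewed as a random element of the product space \<open>(\<real>\<^sup>d)\<^sup>I\<close> with its cylinder
  sigma-algebra; its law is the law of the process.\<close>

definition path :: "'a set \<Rightarrow> ('w \<Rightarrow> 'a \<Rightarrow> 'a) \<Rightarrow> 'w \<Rightarrow> 'a \<Rightarrow> 'a" where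
  "path I T \<omega> = restrict (T \<omega>) I"

definition paths :: "'a::euclidean_space set \<Rightarrow> ('a \<Rightarrow> 'a) measure" where
  "paths I = (\<Pi>\<^sub>M x\<in>I. borel)"

definition deformation_process ::
    "'w measure \<Rightarrow> 'a::euclidean_space set \<Rightarrow> 'i set \<Rightarrow> ('i \<Rightarrow> 'a \<Rightarrow> 'a) \<Rightarrow> ('w \<Rightarrow> 'a \<Rightarrow> 'a) \<Rightarrow> bool" where
  "deformation_process P I A S T \<longleftrightarrow>
     path I T \<in> P \<rightarrow>\<^sub>M paths I \<and> (\<forall>\<omega>\<in>space P. \<exists>i\<in>A. \<forall>x\<in>I. T \<omega> x = S i x)"

definition random_sample ::
    "'w measure \<Rightarrow> 'a::euclidean_space set \<Rightarrow> ('w \<Rightarrow> 'a \<Rightarrow> 'a) \<Rightarrow> (nat \<Rightarrow> 'w \<Rightarrow> 'a \<Rightarrow> 'a) \<Rightarrow> bool" where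
  "random_sample P I T Ts \<longleftrightarrow>
     prob_space.indep_vars P (\<lambda>_. paths I) (\<lambda>j. path I (Ts j)) {1..} \<and>
     (\<forall>j\<ge>1. distr P (paths I) (path I (Ts j)) = distr P (paths I) (path I T))"

section \<open>Measures on a subset of the space\<close>

definition prob_measure_on :: "'a::euclidean_space set \<Rightarrow> 'a measure \<Rightarrow> bool" where
  "prob_measure_on I \<mu> \<longleftrightarrow> prob_space \<mu> \<and> sets \<mu> = sets (restrict_space borel I)"

text \<open>A measure on \<open>I\<close> seen as a Borel measure on the whole space.\<close>

definition extend_measure_to_space :: "'a::euclidean_space measure \<Rightarrow> 'a measure" where
  "extend_measure_to_space \<mu> = distr \<mu> borel (\<lambda>x. x)"

definition compactly_supported :: "'a::euclidean_space measure \<Rightarrow> bool" where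
  "compactly_supported \<mu> \<longleftrightarrow> (\<exists>K. compact K \<and> (AE x in \<mu>. x \<in> K))"

text \<open>In the deviation bound \<open>2 exp (-J \<epsilon>\<^sup>2 / (M\<^sup>2 (1 + c \<epsilon> / M)))\<close> the constant \<open>c\<close> is a function of the
  ratio \<open>\<epsilon> / M\<close> with \<open>c r \<le> 1 / r + C\<close>, and depends on nothing else. One \<open>c\<close> for all \<open>\<epsilon>\<close> and \<open>J\<close> does
  not exist: for translations by \<open>\<plusminus>v\<close> with probability \<open>1/2\<close> each, \<open>norm v = M\<close> and \<open>\<epsilon> = 2 M / sqrt J\<close>,
  the probability tends to that of a standard normal variable exceeding \<open>2\<close> in absolute value, about
  \<open>0.0455\<close>, and the bound to \<open>2 exp (-4)\<close>, about \<open>0.0366\<close>.\<close>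

end

theory Submission
  imports Defs
begin

text \<open>In the coordinate \<open>x\<close> of the template, the potentials of \<open>T\<^sub>i \<circ> T\<^sub>j\<^sup>-\<^sup>1\<close> can be normalized so
  that those of \<open>(i, j)\<close> and \<open>(j, i)\<close> are convex conjugate. Averaging them over \<open>i\<close> gives dual
  potentials showing that the push-forward of \<open>\<mu>\<close> by the mean \<open>(1/J) \<Sum>\<^sub>j T\<^sub>j\<close> minimizes the barycenter
  functional. Every minimizer has couplings with vanishing duality gap; by monotonicity of
  subgradients and continuity of the maps \<open>T\<^sub>i \<circ> T\<^sub>j\<^sup>-\<^sup>1\<close> this determines the minimizer. The mean is
  itself a gradient of a convex function, so the distance of the barycenter from \<open>\<mu>\<close> is
  the \<open>L\<^sup>2(\<mu>)\<close> norm of the mean of the centered independent fields \<open>T\<^sub>j - id\<close>. Pinelis' method,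
  which controls the expectation of \<open>cosh (l * \<parallel>S\<^sub>J\<parallel>)\<close>, bounds its tails by
  \<open>2 exp (- J r\<^sup>2 / (2 + r))\<close> with \<open>r = \<epsilon> / M\<close>, which is the claim for \<open>c r = 1 / r + 1\<close>. Almost sure
  convergence follows by the Borel-Cantelli lemma.\<close>

text \<open>Two features of the statement shape the proof. The frontier of a convex set is
  Lebesgue-null, so \<mu> lives on the interior; gradients are continuous there, and bijectivity
  makes every deformation and its inverse preserve it. Second, \<open>barycenter\<close> is a
  definite description, so uniqueness must be proved. The cost of a coupling is split into a dual
  value fixed by its marginals and twice an expected Fenchel gap; gaps tending to zero already
  determine the first marginal.

  The process is measurable only for cylinder sets, so random fields are read off from their values
  at a dense sequence before Fubini is applied. The exponent comes from l = ln (1 + r) / M in the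
  bound (exp (l M) - l M)^J for the mean of \<open>cosh\<close>: this gives J (r - (1 + r) ln (1 +
  r)), and ln (1 + r) >= 2 r / (2 + r) makes it at most - J r^2 / (2 + r).\<close>

section \<open>Hyperbolic inequalities and square integrable maps\<close>

lemma cosh_sqrt_sums:
  fixes s :: real assumes "0 \<le> s"
  shows "(\<lambda>n. s ^ n /\<^sub>R fact (2 * n)) sums cosh (sqrt s)"
proof -
  let ?f = "\<lambda>n. if even n then sqrt s ^ n /\<^sub>R fact n else 0"
  have "(\<lambda>n. ?f (2 * n)) sums cosh (sqrt s)"
    using cosh_converges[of "sqrt s"]
    by (subst sums_mono_reindex[of "\<lambda>n. 2 * n"]) (auto simp: strict_mono_def elim!: evenE)
  then show ?thesis using assms by (simp add: power_mult)
qed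

text \<open>A power series in s with nonnegative coefficients, whose terms are convex on the
  half-line. It makes \<open>cosh\<close> of a norm convex in the squared norm, where sums of
  vectors expand.\<close>

lemma convex_on_cosh_sqrt: "convex_on {0..} (\<lambda>s::real. cosh (sqrt s))"
proof (rule convex_onI)
  fix t x y :: real
  assume t: "0 < t" "t < 1" and "x \<in> {0..}" "y \<in> {0..}"
  then have xy: "0 \<le> x" "0 \<le> y" by auto
  have 1: "(\<lambda>n. ((1 - t) * x + t * y) ^ n /\<^sub>R fact (2 * n)) sums cosh (sqrt ((1 - t) * x + t * y))"
    using t xy by (intro cosh_sqrt_sums) auto
  have 2: "(\<lambda>n. (1 - t) * (x ^ n /\<^sub>R fact (2 * n)) + t * (y ^ n /\<^sub>R fact (2 * n)))
      sums ((1 - t) * cosh (sqrt x) + t * cosh (sqrt y))"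
    using xy by (intro sums_add sums_mult cosh_sqrt_sums)
  show "cosh (sqrt ((1 - t) *\<^sub>R x + t *\<^sub>R y)) \<le> (1 - t) * cosh (sqrt x) + t * cosh (sqrt y)"
    unfolding real_scaleR_def
  proof (rule sums_le[OF _ 1 2])
    fix n
    have "((1 - t) * x + t * y) ^ n \<le> (1 - t) * x ^ n + t * y ^ n"
      using convex_onD[OF convex_power_even[of n], of t x y]
        convex_onD[OF convex_power_odd[of n], of t x y] t xy by (cases "even n") auto
    then have "((1 - t) * x + t * y) ^ n /\<^sub>R fact (2 * n)
       \<le> ((1 - t) * x ^ n + t * y ^ n) /\<^sub>R fact (2 * n)"
      by (intro scaleR_left_mono) auto
    then show "((1 - t) * x + t * y) ^ n /\<^sub>R fact (2 * n)
       \<le> (1 - t) * (x ^ n /\<^sub>R fact (2 * n)) + t * (y ^ n /\<^sub>R fact (2 * n))"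
      by (simp add: algebra_simps)
  qed
qed auto

lemma borel_measurable_cosh [measurable]: "cosh \<in> borel_measurable (borel :: real measure)"
  by (intro borel_measurable_continuous_onI continuous_intros)

lemma le_sinh_real: "0 \<le> b \<Longrightarrow> b \<le> sinh (b::real)"
proof -
  assume b: "0 \<le> b"
  have "sinh 0 - 0 \<le> sinh b - b"
    using b by (intro DERIV_nonneg_imp_nondecreasing[of 0 b "\<lambda>b. sinh b - b"])
       (auto intro!: derivative_eq_intros exI simp: cosh_real_ge_1)
  then show ?thesis by simp
qed

text \<open>Read a and b as the norms of two vectors and p as their inner product: the left side is
  \<open>cosh\<close> of the norm of their sum. The term linear in p is kept exactly, since it will
  average to zero; the rest is bounded through a and b.\<close>

lemma cosh_add_vector_le:
  fixes a b p :: real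
  assumes ab: "0 \<le> a" "0 \<le> b" and p: "\<bar>p\<bar> \<le> a * b"
  shows "cosh (sqrt (a\<^sup>2 + 2 * p + b\<^sup>2))
    \<le> cosh a * (exp b - b) + (if a = 0 then 0 else sinh a / a * p)"
proof -
  have sb: "0 \<le> sinh b - b" using le_sinh_real ab by simp
  have sa: "0 \<le> sinh a" "sinh a \<le> cosh a" using ab by (auto simp: sinh_le_cosh_real)
  have e: "exp b - b = cosh b + (sinh b - b)" by (simp add: cosh_plus_sinh[symmetric])
  show ?thesis
  proof (cases "a * b = 0")
    case True
    then have "p = 0" using p by auto
    have "cosh (sqrt (a\<^sup>2 + 2 * p + b\<^sup>2)) = cosh a * cosh b"
      using True ab \<open>p = 0\<close> by auto
    also have "\<dots> \<le> cosh a * (exp b - b)"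
      unfolding e using sb by (intro mult_left_mono) auto
    finally show ?thesis using \<open>p = 0\<close> by (cases "a = 0") auto
  next
    case False
    then have ab': "0 < a" "0 < b" using ab by auto
    \<comment> \<open>Solves p = a b (1 - 2 t): the weight that writes the squared norm as a convex
      combination of the extreme cases (a + b)^2 and (a - b)^2.\<close>
    define t where "t = (1 - p / (a * b)) / 2"
    have pab: "p = a * b * (1 - 2 * t)" using ab' by (simp add: t_def field_simps)
    have t: "0 \<le> t" "t \<le> 1" using p ab' by (auto simp: t_def field_simps abs_le_iff)
    have "a\<^sup>2 + 2 * p + b\<^sup>2 = (1 - t) * (a + b)\<^sup>2 + t * (a - b)\<^sup>2"
      by (simp add: pab power2_eq_square algebra_simps)
    then have "cosh (sqrt (a\<^sup>2 + 2 * p + b\<^sup>2)) \<le> (1 - t) * cosh (a + b) + t * cosh (a - b)"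
      using convex_onD[OF convex_on_cosh_sqrt t, of "(a + b)\<^sup>2" "(a - b)\<^sup>2"] ab' by simp
    also have "\<dots> = cosh a * cosh b + (1 - 2 * t) * sinh a * sinh b"
      by (simp add: cosh_add cosh_diff algebra_simps)
    \<comment> \<open>Of \<open>sinh b\<close>, the part b yields exactly the linear term; only the
      nonnegative remainder is estimated.\<close>
    also have "\<dots> = cosh a * cosh b + (1 - 2 * t) * (sinh a * (sinh b - b)) + sinh a / a * p"
      using ab' by (simp add: pab algebra_simps)
    also have "(1 - 2 * t) * (sinh a * (sinh b - b)) \<le> 1 * (cosh a * (sinh b - b))"
      using t sa sb by (intro mult_mono mult_nonneg_nonneg) auto
    finally show ?thesis using ab' unfolding e by (simp add: algebra_simps)
  qed
qed

text \<open>The lower bound for ln (1 + r) is the first term of its series in odd powers of r / (2 +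
  r). Bennett's exponent becomes a rational one of Bernstein type.\<close>

lemma bennett_exponent_le:
  fixes r :: real assumes "0 < r"
  shows "r - (1 + r) * ln (1 + r) \<le> - (r\<^sup>2 / (2 + r))"
proof -
  have "2 * r / (2 + r) \<le> ln (1 + r)"
    using ln_approx_bounds[of "1 + r" 1, unfolded atLeastAtMost_iff, THEN conjunct1] assms
    by (simp add: add_ac)
  then have "(1 + r) * (2 * r / (2 + r)) \<le> (1 + r) * ln (1 + r)"
    using assms by (intro mult_left_mono) auto
  moreover have "(1 + r) * (2 * r / (2 + r)) = r + r\<^sup>2 / (2 + r)"
    using assms by (simp add: field_simps power2_eq_square)
  ultimately show ?thesis by linarith
qed

section \<open>Square integrable vector fields\<close>

definition L2_norm :: "'b measure \<Rightarrow> ('b \<Rightarrow> 'a::euclidean_space) \<Rightarrow> real" where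
  "L2_norm \<mu> f = sqrt (\<integral>x. (norm (f x))\<^sup>2 \<partial>\<mu>)"

text \<open>For a map whose squared norm is not integrable, \<open>L2_norm\<close> is 0 by the
  default of the Bochner integral; membership here gives its value a meaning.\<close>

definition L2 :: "'b measure \<Rightarrow> ('b \<Rightarrow> 'a::euclidean_space) set" where
  "L2 \<mu> = {f. f \<in> borel_measurable \<mu> \<and> integrable \<mu> (\<lambda>x. (norm (f x))\<^sup>2)}"

lemma L2_measurable [measurable_dest]: "f \<in> L2 \<mu> \<Longrightarrow> f \<in> borel_measurable \<mu>"
  by (simp add: L2_def)

lemma L2_integrable_norm_sq: "f \<in> L2 \<mu> \<Longrightarrow> integrable \<mu> (\<lambda>x. (norm (f x))\<^sup>2)"
  by (simp add: L2_def)

lemma L2_iff_nn_integral: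
  "f \<in> L2 \<mu> \<longleftrightarrow> f \<in> borel_measurable \<mu> \<and> L2_norm_sq \<mu> f < \<infinity>"
  by (auto simp: L2_def L2_norm_sq_def integrable_iff_bounded)

lemma L2_norm_sq_eq: "f \<in> L2 \<mu> \<Longrightarrow> L2_norm_sq \<mu> f = ennreal ((L2_norm \<mu> f)\<^sup>2)"
  by (simp add: L2_def L2_norm_sq_def L2_norm_def nn_integral_eq_integral)

lemma L2_norm_eq_enn2real:
  "f \<in> borel_measurable \<mu> \<Longrightarrow> L2_norm \<mu> f = sqrt (enn2real (L2_norm_sq \<mu> f))"
  by (simp add: L2_norm_def L2_norm_sq_def integral_eq_nn_integral)

lemma L2_integrable_inner:
  assumes "f \<in> L2 \<mu>" "g \<in> L2 \<mu>"
  shows "integrable \<mu> (\<lambda>x. f x \<bullet> g x)"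
proof (rule Bochner_Integration.integrable_bound)
  show "integrable \<mu> (\<lambda>x. (norm (f x))\<^sup>2 + (norm (g x))\<^sup>2)"
    using assms by (auto simp: L2_def)
  have "\<bar>f x \<bullet> g x\<bar> \<le> (norm (f x))\<^sup>2 + (norm (g x))\<^sup>2" for x
    using Cauchy_Schwarz_ineq2[of "f x" "g x"] sum_squares_bound[of "norm (f x)" "norm (g x)"]
      zero_le_power2[of "norm (f x)"] zero_le_power2[of "norm (g x)"] mult_nonneg_nonneg[OF norm_ge_zero norm_ge_zero, of "f x" "g x"] by linarith
  then show "AE x in \<mu>. norm (f x \<bullet> g x) \<le> norm ((norm (f x))\<^sup>2 + (norm (g x))\<^sup>2)"
    by (auto intro!: AE_I2)
qed (use assms in measurable)

lemma norm_add_sq: "(norm (x + y))\<^sup>2 = (norm x)\<^sup>2 + 2 * (x \<bullet> y) + (norm (y::'a::real_inner))\<^sup>2"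
  by (simp add: power2_norm_eq_inner algebra_simps inner_commute)

lemma L2_add [intro]:
  assumes "f \<in> L2 \<mu>" "g \<in> L2 \<mu>"
  shows "(\<lambda>x. f x + g x) \<in> L2 \<mu>"
  using assms L2_integrable_inner[OF assms] by (auto simp: L2_def norm_add_sq)

lemma L2_scaleR [intro]: "f \<in> L2 \<mu> \<Longrightarrow> (\<lambda>x. c *\<^sub>R f x) \<in> L2 \<mu>"
  by (auto simp: L2_def power_mult_distrib)

lemma L2_diff [intro]: "f \<in> L2 \<mu> \<Longrightarrow> g \<in> L2 \<mu> \<Longrightarrow> (\<lambda>x. f x - g x) \<in> L2 \<mu>"
  using L2_add[of f \<mu> "\<lambda>x. (-1) *\<^sub>R g x"] L2_scaleR[of g \<mu> "-1"] by simp

lemma L2_sum [intro]: "(\<And>j. j \<in> K \<Longrightarrow> f j \<in> L2 \<mu>) \<Longrightarrow> (\<lambda>x. \<Sum>j\<in>K. f j x) \<in> L2 \<mu>"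
proof (induction K rule: infinite_finite_induct)
  case (insert j K) then show ?case using L2_add[of "f j" \<mu> "\<lambda>x. \<Sum>j\<in>K. f j x"] by simp
qed (auto simp: L2_def)

lemma L2_norm_nonneg [simp]: "0 \<le> L2_norm \<mu> f"
  by (simp add: L2_norm_def integral_nonneg_AE)

lemma L2_norm_sq_real: "(L2_norm \<mu> f)\<^sup>2 = (\<integral>x. (norm (f x))\<^sup>2 \<partial>\<mu>)"
  by (simp add: L2_norm_def integral_nonneg_AE)

lemma L2_norm_scaleR: "L2_norm \<mu> (\<lambda>x. c *\<^sub>R f x) = \<bar>c\<bar> * L2_norm \<mu> f"
  by (simp add: L2_norm_def power_mult_distrib real_sqrt_mult)

lemma L2_norm_add_sq:
  assumes "f \<in> L2 \<mu>" "g \<in> L2 \<mu>"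
  shows "(L2_norm \<mu> (\<lambda>x. f x + g x))\<^sup>2
    = (L2_norm \<mu> f)\<^sup>2 + 2 * (\<integral>x. f x \<bullet> g x \<partial>\<mu>) + (L2_norm \<mu> g)\<^sup>2"
  unfolding L2_norm_sq_real norm_add_sq
  using assms L2_integrable_inner[OF assms] by (simp add: L2_integrable_norm_sq)

text \<open>The squared norm of f + c g is a nonnegative quadratic polynomial in c.\<close>

lemma L2_Cauchy_Schwarz:
  assumes f: "f \<in> L2 \<mu>" and g: "g \<in> L2 \<mu>"
  shows "\<bar>\<integral>x. f x \<bullet> g x \<partial>\<mu>\<bar> \<le> L2_norm \<mu> f * L2_norm \<mu> g"
proof -
  let ?p = "\<integral>x. f x \<bullet> g x \<partial>\<mu>" and ?a = "L2_norm \<mu> f" and ?b = "L2_norm \<mu> g"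
  have *: "0 \<le> ?a\<^sup>2 + 2 * c * ?p + c\<^sup>2 * ?b\<^sup>2" for c
  proof -
    have "0 \<le> (L2_norm \<mu> (\<lambda>x. f x + c *\<^sub>R g x))\<^sup>2" by simp
    also have "\<dots> = ?a\<^sup>2 + 2 * c * ?p + c\<^sup>2 * ?b\<^sup>2"
      using f g by (subst L2_norm_add_sq) (auto simp: L2_norm_scaleR power_mult_distrib)
    finally show ?thesis .
  qed
  have "?p\<^sup>2 \<le> ?a\<^sup>2 * ?b\<^sup>2"
  proof (cases "?b = 0")
    case True
    have "?p = 0"
    proof (rule ccontr)
      assume "?p \<noteq> 0"
      \<comment> \<open>At this c the polynomial, affine because \<open>?b\<close> = 0, takes the
        value -1.\<close>
      then have "2 * (- (?a\<^sup>2 + 1) / (2 * ?p)) * ?p = - (?a\<^sup>2 + 1)" by (simp add: field_simps)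
      then show False using *[of "- (?a\<^sup>2 + 1) / (2 * ?p)"] True by simp
    qed
    then show ?thesis by simp
  next
    case False
    have "0 \<le> ?a\<^sup>2 - ?p\<^sup>2 / ?b\<^sup>2"
      using *[of "- ?p / ?b\<^sup>2"] False by (simp add: power2_eq_square field_simps)
    then show ?thesis using False by (simp add: field_simps)
  qed
  then have "\<bar>?p\<bar>\<^sup>2 \<le> (?a * ?b)\<^sup>2" by (simp add: power_mult_distrib)
  then show ?thesis by (rule power2_le_imp_le) simp
qed


text \<open>Lets the factor contributed by one increment be evaluated at the almost sure bound of
  its norm.\<close>

lemma exp_diff_self_mono:
  fixes b c :: real assumes "0 \<le> b" "b \<le> c"
  shows "exp b - b \<le> exp c - c"
proof -
  have "c - b \<le> exp (c - b) - 1" using exp_ge_add_one_self[of "c - b"] by linarith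
  then have "(c - b) * 1 \<le> (exp (c - b) - 1) * exp b"
    using assms by (intro mult_mono) auto
  also have "\<dots> = exp c - exp b" by (simp add: algebra_simps exp_diff)
  finally show ?thesis by simp
qed

section \<open>Concentration of sums of independent random fields\<close>

text \<open>\<open>Q\<close> is a law on labels of fields and \<open>D y\<close> the field labelled
  y. Centering is pointwise in x, so no vector-valued expectation occurs; its weak form in
  \<open>L2\<close> is \<open>mean_inner\<close>.\<close>

locale centered_field =
  Q: prob_space Q + \<mu>: prob_space \<mu>
  for Q :: "'e measure" and \<mu> :: "'b measure" +
  fixes D :: "'e \<Rightarrow> 'b \<Rightarrow> 'a::euclidean_space" and M :: real
  assumes measurable_field: "case_prod D \<in> borel_measurable (Q \<Otimes>\<^sub>M \<mu>)"
    and M_pos: "0 < M"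
    and field_bound: "AE y in Q. L2_norm_sq \<mu> (D y) \<le> ennreal (M\<^sup>2)"
    and field_centered: "AE x in \<mu>. integrable Q (\<lambda>y. D y x) \<and> (\<integral>y. D y x \<partial>Q) = 0"
begin

lemma measurable_field' [measurable (raw)]:
  assumes "f \<in> measurable N Q" "g \<in> measurable N \<mu>"
  shows "(\<lambda>p. D (f p) (g p)) \<in> borel_measurable N"
  using measurable_compose[OF measurable_Pair[OF assms] measurable_field] by simp

lemma AE_field_L2: "AE y in Q. D y \<in> L2 \<mu> \<and> L2_norm \<mu> (D y) \<le> M"
  using field_bound AE_space
proof eventually_elim
  case (elim y)
  have [measurable]: "D y \<in> borel_measurable \<mu>"
    by (rule measurable_field'[of "\<lambda>_. y" \<mu> "\<lambda>x. x"]) (use elim in auto)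
  have "L2_norm_sq \<mu> (D y) < \<infinity>"
    using elim(1) by (rule le_less_trans) simp
  then have *: "D y \<in> L2 \<mu>" by (simp add: L2_iff_nn_integral)
  have "(L2_norm \<mu> (D y))\<^sup>2 \<le> M\<^sup>2"
    using elim(1) unfolding L2_norm_sq_eq[OF *] by (simp add: ennreal_le_iff)
  then have "L2_norm \<mu> (D y) \<le> M"
    by (rule power2_le_imp_le) (use M_pos in simp)
  with * show ?case by simp
qed

text \<open>Fubini moves the expectation inside, where it vanishes pointwise. Joint integrability
  comes from |s . D| <= |s|^2 + |D|^2 and the almost sure bound.\<close>

lemma mean_inner:
  assumes s: "s \<in> L2 \<mu>"
  shows "integrable Q (\<lambda>y. \<integral>x. s x \<bullet> D y x \<partial>\<mu>)" "(\<integral>y. (\<integral>x. s x \<bullet> D y x \<partial>\<mu>) \<partial>Q) = 0"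
proof -
  interpret pair_sigma_finite Q \<mu> ..
  have [measurable]: "s \<in> borel_measurable \<mu>" using s by (rule L2_measurable)
  have int: "integrable (Q \<Otimes>\<^sub>M \<mu>) (\<lambda>(y, x). s x \<bullet> D y x)"
  proof (rule integrableI_bounded)
    have "(\<integral>\<^sup>+p. ennreal (norm (case p of (y, x) \<Rightarrow> s x \<bullet> D y x)) \<partial>(Q \<Otimes>\<^sub>M \<mu>))
      = (\<integral>\<^sup>+y. (\<integral>\<^sup>+x. ennreal (norm (s x \<bullet> D y x)) \<partial>\<mu>) \<partial>Q)"
      by (subst \<mu>.nn_integral_fst[symmetric]) auto
    also have "\<dots> \<le> (\<integral>\<^sup>+y. ennreal ((L2_norm \<mu> s)\<^sup>2 + M\<^sup>2) \<partial>Q)"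
    proof (rule nn_integral_mono_AE, use AE_field_L2 in eventually_elim)
      case (elim y)
      have "\<bar>s x \<bullet> D y x\<bar> \<le> (norm (s x))\<^sup>2 + (norm (D y x))\<^sup>2" for x
        using Cauchy_Schwarz_ineq2[of "s x" "D y x"] sum_squares_bound[of "norm (s x)" "norm (D y x)"]
          mult_nonneg_nonneg[OF norm_ge_zero norm_ge_zero, of "s x" "D y x"] by linarith
      then have "(\<integral>\<^sup>+x. ennreal (norm (s x \<bullet> D y x)) \<partial>\<mu>)
          \<le> (\<integral>\<^sup>+x. ennreal ((norm (s x))\<^sup>2 + (norm (D y x))\<^sup>2) \<partial>\<mu>)"
        by (intro nn_integral_mono ennreal_leI) auto
      also have "\<dots> = ennreal ((L2_norm \<mu> s)\<^sup>2 + (L2_norm \<mu> (D y))\<^sup>2)"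
        unfolding L2_norm_sq_real using s elim
        by (subst nn_integral_eq_integral) (auto simp: L2_integrable_norm_sq)
      also have "\<dots> \<le> ennreal ((L2_norm \<mu> s)\<^sup>2 + M\<^sup>2)"
        using elim by (intro ennreal_leI add_left_mono power_mono) auto
      finally show ?case .
    qed
    also have "\<dots> < \<infinity>" by (simp add: Q.emeasure_space_1)
    finally show "(\<integral>\<^sup>+p. ennreal (norm (case p of (y, x) \<Rightarrow> s x \<bullet> D y x)) \<partial>(Q \<Otimes>\<^sub>M \<mu>)) < \<infinity>" .
  qed measurable
  show "integrable Q (\<lambda>y. \<integral>x. s x \<bullet> D y x \<partial>\<mu>)"
    using integrable_fst[OF int] by simp
  have "(\<integral>y. (\<integral>x. s x \<bullet> D y x \<partial>\<mu>) \<partial>Q) = (\<integral>x. (\<integral>y. s x \<bullet> D y x \<partial>Q) \<partial>\<mu>)"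
    using Fubini_integral[OF int] by simp
  also have "\<dots> = (\<integral>x. 0 \<partial>\<mu>)"
    by (intro integral_cong_AE, measurable, use field_centered in eventually_elim) auto
  finally show "(\<integral>y. (\<integral>x. s x \<bullet> D y x \<partial>\<mu>) \<partial>Q) = 0" by simp
qed

text \<open>Pinelis' inequality: the term of \<open>cosh_add_vector_le\<close> that is linear in the increment
  averages to zero, so \<open>cosh (l * \<parallel>\<cdot>\<parallel>)\<close> grows at most by a constant factor per summand.\<close>

lemma cosh_step:
  assumes s: "s \<in> L2 \<mu>" and l: "0 < l"
  shows "(\<integral>\<^sup>+y. ennreal (cosh (l * L2_norm \<mu> (\<lambda>x. s x + D y x))) \<partial>Q)
    \<le> ennreal (exp (l * M) - l * M) * ennreal (cosh (l * L2_norm \<mu> s))"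
proof -
  define a where "a = l * L2_norm \<mu> s"
  define k where "k = (if a = 0 then 0 else sinh a / a) * l\<^sup>2"
  define C where "C = cosh a * (exp (l * M) - l * M)"
  define p where "p y = (\<integral>x. s x \<bullet> D y x \<partial>\<mu>)" for y
  have le: "AE y in Q. cosh (l * L2_norm \<mu> (\<lambda>x. s x + D y x)) \<le> C + k * p y"
    using AE_field_L2
  proof eventually_elim
    case (elim y)
    define b where "b = l * L2_norm \<mu> (D y)"
    have "l * L2_norm \<mu> (\<lambda>x. s x + D y x) = sqrt (a\<^sup>2 + 2 * (l\<^sup>2 * p y) + b\<^sup>2)"
    proof -
      have "(l * L2_norm \<mu> (\<lambda>x. s x + D y x))\<^sup>2 = a\<^sup>2 + 2 * (l\<^sup>2 * p y) + b\<^sup>2"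
        using L2_norm_add_sq[OF s, of "D y"] elim
        by (simp add: a_def b_def p_def power_mult_distrib algebra_simps)
      then show ?thesis using l by (metis L2_norm_nonneg less_imp_le mult_nonneg_nonneg real_sqrt_unique)
    qed
    moreover have "cosh (sqrt (a\<^sup>2 + 2 * (l\<^sup>2 * p y) + b\<^sup>2))
        \<le> cosh a * (exp b - b) + (if a = 0 then 0 else sinh a / a * (l\<^sup>2 * p y))"
    proof (rule cosh_add_vector_le)
      have "\<bar>l\<^sup>2 * p y\<bar> \<le> l\<^sup>2 * (L2_norm \<mu> s * L2_norm \<mu> (D y))"
        unfolding abs_mult p_def using L2_Cauchy_Schwarz[OF s, of "D y"] elim
        by (auto intro!: mult_left_mono)
      then show "\<bar>l\<^sup>2 * p y\<bar> \<le> a * b" by (simp add: a_def b_def power2_eq_square mult_ac)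
    qed (use l in \<open>auto simp: a_def b_def\<close>)
    moreover have "cosh a * (exp b - b) \<le> C"
      unfolding C_def using elim l
      by (intro mult_left_mono exp_diff_self_mono) (auto simp: b_def)
    ultimately show ?case by (auto simp: k_def mult_ac)
  qed
  have int: "integrable Q (\<lambda>y. C + k * p y)" "(\<integral>y. C + k * p y \<partial>Q) = C"
    using mean_inner[OF s] by (auto simp: p_def Q.prob_space)
  have nn: "AE y in Q. 0 \<le> C + k * p y"
    using le by eventually_elim (metis cosh_real_nonneg order_trans)
  have "(\<integral>\<^sup>+y. ennreal (cosh (l * L2_norm \<mu> (\<lambda>x. s x + D y x))) \<partial>Q)
      \<le> (\<integral>\<^sup>+y. ennreal (C + k * p y) \<partial>Q)"
    using le by (intro nn_integral_mono_AE) (auto intro: ennreal_leI)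
  also have "\<dots> = ennreal C"
    using nn_integral_eq_integral[OF int(1) nn] int(2) by simp
  also have "\<dots> = ennreal (exp (l * M) - l * M) * ennreal (cosh a)"
    unfolding C_def by (subst ennreal_mult'[symmetric]) (smt (verit) exp_ge_add_one_self, simp add: mult.commute)
  finally show ?thesis by (simp add: a_def)
qed

text \<open>In the product space one coordinate is integrated with the others frozen, so the factors
  of \<open>cosh_step\<close> multiply without filtrations or conditional expectations.\<close>

lemma cosh_sum:
  fixes K :: "nat set"
  assumes "finite K" and l: "0 < l"
  shows "(\<integral>\<^sup>+z. ennreal (cosh (l * L2_norm \<mu> (\<lambda>x. \<Sum>j\<in>K. D (z j) x))) \<partial>(\<Pi>\<^sub>M j\<in>K. Q))
    \<le> ennreal (exp (l * M) - l * M) ^ card K"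
  using assms(1)
proof (induction K)
  case empty
  then show ?case by (simp add: L2_norm_def PiM_empty nn_integral_count_space_finite)
next
  case (insert i K)
  interpret product_sigma_finite "\<lambda>_::nat. Q" by standard
  let ?c = "\<lambda>K z. ennreal (cosh (l * L2_norm \<mu> (\<lambda>x. \<Sum>j\<in>K. D (z j) x)))"
  have [measurable]: "?c K' \<in> borel_measurable (\<Pi>\<^sub>M j\<in>K'. Q)" for K' :: "nat set"
    unfolding L2_norm_def by measurable
  have "AE z in (\<Pi>\<^sub>M j\<in>K. Q). \<forall>j\<in>K. D (z j) \<in> L2 \<mu>"
    using insert.hyps(1) AE_field_L2 by (intro AE_finite_allI AE_PiM_component Q.prob_space_axioms) auto
  then have L: "AE z in (\<Pi>\<^sub>M j\<in>K. Q). (\<lambda>x. \<Sum>j\<in>K. D (z j) x) \<in> L2 \<mu>"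
    by eventually_elim auto
  have eq: "(\<lambda>x. \<Sum>j\<in>insert i K. D ((z(i := y)) j) x) = (\<lambda>x. (\<Sum>j\<in>K. D (z j) x) + D y x)" for z y
    using insert.hyps by (auto simp: add.commute intro!: ext sum.cong)
  have "integral\<^sup>N (\<Pi>\<^sub>M j\<in>insert i K. Q) (?c (insert i K))
      = (\<integral>\<^sup>+z. (\<integral>\<^sup>+y. ?c (insert i K) (z(i := y)) \<partial>Q) \<partial>(\<Pi>\<^sub>M j\<in>K. Q))"
    by (rule product_nn_integral_insert[OF insert.hyps]) measurable
  also have "\<dots> \<le> (\<integral>\<^sup>+z. ennreal (exp (l * M) - l * M) * ?c K z \<partial>(\<Pi>\<^sub>M j\<in>K. Q))"
    unfolding eq using L by (intro nn_integral_mono_AE) (auto elim!: eventually_mono intro: cosh_step[OF _ l])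
  also have "\<dots> = ennreal (exp (l * M) - l * M) * (\<integral>\<^sup>+z. ?c K z \<partial>(\<Pi>\<^sub>M j\<in>K. Q))"
    by (rule nn_integral_cmult) measurable
  also have "\<dots> \<le> ennreal (exp (l * M) - l * M) * ennreal (exp (l * M) - l * M) ^ card K"
    by (intro mult_left_mono insert.IH) auto
  finally show ?case using insert.hyps by simp
qed

text \<open>Markov's inequality for \<open>cosh\<close>, computed under the joint law, which
  independence makes a product.\<close>

lemma tail_bound:
  fixes Z :: "nat \<Rightarrow> 'w \<Rightarrow> 'e"
  assumes P: "prob_space P" and E: "sets E = sets Q"
    and indep: "prob_space.indep_vars P (\<lambda>_. E) Z {1..}"
    and law: "\<And>j. 1 \<le> j \<Longrightarrow> distr P E (Z j) = Q"
    and J: "1 \<le> J" and r: "0 < r"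
  shows "{\<omega> \<in> space P. r * M \<le> L2_norm \<mu> (\<lambda>x. (1 / real J) *\<^sub>R (\<Sum>j=1..J. D (Z j \<omega>) x))} \<in> sets P" (is "?A \<in> _")
    and "measure P {\<omega> \<in> space P. r * M \<le> L2_norm \<mu> (\<lambda>x. (1 / real J) *\<^sub>R (\<Sum>j=1..J. D (Z j \<omega>) x))}
      \<le> 2 * exp (- (real J * (r\<^sup>2 / (2 + r))))"
proof -
  interpret P: prob_space P by fact
  let ?K = "{1..J}"
  have Z [measurable]: "Z j \<in> measurable P Q" if "j \<in> ?K" for j
    using indep that measurable_cong_sets[OF refl E, of P] unfolding P.indep_vars_def by auto
  have joint: "distr P (\<Pi>\<^sub>M j\<in>?K. E) (\<lambda>\<omega>. \<lambda>j\<in>?K. Z j \<omega>) = (\<Pi>\<^sub>M j\<in>?K. Q)"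
  proof -
    have "distr P (\<Pi>\<^sub>M j\<in>?K. E) (\<lambda>\<omega>. \<lambda>j\<in>?K. Z j \<omega>) = (\<Pi>\<^sub>M j\<in>?K. distr P E (Z j))"
      using J indep measurable_cong_sets[OF refl E, of P] Z
      by (intro P.indep_vars_iff_distr_eq_PiM'[THEN iffD1]) (auto intro: P.indep_vars_subset)
    also have "\<dots> = (\<Pi>\<^sub>M j\<in>?K. Q)" using law by (intro PiM_cong) auto
    finally show ?thesis .
  qed
  \<comment> \<open>The minimizer in l of exp (l M) - 1 - l M - l r M.\<close>
  define l where "l = ln (1 + r) / M"
  have l: "0 < l" using r M_pos by (simp add: l_def)
  let ?V = "\<lambda>\<omega>. L2_norm \<mu> (\<lambda>x. \<Sum>j\<in>?K. D (Z j \<omega>) x)"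
  let ?c = "\<lambda>z. ennreal (cosh (l * L2_norm \<mu> (\<lambda>x. \<Sum>j\<in>?K. D (z j) x)))"
  have V [measurable]: "?V \<in> borel_measurable P"
    unfolding L2_norm_def by measurable
  have A_eq: "?A = {\<omega> \<in> space P. real J * r * M \<le> ?V \<omega>}"
    unfolding L2_norm_scaleR using J by (auto simp: field_simps)
  show A [measurable]: "?A \<in> sets P" unfolding A_eq by measurable
  \<comment> \<open>The 2 is that of exp v <= 2 cosh v; the exponential belongs to the threshold on
    the sum, J times that on the mean.\<close>
  define \<gamma> where "\<gamma> = 2 * exp (- (l * (real J * r * M)))"
  have "emeasure P ?A = (\<integral>\<^sup>+\<omega>. indicator ?A \<omega> \<partial>P)"
    using A by (rule nn_integral_indicator[symmetric])
  also have "\<dots> \<le> (\<integral>\<^sup>+\<omega>. ennreal \<gamma> * ?c (\<lambda>j\<in>?K. Z j \<omega>) \<partial>P)"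
  proof (intro nn_integral_mono)
    fix \<omega> assume "\<omega> \<in> space P"
    show "indicator ?A \<omega> \<le> ennreal \<gamma> * ?c (\<lambda>j\<in>?K. Z j \<omega>)"
    proof (cases "\<omega> \<in> ?A")
      case True
      then have "real J * r * M \<le> ?V \<omega>" unfolding A_eq by simp
      then have "exp (l * (real J * r * M)) \<le> exp (l * ?V \<omega>)" using l by simp
      also have "\<dots> \<le> 2 * cosh (l * ?V \<omega>)"
        by (simp add: cosh_field_def)
      finally have "1 \<le> \<gamma> * cosh (l * ?V \<omega>)"
        by (simp add: \<gamma>_def exp_minus field_simps)
      then have "ennreal 1 \<le> ennreal (\<gamma> * cosh (l * ?V \<omega>))" by (rule ennreal_leI)
      then show ?thesis using True by (simp add: ennreal_mult'' \<gamma>_def)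
    qed simp
  qed
  also have "\<dots> = ennreal \<gamma> * (\<integral>\<^sup>+\<omega>. ?c (\<lambda>j\<in>?K. Z j \<omega>) \<partial>P)"
  proof (rule nn_integral_cmult)
    have "(\<lambda>\<omega>. ?c (\<lambda>j\<in>?K. Z j \<omega>)) = (\<lambda>\<omega>. ennreal (cosh (l * ?V \<omega>)))"
      by simp
    also have "\<dots> \<in> borel_measurable P" by measurable
    finally show "(\<lambda>\<omega>. ?c (\<lambda>j\<in>?K. Z j \<omega>)) \<in> borel_measurable P" .
  qed
  also have "(\<integral>\<^sup>+\<omega>. ?c (\<lambda>j\<in>?K. Z j \<omega>) \<partial>P) = (\<integral>\<^sup>+z. ?c z \<partial>distr P (\<Pi>\<^sub>M j\<in>?K. E) (\<lambda>\<omega>. \<lambda>j\<in>?K. Z j \<omega>))"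
  proof (rule nn_integral_distr[symmetric])
    have "?c \<in> borel_measurable (\<Pi>\<^sub>M j\<in>?K. Q)" unfolding L2_norm_def by measurable
    then show "?c \<in> borel_measurable (distr P (\<Pi>\<^sub>M j\<in>?K. E) (\<lambda>\<omega>. \<lambda>j\<in>?K. Z j \<omega>))"
      using joint by metis
    show "(\<lambda>\<omega>. \<lambda>j\<in>?K. Z j \<omega>) \<in> measurable P (\<Pi>\<^sub>M j\<in>?K. E)"
      using Z measurable_cong_sets[OF refl E, of P] by (intro measurable_restrict) auto
  qed
  also have "ennreal \<gamma> * (\<integral>\<^sup>+z. ?c z \<partial>distr P (\<Pi>\<^sub>M j\<in>?K. E) (\<lambda>\<omega>. \<lambda>j\<in>?K. Z j \<omega>))
      \<le> ennreal \<gamma> * ennreal (exp (l * M) - l * M) ^ J"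
    unfolding joint using cosh_sum[of ?K l] l by (intro mult_left_mono) auto
  also have "exp (l * M) - l * M = 1 + (r - ln (1 + r))"
    using r M_pos by (simp add: l_def)
  also have "ennreal \<gamma> * ennreal (1 + (r - ln (1 + r))) ^ J \<le> ennreal \<gamma> * ennreal (exp (r - ln (1 + r))) ^ J"
    by (intro mult_left_mono power_mono ennreal_leI exp_ge_add_one_self) auto
  also have "\<dots> = ennreal (\<gamma> * exp (r - ln (1 + r)) ^ J)"
    by (simp add: ennreal_power ennreal_mult'' \<gamma>_def)
  also have "\<gamma> * exp (r - ln (1 + r)) ^ J = 2 * exp (real J * (r - (1 + r) * ln (1 + r)))"
    using M_pos by (simp add: \<gamma>_def l_def exp_of_nat_mult[symmetric] mult.assoc exp_add[symmetric] algebra_simps)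
  also have "\<dots> \<le> 2 * exp (- (real J * (r\<^sup>2 / (2 + r))))"
    using mult_left_mono[OF bennett_exponent_le[OF r], of "real J"] by simp
  finally show "measure P ?A \<le> 2 * exp (- (real J * (r\<^sup>2 / (2 + r))))"
    by (simp add: P.emeasure_eq_measure ennreal_leI)
qed

text \<open>For fixed r the tail bounds are geometric in J, hence summable.\<close>

lemma average_tendsto_0:
  fixes Z :: "nat \<Rightarrow> 'w \<Rightarrow> 'e"
  assumes P: "prob_space P" and E: "sets E = sets Q"
    and indep: "prob_space.indep_vars P (\<lambda>_. E) Z {1..}"
    and law: "\<And>j. 1 \<le> j \<Longrightarrow> distr P E (Z j) = Q"
  shows "AE \<omega> in P. (\<lambda>J. L2_norm \<mu> (\<lambda>x. (1 / real J) *\<^sub>R (\<Sum>j=1..J. D (Z j \<omega>) x))) \<longlonglongrightarrow> 0"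
proof -
  interpret P: prob_space P by fact
  let ?V = "\<lambda>J \<omega>. L2_norm \<mu> (\<lambda>x. (1 / real J) *\<^sub>R (\<Sum>j=1..J. D (Z j \<omega>) x))"
  have "AE \<omega> in P. eventually (\<lambda>J. ?V J \<omega> < r * M) sequentially" if r: "0 < r" for r
  proof -
    \<comment> \<open>Shifted by one because the tail bound starts at J = 1.\<close>
    define A where "A J = {\<omega> \<in> space P. r * M \<le> ?V (Suc J) \<omega>}" for J
    define \<rho> where "\<rho> = exp (- (r\<^sup>2 / (2 + r)))"
    note tb = tail_bound[OF P E indep law _ r]
    have m: "A J \<in> sets P" for J using tb(1)[of "Suc J"] by (simp add: A_def)
    have "AE \<omega> in P. eventually (\<lambda>J. \<omega> \<in> space P - A J) sequentially"
    proof (rule borel_cantelli_AE1[OF m])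
      show "emeasure P (A n) < \<infinity>" for n by (simp add: P.emeasure_eq_measure)
      have \<rho>: "0 < \<rho>" "\<rho> < 1" using r by (auto simp: \<rho>_def)
      show "summable (\<lambda>n. measure P (A n))"
      proof (rule summable_comparison_test)
        show "\<exists>N. \<forall>n\<ge>N. norm (measure P (A n)) \<le> 2 * \<rho> ^ Suc n"
        proof (intro exI allI impI)
          fix n :: nat
          show "norm (measure P (A n)) \<le> 2 * \<rho> ^ Suc n"
            using tb(2)[of "Suc n"] by (simp add: A_def \<rho>_def exp_of_nat_mult[symmetric] del: power_Suc)
        qed
        show "summable (\<lambda>n. 2 * \<rho> ^ Suc n)"
          using \<rho> by (intro summable_mult summable_Suc_iff[THEN iffD2] summable_geometric) auto
      qed
    qed
    then show ?thesis
    proof eventually_elim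
      case (elim \<omega>)
      then have "eventually (\<lambda>J. ?V (Suc J) \<omega> < r * M) sequentially"
        by eventually_elim (auto simp: A_def)
      then show ?case by (rule eventually_sequentially_Suc[THEN iffD1])
    qed
  qed
  note eventually_small = this
  \<comment> \<open>Radii M / (k + 1) suffice, and countably many statements share one null
    set.\<close>
  have "AE \<omega> in P. \<forall>k::nat. eventually (\<lambda>J. ?V J \<omega> < (1 / real (Suc k)) * M) sequentially"
    unfolding AE_all_countable by (intro allI eventually_small) simp
  then show ?thesis
  proof eventually_elim
    case (elim \<omega>)
    show ?case
    proof (rule order_tendstoI)
      fix a :: real assume "a < 0"
      then show "eventually (\<lambda>J. a < ?V J \<omega>) sequentially"
        by (intro always_eventually allI) (meson L2_norm_nonneg less_le_trans)
    next
      fix a :: real assume "0 < a"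
      then obtain k where k: "1 / real (Suc k) < a / M"
        using nat_approx_posE[of "a / M"] M_pos by auto
      then have k: "(1 / real (Suc k)) * M < a" using M_pos by (simp only: pos_less_divide_eq)
      have "eventually (\<lambda>J. ?V J \<omega> < (1 / real (Suc k)) * M) sequentially" using elim by blast
      then show "eventually (\<lambda>J. ?V J \<omega> < a) sequentially"
        by eventually_elim (rule less_trans[OF _ k])
    qed
  qed
qed

end

section \<open>Gradients of convex functions\<close>

definition convex_gradient :: "'a::euclidean_space set \<Rightarrow> ('a \<Rightarrow> real) \<Rightarrow> ('a \<Rightarrow> 'a) \<Rightarrow> bool" where
  "convex_gradient I \<phi> S \<longleftrightarrow> convex_on I \<phi> \<and>
     (\<forall>x\<in>I. (\<phi> has_derivative (\<lambda>h. S x \<bullet> h)) (at x within I))"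

lemma GCF_convex_gradient: "S \<in> GCF I \<Longrightarrow> \<exists>\<phi>. convex_gradient I \<phi> S"
  by (auto simp: GCF_def convex_gradient_def)

lemma convex_gradient_cong:
  "convex_gradient I \<phi> S \<Longrightarrow> (\<And>x. x \<in> I \<Longrightarrow> S x = S' x) \<Longrightarrow> convex_gradient I \<phi> S'"
  by (simp add: convex_gradient_def)

text \<open>At a boundary point only directions towards other points of \<open>I\<close> are usable,
  so the derivative is taken along the segment from x to y. A sequence of step sizes makes the limit
  usable for measurability.\<close>

lemma difference_quotient_tendsto:
  fixes x y :: "'a::euclidean_space"
  assumes I: "convex I" "x \<in> I" "y \<in> I"
    and d: "(\<phi> has_derivative (\<lambda>h. s \<bullet> h)) (at x within I)"
  shows "(\<lambda>n. real (Suc n) * (\<phi> (x + (1 / real (Suc n)) *\<^sub>R (y - x)) - \<phi> x)) \<longlonglongrightarrow> s \<bullet> (y - x)"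
proof -
  let ?g = "\<lambda>t::real. x + t *\<^sub>R (y - x)"
  have sub: "?g ` {0..1} \<subseteq> I"
  proof clarify
    fix t :: real assume "t \<in> {0..1}"
    then show "?g t \<in> I" using convexD_alt[OF I, of t] by (simp add: algebra_simps)
  qed
  have "((\<lambda>t. \<phi> (?g t)) has_derivative (\<lambda>t. s \<bullet> (t *\<^sub>R (y - x)))) (at 0 within {0..1})"
  proof (rule has_derivative_in_compose[where g = \<phi> and f = ?g])
    show "(?g has_derivative (\<lambda>t. t *\<^sub>R (y - x))) (at 0 within {0..1})"
      by (auto intro!: derivative_eq_intros)
    show "(\<phi> has_derivative (\<lambda>h. s \<bullet> h)) (at (?g 0) within ?g ` {0..1})"
      using has_derivative_subset[OF d sub] by simp
  qed
  then have "((\<lambda>t. \<phi> (?g t)) has_field_derivative s \<bullet> (y - x)) (at 0 within {0..1})"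
    unfolding has_field_derivative_def by (rule has_derivative_eq_rhs) (auto simp: mult.commute)
  then have lim: "((\<lambda>t. (\<phi> (?g t) - \<phi> x) / t) \<longlongrightarrow> s \<bullet> (y - x)) (at 0 within {0..1})"
    by (simp add: has_field_derivative_iff)
  have "filterlim (\<lambda>n. 1 / real (Suc n)) (at 0 within {0..1}) sequentially"
    unfolding filterlim_at using LIMSEQ_inverse_real_of_nat
    by (auto simp: inverse_eq_divide intro!: always_eventually)
  from filterlim_compose[OF lim this] show ?thesis
    by (simp add: mult.commute)
qed

context
  fixes I :: "'a::euclidean_space set" and \<phi> S
  assumes grad: "convex_gradient I \<phi> S"
begin

lemma gradient_convex: "convex I"
  using grad by (auto simp: convex_gradient_def convex_on_def)

lemma gradient_quotient_tendsto:
  "x \<in> I \<Longrightarrow> y \<in> I \<Longrightarrow>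
    (\<lambda>n. real (Suc n) * (\<phi> (x + (1 / real (Suc n)) *\<^sub>R (y - x)) - \<phi> x)) \<longlonglongrightarrow> S x \<bullet> (y - x)"
  using grad gradient_convex by (intro difference_quotient_tendsto) (auto simp: convex_gradient_def)

lemma segment_mem:
  "x \<in> I \<Longrightarrow> y \<in> I \<Longrightarrow> x + (1 / real (Suc n)) *\<^sub>R (y - x) \<in> I"
  using convexD_alt[OF gradient_convex, of x y "1 / real (Suc n)"] by (simp add: algebra_simps)

lemma subgradient:
  assumes "x \<in> I" "y \<in> I"
  shows "\<phi> x + S x \<bullet> (y - x) \<le> \<phi> y"
proof -
  have "S x \<bullet> (y - x) \<le> \<phi> y - \<phi> x"
  proof (rule LIMSEQ_le_const2[OF gradient_quotient_tendsto[OF assms]], intro exI allI impI)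
    fix n :: nat
    let ?t = "1 / real (Suc n)"
    have "\<phi> (x + ?t *\<^sub>R (y - x)) \<le> (1 - ?t) * \<phi> x + ?t * \<phi> y"
    proof -
      have "x + ?t *\<^sub>R (y - x) = (1 - ?t) *\<^sub>R x + ?t *\<^sub>R y" by (simp only: algebra_simps scaleR_one)
      then show ?thesis
        using grad convex_onD[of I \<phi> ?t x y] assms by (simp only: convex_gradient_def) simp
    qed
    then have "\<phi> (x + ?t *\<^sub>R (y - x)) - \<phi> x \<le> ?t * (\<phi> y - \<phi> x)"
      by (simp only: left_diff_distrib right_diff_distrib)
    then have "real (Suc n) * (\<phi> (x + ?t *\<^sub>R (y - x)) - \<phi> x) \<le> real (Suc n) * (?t * (\<phi> y - \<phi> x))"
      by (intro mult_left_mono) auto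
    then show "real (Suc n) * (\<phi> (x + ?t *\<^sub>R (y - x)) - \<phi> x) \<le> \<phi> y - \<phi> x" by simp
  qed
  then show ?thesis by simp
qed

text \<open>Comparison with directional derivatives gives p . h <= S x . h for every h pointing into
  \<open>I\<close>; at an interior point a multiple of p - S x is such an h.\<close>

lemma subgradient_unique:
  assumes x: "x \<in> interior I" and p: "\<And>y. y \<in> I \<Longrightarrow> \<phi> x + p \<bullet> (y - x) \<le> \<phi> y"
  shows "p = S x"
proof (rule ccontr)
  assume "p \<noteq> S x"
  have xI: "x \<in> I" using x interior_subset by blast
  have le: "p \<bullet> (y - x) \<le> S x \<bullet> (y - x)" if y: "y \<in> I" for y
  proof (rule LIMSEQ_le_const[OF gradient_quotient_tendsto[OF xI y]], intro exI allI impI)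
    fix n :: nat
    let ?t = "1 / real (Suc n)"
    have "p \<bullet> (?t *\<^sub>R (y - x)) \<le> \<phi> (x + ?t *\<^sub>R (y - x)) - \<phi> x"
      using p[OF segment_mem[OF xI y, of n]] by simp
    then have "real (Suc n) * (p \<bullet> (?t *\<^sub>R (y - x))) \<le> real (Suc n) * (\<phi> (x + ?t *\<^sub>R (y - x)) - \<phi> x)"
      by (intro mult_left_mono) auto
    then show "p \<bullet> (y - x) \<le> real (Suc n) * (\<phi> (x + ?t *\<^sub>R (y - x)) - \<phi> x)" by simp
  qed
  obtain e where e: "0 < e" "cball x e \<subseteq> I" using x by (auto simp: mem_interior_cball)
  define y where "y = x + (e / norm (p - S x)) *\<^sub>R (p - S x)"
  have "y \<in> I" using e \<open>p \<noteq> S x\<close> by (intro subsetD[OF e(2)]) (auto simp: y_def dist_norm)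
  from le[OF this] have "(p - S x) \<bullet> (y - x) \<le> 0" by (simp add: inner_diff_left)
  then have "e / norm (p - S x) * ((p - S x) \<bullet> (p - S x)) \<le> 0" by (simp add: y_def)
  moreover have "0 < e / norm (p - S x) * ((p - S x) \<bullet> (p - S x))"
    using e \<open>p \<noteq> S x\<close> by (intro mult_pos_pos divide_pos_pos) auto
  ultimately show False by simp
qed

lemma potential_continuous: "continuous_on I \<phi>"
  using grad by (auto simp: convex_gradient_def intro!: has_derivative_continuous_on)

text \<open>By convexity a directional derivative lies below every difference quotient, and a
  quotient of fixed step is continuous in the base point. One quotient close to the derivative at x
  therefore bounds all nearby ones.\<close>

lemma gradient_usc:
  assumes x: "x \<in> interior I" and e: "0 < e"
  shows "eventually (\<lambda>y. S y \<bullet> v < S x \<bullet> v + e) (at x)"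
proof -
  have xI: "x \<in> I" using x interior_subset by blast
  obtain r where r: "0 < r" "cball x r \<subseteq> interior I"
    using x open_contains_cball[of "interior I"] by auto
  \<comment> \<open>Scales v so that x + w stays in the ball; the 1 covers v = 0.\<close>
  define \<rho> where "\<rho> = r / (norm v + 1)"
  have \<rho>: "0 < \<rho>" using r by (simp add: \<rho>_def add_nonneg_pos)
  define w where "w = \<rho> *\<^sub>R v"
  have nw: "norm w \<le> r"
    using r by (simp add: w_def \<rho>_def divide_le_eq add_nonneg_pos mult_left_mono)
  then have "x + w \<in> cball x r" by (simp add: dist_norm)
  then have xw: "x + w \<in> I" using r(2) interior_subset[of I] by blast
  have "eventually (\<lambda>n. real (Suc n) * (\<phi> (x + (1 / real (Suc n)) *\<^sub>R w) - \<phi> x) < S x \<bullet> w + \<rho> * e) sequentially"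
    using order_tendstoD(2)[OF gradient_quotient_tendsto[OF xI xw], of "S x \<bullet> w + \<rho> * e"] \<rho> e by simp
  then obtain n where n: "real (Suc n) * (\<phi> (x + (1 / real (Suc n)) *\<^sub>R w) - \<phi> x) < S x \<bullet> w + \<rho> * e"
    by (auto simp: eventually_sequentially)
  define u where "u = (1 / real (Suc n)) *\<^sub>R w"
  let ?f = "\<lambda>y. real (Suc n) * (\<phi> (y + u) - \<phi> y)"
  have xu: "x + u \<in> interior I"
  proof -
    have "norm u \<le> norm w" by (simp add: u_def) (simp add: divide_le_eq mult_le_cancel_left1)
    then show ?thesis using nw r(2) by (auto simp: dist_norm)
  qed
  have cont: "isCont \<phi> z" if "z \<in> interior I" for z
    using potential_continuous that by (meson continuous_on_interior)
  have "isCont ?f x"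
    using cont[OF x] isCont_o2[of x "\<lambda>y. y + u" \<phi>] cont[OF xu] by (intro continuous_intros) auto
  then have "(?f \<longlongrightarrow> ?f x) (at x)" by (simp add: isCont_def)
  then have 1: "eventually (\<lambda>y. ?f y < S x \<bullet> w + \<rho> * e) (at x)"
    using n by (intro order_tendstoD) (auto simp: u_def)
  have 2: "eventually (\<lambda>y. y \<in> interior I) (at x)"
    using x by (intro eventually_at_in_open') auto
  have "((\<lambda>y. y + u) \<longlongrightarrow> x + u) (at x)" by (intro tendsto_intros)
  then have 3: "eventually (\<lambda>y. y + u \<in> interior I) (at x)"
    using xu by (rule topological_tendstoD[OF _ open_interior])
  show ?thesis using 1 2 3
  proof eventually_elim
    case (elim y)
    have "S y \<bullet> u \<le> \<phi> (y + u) - \<phi> y"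
      using subgradient[of y "y + u"] elim subsetD[OF interior_subset] by (auto simp: algebra_simps)
    then have "real (Suc n) * (S y \<bullet> u) \<le> ?f y" by (intro mult_left_mono) auto
    then have "S y \<bullet> w < S x \<bullet> w + \<rho> * e" using elim(1) by (simp add: u_def)
    then have "\<rho> * (S y \<bullet> v) < \<rho> * (S x \<bullet> v + e)" by (simp add: w_def algebra_simps)
    then show ?case using \<rho> by simp
  qed
qed

text \<open>Upper semicontinuity in direction -b is lower semicontinuity in direction b.\<close>

lemma gradient_continuous: "continuous_on (interior I) S"
proof (intro continuous_at_imp_continuous_on ballI)
  fix x assume x: "x \<in> interior I"
  have "((\<lambda>y. S y \<bullet> b) \<longlongrightarrow> S x \<bullet> b) (at x)" for b
  proof (rule order_tendstoI)
    fix a assume "a < S x \<bullet> b"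
    then show "eventually (\<lambda>y. a < S y \<bullet> b) (at x)"
      using gradient_usc[OF x, of "S x \<bullet> b - a" "- b"] by (auto elim: eventually_mono)
  next
    fix a assume "S x \<bullet> b < a"
    then show "eventually (\<lambda>y. S y \<bullet> b < a) (at x)"
      using gradient_usc[OF x, of "a - S x \<bullet> b" b] by (auto elim: eventually_mono)
  qed
  then show "isCont S x" by (simp add: isCont_def tendsto_componentwise_iff[of S])
qed

text \<open>Boundary points are included, where continuity is not at hand. For fixed y, S x . (y -
  x) is a limit of functions continuous in x; two points y that differ by a multiple of b isolate S
  x . b.\<close>

lemma gradient_measurable:
  assumes ne: "interior I \<noteq> {}"
  shows "S \<in> borel_measurable (restrict_space borel I)"
proof -
  obtain x0 e where e: "0 < e" "cball x0 e \<subseteq> I" using ne by (auto simp: mem_interior_cball)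
  have m: "(\<lambda>x. S x \<bullet> (y - x)) \<in> borel_measurable (restrict_space borel I)" if y: "y \<in> I" for y
  proof (rule borel_measurable_LIMSEQ_real)
    show "(\<lambda>n. real (Suc n) * (\<phi> (x + (1 / real (Suc n)) *\<^sub>R (y - x)) - \<phi> x)) \<longlonglongrightarrow> S x \<bullet> (y - x)"
      if "x \<in> space (restrict_space borel I)" for x
      using gradient_quotient_tendsto[OF _ y] that by (simp add: space_restrict_space)
    show "(\<lambda>x. real (Suc n) * (\<phi> (x + (1 / real (Suc n)) *\<^sub>R (y - x)) - \<phi> x))
        \<in> borel_measurable (restrict_space borel I)" for n
      using y segment_mem
      by (intro borel_measurable_continuous_on_restrict continuous_intros potential_continuous
          continuous_on_compose2[OF potential_continuous, of I]) auto
  qed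
  have "(\<lambda>x. S x \<bullet> b) \<in> borel_measurable (restrict_space borel I)" if b: "b \<in> Basis" for b
  proof -
    have "x0 \<in> I" "x0 + e *\<^sub>R b \<in> I" using e b by (auto intro!: subsetD[OF e(2)] simp: dist_norm)
    from m[OF this(1)] m[OF this(2)]
    have "(\<lambda>x. (S x \<bullet> (x0 + e *\<^sub>R b - x) - S x \<bullet> (x0 - x)) / e) \<in> borel_measurable (restrict_space borel I)"
      by measurable
    also have "(\<lambda>x. (S x \<bullet> (x0 + e *\<^sub>R b - x) - S x \<bullet> (x0 - x)) / e) = (\<lambda>x. S x \<bullet> b)"
      using e by (auto simp: inner_diff_right inner_add_right)
    finally show ?thesis .
  qed
  then show ?thesis by (subst borel_measurable_euclidean_space) auto
qed

text \<open>If an interior point had a boundary point as image, the potential would be affine on a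
  segment in the direction normal to a supporting hyperplane there, against injectivity.\<close>

lemma gradient_maps_interior:
  assumes inj: "inj_on S I" and img: "S ` I \<subseteq> I" and x: "x \<in> interior I"
  shows "S x \<in> interior I"
proof (rule ccontr)
  assume ni: "S x \<notin> interior I"
  have xI: "x \<in> I" using x interior_subset by blast
  obtain a b where a: "a \<noteq> 0" "\<And>z. z \<in> interior I \<Longrightarrow> a \<bullet> z \<le> b" "b \<le> a \<bullet> S x"
    using separating_hyperplane_sets[of "interior I" "{S x}"] ni x gradient_convex
    by (auto simp: convex_interior)
  have "closure (interior I) \<subseteq> {z. a \<bullet> z \<le> b}"
    using a(2) by (intro closure_minimal closed_halfspace_le) auto
  then have "I \<subseteq> {z. a \<bullet> z \<le> b}"
    using convex_closure_interior[OF gradient_convex] x closure_subset[of I] by auto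
  then have support: "a \<bullet> z \<le> a \<bullet> S x" if "z \<in> I" for z using a(3) that by (metis (mono_tags) mem_Collect_eq order_trans subsetD)
  obtain r where r: "0 < r" "cball x r \<subseteq> interior I"
    using x open_contains_cball[of "interior I"] by auto
  define t where "t = r / norm a"
  have t: "0 < t" using r a by (simp add: t_def)
  define x' where "x' = x + t *\<^sub>R a"
  have x': "x' \<in> interior I" using r a by (intro subsetD[OF r(2)]) (auto simp: x'_def t_def dist_norm)
  then have x'I: "x' \<in> I" using interior_subset by blast
  have "\<phi> x' + S x' \<bullet> (x - x') \<le> \<phi> x" by (rule subgradient[OF x'I xI])
  then have "\<phi> x' \<le> \<phi> x + t * (a \<bullet> S x')" by (simp add: x'_def inner_commute)
  also have "\<dots> \<le> \<phi> x + t * (a \<bullet> S x)"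
    using support[of "S x'"] img x'I t by (intro add_left_mono mult_left_mono) auto
  finally have le: "\<phi> x' \<le> \<phi> x + S x \<bullet> (x' - x)" by (simp add: x'_def inner_commute)
  \<comment> \<open>The tangent at x touches \<phi> at x' as well, so its slope is a subgradient
    there.\<close>
  have "S x = S x'"
  proof (rule subgradient_unique[OF x'])
    fix y assume "y \<in> I"
    then show "\<phi> x' + S x \<bullet> (y - x') \<le> \<phi> y"
      using subgradient[OF xI, of y] le by (simp add: inner_diff_right)
  qed
  then have "x = x'" using inj xI x'I by (auto dest: inj_onD)
  then show False using t a by (simp add: x'_def)
qed

end

section \<open>Couplings\<close>

lemma couplingD:
  assumes "\<pi> \<in> couplings \<nu> \<mu>"
  shows coupling_sets: "sets \<pi> = sets (borel \<Otimes>\<^sub>M borel)" and coupling_prob: "prob_space \<pi>"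
    and coupling_fst: "distr \<pi> borel fst = \<nu>" and coupling_snd: "distr \<pi> borel snd = \<mu>"
  using assms by (auto simp: couplings_def)

lemma coupling_measurable [measurable_dest]:
  fixes \<nu> :: "'a::euclidean_space measure"
  assumes "\<pi> \<in> couplings \<nu> \<mu>"
  shows "fst \<in> measurable \<pi> borel" "snd \<in> measurable \<pi> borel"
  by (simp_all add: measurable_cong_sets[OF coupling_sets[OF assms] refl])

lemma coupling_AE_snd:
  fixes \<nu> :: "'a::euclidean_space measure"
  assumes \<pi>: "\<pi> \<in> couplings \<nu> \<mu>" and "AE x in \<mu>. P x"
  shows "AE z in \<pi>. P (snd z)"
  using assms(2) unfolding coupling_snd[OF \<pi>, symmetric] by (rule AE_distrD[OF coupling_measurable(2)[OF \<pi>]])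

lemma coupling_nn_integral:
  fixes \<nu> :: "'a::euclidean_space measure"
  assumes \<pi>: "\<pi> \<in> couplings \<nu> \<mu>" and f: "f \<in> borel_measurable borel"
  shows "(\<integral>\<^sup>+z. f (fst z) \<partial>\<pi>) = (\<integral>\<^sup>+x. f x \<partial>\<nu>)" "(\<integral>\<^sup>+z. f (snd z) \<partial>\<pi>) = (\<integral>\<^sup>+x. f x \<partial>\<mu>)"
  using nn_integral_distr[OF coupling_measurable(1)[OF \<pi>], of f]
    nn_integral_distr[OF coupling_measurable(2)[OF \<pi>], of f] f couplingD(3,4)[OF \<pi>] by auto

lemma coupling_integrable:
  fixes \<nu> :: "'a::euclidean_space measure" and f :: "'a \<Rightarrow> real"
  assumes \<pi>: "\<pi> \<in> couplings \<nu> \<mu>" and f: "f \<in> borel_measurable borel"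
  shows "integrable \<pi> (\<lambda>z. f (fst z)) \<longleftrightarrow> integrable \<nu> f" "integrable \<pi> (\<lambda>z. f (snd z)) \<longleftrightarrow> integrable \<mu> f"
    and "(\<integral>z. f (fst z) \<partial>\<pi>) = (\<integral>x. f x \<partial>\<nu>)" "(\<integral>z. f (snd z) \<partial>\<pi>) = (\<integral>x. f x \<partial>\<mu>)"
  using integrable_distr_eq[OF coupling_measurable(1)[OF \<pi>], of f]
    integrable_distr_eq[OF coupling_measurable(2)[OF \<pi>], of f]
    integral_distr[OF coupling_measurable(1)[OF \<pi>], of f]
    integral_distr[OF coupling_measurable(2)[OF \<pi>], of f] f couplingD(3,4)[OF \<pi>] by auto

lemma distr_coupling:
  fixes T S :: "'b \<Rightarrow> 'a::euclidean_space"
  assumes "prob_space \<mu>" and [measurable]: "T \<in> borel_measurable \<mu>" "S \<in> borel_measurable \<mu>"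
  shows "distr \<mu> (borel \<Otimes>\<^sub>M borel) (\<lambda>x. (T x, S x)) \<in> couplings (distr \<mu> borel T) (distr \<mu> borel S)"
  unfolding couplings_def
  by (auto simp: distr_distr comp_def intro!: prob_space.prob_space_distr assms(1))

lemma wasserstein2_sq_distr_le:
  fixes T S :: "'b \<Rightarrow> 'a::euclidean_space"
  assumes \<mu>: "prob_space \<mu>" and [measurable]: "T \<in> borel_measurable \<mu>" "S \<in> borel_measurable \<mu>"
  shows "wasserstein2_sq (distr \<mu> borel T) (distr \<mu> borel S) \<le> L2_norm_sq \<mu> (\<lambda>x. T x - S x)"
  unfolding wasserstein2_sq_def
proof (rule INF_lower2[OF distr_coupling[OF assms]])
  show "(\<integral>\<^sup>+z. ennreal ((norm (fst z - snd z))\<^sup>2) \<partial>distr \<mu> (borel \<Otimes>\<^sub>M borel) (\<lambda>x. (T x, S x)))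
      \<le> L2_norm_sq \<mu> (\<lambda>x. T x - S x)"
    by (subst nn_integral_distr) (auto simp: L2_norm_sq_def)
qed

text \<open>Moving the second coordinate by the inverse s puts the transport problems to all images
  of \<mu> over one base measure.\<close>

lemma coupling_lift:
  fixes t s :: "'a::euclidean_space \<Rightarrow> 'a"
  assumes \<mu>: "prob_space \<mu>" "sets \<mu> = sets borel"
    and [measurable]: "t \<in> borel_measurable borel" "s \<in> borel_measurable borel"
    and inv: "AE x in \<mu>. s (t x) = x"
    and \<pi>: "\<pi> \<in> couplings \<nu> (distr \<mu> borel t)"
  shows "\<exists>\<pi>'\<in>couplings \<nu> \<mu>. (\<integral>\<^sup>+z. ennreal ((norm (fst z - t (snd z)))\<^sup>2) \<partial>\<pi>')
    = (\<integral>\<^sup>+z. ennreal ((norm (fst z - snd z))\<^sup>2) \<partial>\<pi>)"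
proof -
  have [measurable_cong]: "sets \<mu> = sets borel" "sets \<pi> = sets (borel \<Otimes>\<^sub>M borel)"
    using \<mu> \<pi> by (auto dest: coupling_sets)
  define \<pi>' where "\<pi>' = distr \<pi> (borel \<Otimes>\<^sub>M borel) (\<lambda>z. (fst z, s (snd z)))"
  have "distr \<pi> borel (\<lambda>z. s (snd z)) = distr (distr \<pi> borel snd) borel s"
    by (simp add: distr_distr comp_def)
  also have "\<dots> = distr \<mu> borel (\<lambda>x. s (t x))"
    unfolding coupling_snd[OF \<pi>] by (simp add: distr_distr comp_def)
  also have "\<dots> = distr \<mu> borel (\<lambda>x. x)"
    using inv by (intro distr_cong_AE) auto
  also have "\<dots> = \<mu>" using \<mu>(2) by (simp add: distr_id2)
  finally have snd: "distr \<pi> borel (\<lambda>z. s (snd z)) = \<mu>" .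
  \<comment> \<open>Under the image measure only y = t x matters, where s (t x) = x gives the
    claim.\<close>
  have "AE y in distr \<mu> borel t. t (s y) = y"
    using inv by (subst AE_distr_iff) (auto elim: eventually_mono)
  from coupling_AE_snd[OF \<pi> this] have ts: "AE z in \<pi>. t (s (snd z)) = snd z" .
  show ?thesis
  proof (rule bexI)
    show "\<pi>' \<in> couplings \<nu> \<mu>"
      using snd coupling_fst[OF \<pi>] unfolding couplings_def \<pi>'_def
      by (auto simp: distr_distr comp_def intro!: prob_space.prob_space_distr coupling_prob[OF \<pi>])
    show "(\<integral>\<^sup>+z. ennreal ((norm (fst z - t (snd z)))\<^sup>2) \<partial>\<pi>')
        = (\<integral>\<^sup>+z. ennreal ((norm (fst z - snd z))\<^sup>2) \<partial>\<pi>)"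
      unfolding \<pi>'_def using ts
      by (subst nn_integral_distr) (auto intro!: nn_integral_cong_AE)
  qed
qed

text \<open>By |y|^2 <= 2 |z - y|^2 + 2 |z|^2 a coupling of finite cost would hand the finite second
  moment of \<nu> on to m.\<close>

lemma wasserstein2_sq_infinite:
  fixes \<nu> :: "'a::euclidean_space measure"
  assumes \<nu>: "\<nu> \<in> P2" and m: "(\<integral>\<^sup>+y. ennreal ((norm y)\<^sup>2) \<partial>m) = \<infinity>"
  shows "wasserstein2_sq \<nu> m = \<infinity>"
proof -
  have "(\<integral>\<^sup>+z. ennreal ((norm (fst z - snd z))\<^sup>2) \<partial>\<pi>) = \<infinity>" if \<pi>: "\<pi> \<in> couplings \<nu> m" for \<pi>
  proof (rule ccontr)
    assume fin: "(\<integral>\<^sup>+z. ennreal ((norm (fst z - snd z))\<^sup>2) \<partial>\<pi>) \<noteq> \<infinity>"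
    note [measurable_cong] = coupling_sets[OF \<pi>]
    have le: "(norm y)\<^sup>2 \<le> 2 * (norm (z - y))\<^sup>2 + 2 * (norm z)\<^sup>2" for y z :: 'a
      using norm_triangle_ineq4[of z "z - y"] sum_squares_bound[of "norm (z - y)" "norm z"]
        power_mono[of "norm y" "norm z + norm (z - y)" 2] by (simp add: power2_sum mult_ac)
    have "(\<integral>\<^sup>+y. ennreal ((norm y)\<^sup>2) \<partial>m) = (\<integral>\<^sup>+z. ennreal ((norm (snd z))\<^sup>2) \<partial>\<pi>)"
      using coupling_nn_integral(2)[OF \<pi>, of "\<lambda>y. ennreal ((norm y)\<^sup>2)"] by simp
    also have "\<dots> \<le> (\<integral>\<^sup>+z. 2 * ennreal ((norm (fst z - snd z))\<^sup>2) + 2 * ennreal ((norm (fst z))\<^sup>2) \<partial>\<pi>)"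
    proof (intro nn_integral_mono)
      fix z :: "'a \<times> 'a"
      have "ennreal ((norm (snd z))\<^sup>2) \<le> ennreal (2 * (norm (fst z - snd z))\<^sup>2 + 2 * (norm (fst z))\<^sup>2)"
        by (rule ennreal_leI[OF le])
      then show "ennreal ((norm (snd z))\<^sup>2)
          \<le> 2 * ennreal ((norm (fst z - snd z))\<^sup>2) + 2 * ennreal ((norm (fst z))\<^sup>2)"
        by (simp add: ennreal_mult)
    qed
    also have "\<dots> = 2 * (\<integral>\<^sup>+z. ennreal ((norm (fst z - snd z))\<^sup>2) \<partial>\<pi>) + 2 * (\<integral>\<^sup>+z. ennreal ((norm z)\<^sup>2) \<partial>\<nu>)"
      using coupling_nn_integral(1)[OF \<pi>, of "\<lambda>y. ennreal ((norm y)\<^sup>2)"]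
      by (simp add: nn_integral_add nn_integral_cmult)
    also have "\<dots> < \<infinity>"
      using fin \<nu> by (auto simp: P2_def ennreal_mult_less_top less_top)
    finally show False using m by simp
  qed
  then show ?thesis unfolding wasserstein2_sq_def by (simp add: INF_eqI)
qed

text \<open>A one-sided inequality suffices: e -> 0 gives it for closed sets, and complements of
  open neighbourhoods give the reverse. Closed sets are an intersection-stable generator.\<close>

lemma prob_measure_eqI_closed_neighbourhoods:
  fixes M N :: "'a::metric_space measure"
  assumes M: "prob_space M" "sets M = sets borel" and N: "prob_space N" "sets N = sets borel"
    and le: "\<And>C e. closed C \<Longrightarrow> C \<noteq> {} \<Longrightarrow> 0 < e \<Longrightarrow> measure M C \<le> measure N {x. infdist x C \<le> e}"
  shows "M = N"
proof -
  interpret M: prob_space M by fact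
  interpret N: prob_space N by fact
  have sp: "space M = UNIV" "space N = UNIV"
    using M(2) N(2) by (metis sets_eq_imp_space_eq space_borel)+
  have [measurable_cong]: "sets M = sets borel" "sets N = sets borel" by fact+
  have Int_nbhd: "(\<Inter>n. {x. infdist x C \<le> 1 / real (Suc n)}) = C"
     "(\<Inter>n. {x. infdist x C < 1 / real (Suc n)}) = C"
    if C: "closed C" "C \<noteq> {}" for C :: "'a set"
  proof -
    have "infdist x C = 0" if "\<And>n. infdist x C \<le> 1 / real (Suc n)" for x
    proof (rule ccontr)
      assume "infdist x C \<noteq> 0"
      then have "0 < infdist x C" using infdist_nonneg[of x C] by linarith
      then obtain n where "1 / real (Suc n) < infdist x C" using nat_approx_posE by blast
      then show False using that[of n] by simp
    qed
    then have *: "x \<in> C" if "\<And>n. infdist x C \<le> 1 / real (Suc n)" for x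
      using that in_closed_iff_infdist_zero[OF C] by blast
    show "(\<Inter>n. {x. infdist x C \<le> 1 / real (Suc n)}) = C" using * by auto
    show "(\<Inter>n. {x. infdist x C < 1 / real (Suc n)}) = C" using * by (fastforce intro: less_imp_le)
  qed
  have le': "measure M C \<le> measure N C" if C: "closed C" for C
  proof (cases "C = {}")
    case False
    have "(\<lambda>n. measure N {x. infdist x C \<le> 1 / real (Suc n)}) \<longlonglongrightarrow> measure N (\<Inter>n. {x. infdist x C \<le> 1 / real (Suc n)})"
    proof (rule N.finite_Lim_measure_decseq)
      show "decseq (\<lambda>n. {x. infdist x C \<le> 1 / real (Suc n)})"
        by (auto simp: decseq_def intro!: frac_le elim: order_trans)
      show "range (\<lambda>n. {x. infdist x C \<le> 1 / real (Suc n)}) \<subseteq> N.events"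
        unfolding N(2) by (auto intro!: borel_closed closed_Collect_le continuous_intros)
    qed
    then show ?thesis
      unfolding Int_nbhd[OF C False]
      by (rule LIMSEQ_le_const) (auto intro!: exI le C False simp del: of_nat_Suc)
  qed simp
  have eq: "measure M C = measure N C" if C: "closed C" for C
  proof (cases "C = {}")
    case False
    have "measure N C \<le> measure M C"
    proof (rule LIMSEQ_le_const)
      show "(\<lambda>n. measure M {x. infdist x C < 1 / real (Suc n)}) \<longlonglongrightarrow> measure M C"
      proof -
        have "(\<lambda>n. measure M {x. infdist x C < 1 / real (Suc n)}) \<longlonglongrightarrow> measure M (\<Inter>n. {x. infdist x C < 1 / real (Suc n)})"
        proof (rule M.finite_Lim_measure_decseq)
          show "decseq (\<lambda>n. {x. infdist x C < 1 / real (Suc n)})"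
            by (auto simp: decseq_def intro!: frac_le elim: less_le_trans)
          show "range (\<lambda>n. {x. infdist x C < 1 / real (Suc n)}) \<subseteq> M.events"
            unfolding M(2) by (auto intro!: borel_open open_Collect_less continuous_intros)
        qed
        then show ?thesis unfolding Int_nbhd[OF C False] .
      qed
      show "\<exists>N'. \<forall>n\<ge>N'. measure N C \<le> measure M {x. infdist x C < 1 / real (Suc n)}"
      proof (intro exI allI impI)
        fix n :: nat
        let ?A = "{x. infdist x C < 1 / real (Suc n)}"
        have A: "open ?A" by (intro open_Collect_less continuous_intros)
        have "measure N C \<le> measure N ?A"
          using C A by (intro N.finite_measure_mono) (auto simp: N(2))
        also have "\<dots> = 1 - measure N (UNIV - ?A)"
          using A N.prob_compl[of ?A] by (simp add: sp N(2))
        also have "\<dots> \<le> 1 - measure M (UNIV - ?A)"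
          using le'[of "UNIV - ?A"] A by (simp add: closed_Diff)
        also have "\<dots> = measure M ?A"
          using A M.prob_compl[of ?A] by (simp add: sp M(2))
        finally show "measure N C \<le> measure M ?A" .
      qed
    qed
    with le'[OF C] show ?thesis by simp
  qed simp
  show ?thesis
  proof (rule measure_eqI_generator_eq[of "Collect closed" UNIV M N "\<lambda>_. UNIV"])
    show "Int_stable (Collect closed :: 'a set set)" by (auto simp: Int_stable_def)
    show "sets M = sigma_sets UNIV (Collect closed)" "sets N = sigma_sets UNIV (Collect closed)"
      unfolding M(2) N(2) by (simp_all add: borel_eq_closed)
  qed (auto simp: eq M.emeasure_eq_measure N.emeasure_eq_measure)
qed

section \<open>Kantorovich potentials\<close>

text \<open>\<open>G\<close> is a potential of \<open>\<Theta> \<circ> t\<^sup>-\<^sup>1\<close>, composed with \<open>t\<close>. In this parametrization no inverse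
  occurs, and couplings of \<open>\<nu>\<close> with \<open>t\<^sub># \<mu>\<close> become couplings of \<open>\<nu>\<close> with \<open>\<mu>\<close>.\<close>

locale transport_potential = prob_space \<mu> for \<mu> :: "'a::euclidean_space measure" +
  fixes V :: "'a set" and t \<Theta> :: "'a \<Rightarrow> 'a" and G :: "'a \<Rightarrow> real"
  assumes sets_\<mu> [measurable_cong]: "sets \<mu> = sets borel"
    and AE_V: "AE x in \<mu>. x \<in> V"
    and t_L2: "t \<in> L2 \<mu>" and \<Theta>_L2: "\<Theta> \<in> L2 \<mu>"
    and G_subgradient: "\<And>x x'. x \<in> V \<Longrightarrow> x' \<in> V \<Longrightarrow> G x + \<Theta> x \<bullet> (t x' - t x) \<le> G x'"
    and G_growth: "\<exists>c. \<forall>x\<in>V. \<forall>z. z \<bullet> t x - G x \<le> c * (1 + (norm z)\<^sup>2)"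
begin

text \<open>The Legendre transform of the potential whose value at the point t x is G x; finite by
  \<open>G_growth\<close>.\<close>

definition F :: "'a \<Rightarrow> real" where
  "F z = (SUP x\<in>V. z \<bullet> t x - G x)"

text \<open>On V this is the Fenchel gap F z + G x - z . t x. G x is expressed through F at \<Theta>
  x because G is not assumed measurable, while F is continuous.\<close>

definition slack :: "'a \<Rightarrow> 'a \<Rightarrow> real" where
  "slack z x = F z + (\<Theta> x \<bullet> t x - F (\<Theta> x)) - z \<bullet> t x"

lemma V_nonempty: "V \<noteq> {}"
  using AE_V AE_contr[of "\<lambda>x. x \<in> V"] by auto

lemma bdd: "bdd_above ((\<lambda>x. z \<bullet> t x - G x) ` V)"
  using G_growth by (auto simp: bdd_above_def)

lemma F_ge: "x \<in> V \<Longrightarrow> z \<bullet> t x - G x \<le> F z"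
  unfolding F_def by (intro cSUP_upper bdd)

lemma F_le: "(\<And>x. x \<in> V \<Longrightarrow> z \<bullet> t x - G x \<le> c) \<Longrightarrow> F z \<le> c"
  unfolding F_def by (intro cSUP_least V_nonempty)

text \<open>The subgradient inequality says that the supremum at \<Theta> x is attained at
  x.\<close>

lemma F_\<Theta>: "x \<in> V \<Longrightarrow> F (\<Theta> x) = \<Theta> x \<bullet> t x - G x"
  using G_subgradient[of x] by (intro antisym F_le F_ge) (auto simp: inner_diff_right algebra_simps)

lemma slack_eq: "x \<in> V \<Longrightarrow> slack z x = F z + G x - z \<bullet> t x"
  by (simp add: slack_def F_\<Theta>)

lemma slack_nonneg: "x \<in> V \<Longrightarrow> 0 \<le> slack z x"
  using F_ge[of x z] by (simp add: slack_eq)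

lemma F_convex: "convex_on UNIV F"
proof (rule convex_onI)
  fix u x y assume u: "0 < (u::real)" "u < 1"
  show "F ((1 - u) *\<^sub>R x + u *\<^sub>R y) \<le> (1 - u) * F x + u * F y"
  proof (rule F_le)
    fix v assume v: "v \<in> V"
    have "((1 - u) *\<^sub>R x + u *\<^sub>R y) \<bullet> t v - G v = (1 - u) * (x \<bullet> t v - G v) + u * (y \<bullet> t v - G v)"
      by (simp add: algebra_simps inner_simps)
    also have "\<dots> \<le> (1 - u) * F x + u * F y"
      using u v by (intro add_mono mult_left_mono F_ge) auto
    finally show "((1 - u) *\<^sub>R x + u *\<^sub>R y) \<bullet> t v - G v \<le> (1 - u) * F x + u * F y" .
  qed
qed simp

lemma F_continuous: "continuous_on A F"
  using convex_on_continuous[OF open_UNIV F_convex] continuous_on_subset by blast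

lemma F_measurable [measurable]: "F \<in> borel_measurable borel"
  by (intro borel_measurable_continuous_onI F_continuous)

text \<open>Above by \<open>G_growth\<close>, below by the affine function of a single point of V.
  Quadratic growth makes F integrable for measures in \<open>P2\<close>.\<close>

lemma F_bound: "\<exists>c. \<forall>z. \<bar>F z\<bar> \<le> c * (1 + (norm z)\<^sup>2)"
proof -
  obtain c where c: "\<And>x z. x \<in> V \<Longrightarrow> z \<bullet> t x - G x \<le> c * (1 + (norm z)\<^sup>2)" using G_growth by blast
  obtain x0 where x0: "x0 \<in> V" using V_nonempty by blast
  define d where "d = norm (t x0) + \<bar>G x0\<bar>"
  have "\<bar>F z\<bar> \<le> (\<bar>c\<bar> + d) * (1 + (norm z)\<^sup>2)" for z
  proof -
    let ?q = "1 + (norm z)\<^sup>2"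
    have q: "1 \<le> ?q" "norm z \<le> ?q"
      using sum_squares_bound[of 1 "norm z"] zero_le_power2[of "norm z"] norm_ge_zero[of z] by (auto; linarith)+
    have "F z \<le> c * ?q" using c by (intro F_le)
    also have "\<dots> \<le> (\<bar>c\<bar> + d) * ?q" using q abs_ge_self[of c] by (intro mult_right_mono) (simp_all add: d_def add_increasing2)
    finally have 1: "F z \<le> (\<bar>c\<bar> + d) * ?q" .
    have "- F z \<le> - (z \<bullet> t x0) + G x0" using F_ge[OF x0, of z] by simp
    also have "\<dots> \<le> norm z * norm (t x0) + \<bar>G x0\<bar>"
      using Cauchy_Schwarz_ineq2[of z "t x0"] by linarith
    also have "\<dots> \<le> ?q * norm (t x0) + ?q * \<bar>G x0\<bar>"
      using q by (intro add_mono mult_right_mono) (auto simp: mult_le_cancel_right1)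
    also have "\<dots> = d * ?q" by (simp add: d_def algebra_simps)
    also have "\<dots> \<le> (\<bar>c\<bar> + d) * ?q" using q by (intro mult_right_mono) auto
    finally show ?thesis using 1 by (simp add: abs_le_iff)
  qed
  then show ?thesis by blast
qed

lemma F_integrable:
  assumes "prob_space N" and [measurable]: "g \<in> borel_measurable N" and "integrable N (\<lambda>x. (norm (g x))\<^sup>2)"
  shows "integrable N (\<lambda>x. F (g x))"
proof -
  interpret N: prob_space N by fact
  obtain c where c: "\<And>z. \<bar>F z\<bar> \<le> c * (1 + (norm z)\<^sup>2)" using F_bound by blast
  show ?thesis
  proof (rule Bochner_Integration.integrable_bound)
    show "integrable N (\<lambda>x. c * (1 + (norm (g x))\<^sup>2))" using assms(3) by simp
    show "AE x in N. norm (F (g x)) \<le> norm (c * (1 + (norm (g x))\<^sup>2))"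
    proof (rule AE_I2)
      fix x
      show "norm (F (g x)) \<le> norm (c * (1 + (norm (g x))\<^sup>2))" using order_trans[OF c[of "g x"] abs_ge_self] by simp
    qed
  qed measurable
qed

text \<open>With \<open>\<beta>\<close>, the two halves of the Kantorovich dual value: their
  integrands plus twice the slack add up to the squared distance.\<close>

definition \<alpha> :: "'a measure \<Rightarrow> real" where
  "\<alpha> \<nu> = (\<integral>z. (norm z)\<^sup>2 - 2 * F z \<partial>\<nu>)"

definition \<beta> :: real where
  "\<beta> = (\<integral>x. (norm (t x))\<^sup>2 - 2 * (\<Theta> x \<bullet> t x - F (\<Theta> x)) \<partial>\<mu>)"

lemma t_measurable [measurable]: "t \<in> borel_measurable borel"
  and \<Theta>_measurable [measurable]: "\<Theta> \<in> borel_measurable borel"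
  using L2_measurable[OF t_L2] L2_measurable[OF \<Theta>_L2] by simp_all

lemma slack_measurable [measurable (raw)]:
  assumes [measurable]: "f \<in> borel_measurable N" "g \<in> borel_measurable N"
  shows "(\<lambda>x. slack (f x) (g x)) \<in> borel_measurable N"
  unfolding slack_def by measurable

lemma P2_integrable:
  assumes "\<nu> \<in> P2"
  shows "prob_space \<nu>" "sets \<nu> = sets borel" "integrable \<nu> (\<lambda>z. (norm z)\<^sup>2)"
    "integrable \<nu> F"
proof -
  show *: "prob_space \<nu>" "sets \<nu> = sets borel" using assms by (auto simp: P2_def)
  note [measurable_cong] = *(2)
  show i: "integrable \<nu> (\<lambda>z. (norm z)\<^sup>2)"
    using assms by (intro integrableI_bounded) (auto simp: P2_def)
  show "integrable \<nu> F"
    using F_integrable[OF *(1), of "\<lambda>z. z"] i by simp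
qed

lemma \<Theta>_integrable: "integrable \<mu> (\<lambda>x. \<Theta> x \<bullet> t x)" "integrable \<mu> (\<lambda>x. F (\<Theta> x))"
  using L2_integrable_inner[OF \<Theta>_L2 t_L2] F_integrable[OF prob_space_axioms, of \<Theta>] \<Theta>_L2
  by (auto simp: L2_def)

text \<open>Only the slack depends on the coupling beyond its marginals, so twice its mean is the
  duality gap.\<close>

lemma transport_cost:
  assumes \<nu>: "\<nu> \<in> P2" and \<pi>: "\<pi> \<in> couplings \<nu> \<mu>"
  shows "integrable \<pi> (\<lambda>p. slack (fst p) (snd p))" "AE p in \<pi>. 0 \<le> slack (fst p) (snd p)"
    "0 \<le> \<alpha> \<nu> + \<beta> + 2 * (\<integral>p. slack (fst p) (snd p) \<partial>\<pi>)"
    "(\<integral>\<^sup>+p. ennreal ((norm (fst p - t (snd p)))\<^sup>2) \<partial>\<pi>)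
      = ennreal (\<alpha> \<nu> + \<beta> + 2 * (\<integral>p. slack (fst p) (snd p) \<partial>\<pi>))"
proof -
  note [measurable_cong] = coupling_sets[OF \<pi>]
  note P2 = P2_integrable[OF \<nu>]
  have fL: "fst \<in> L2 \<pi>" using P2(3) coupling_integrable(1)[OF \<pi>, of "\<lambda>z. (norm z)\<^sup>2"] by (simp add: L2_def)
  have tL: "(\<lambda>p. t (snd p)) \<in> L2 \<pi>"
    using L2_integrable_norm_sq[OF t_L2] coupling_integrable(2)[OF \<pi>, of "\<lambda>x. (norm (t x))\<^sup>2"]
    by (simp add: L2_def)
  have in1: "integrable \<pi> (\<lambda>p. fst p \<bullet> t (snd p))" by (rule L2_integrable_inner[OF fL tL])
  have in2: "integrable \<pi> (\<lambda>p. F (fst p))"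
    using P2(4) coupling_integrable(1)[OF \<pi>, of F] by simp
  have in3: "integrable \<pi> (\<lambda>p. \<Theta> (snd p) \<bullet> t (snd p))"
    using \<Theta>_integrable(1) coupling_integrable(2)[OF \<pi>, of "\<lambda>x. \<Theta> x \<bullet> t x"] by simp
  have in4: "integrable \<pi> (\<lambda>p. F (\<Theta> (snd p)))"
    using \<Theta>_integrable(2) coupling_integrable(2)[OF \<pi>, of "\<lambda>x. F (\<Theta> x)"] by simp
  show slack: "integrable \<pi> (\<lambda>p. slack (fst p) (snd p))"
    unfolding slack_def using in1 in2 in3 in4 by simp
  show "AE p in \<pi>. 0 \<le> slack (fst p) (snd p)"
    using coupling_AE_snd[OF \<pi> AE_V] by eventually_elim (rule slack_nonneg)
  have sq: "(norm (fst p - t (snd p)))\<^sup>2 = ((norm (fst p))\<^sup>2 - 2 * F (fst p))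
      + ((norm (t (snd p)))\<^sup>2 - 2 * (\<Theta> (snd p) \<bullet> t (snd p) - F (\<Theta> (snd p)))) + 2 * slack (fst p) (snd p)" for p
    by (simp add: slack_def power2_norm_eq_inner inner_diff_left inner_diff_right inner_commute algebra_simps)
  have int: "integrable \<pi> (\<lambda>p. (norm (fst p - t (snd p)))\<^sup>2)"
    using L2_diff[OF fL tL] by (rule L2_integrable_norm_sq)
  have A: "(\<integral>p. (norm (fst p))\<^sup>2 - 2 * F (fst p) \<partial>\<pi>) = \<alpha> \<nu>"
    unfolding \<alpha>_def using coupling_integrable(3)[OF \<pi>, of "\<lambda>z. (norm z)\<^sup>2 - 2 * F z"] by simp
  have B: "(\<integral>p. (norm (t (snd p)))\<^sup>2 - 2 * (\<Theta> (snd p) \<bullet> t (snd p) - F (\<Theta> (snd p))) \<partial>\<pi>) = \<beta>"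
    unfolding \<beta>_def
    using coupling_integrable(4)[OF \<pi>, of "\<lambda>x. (norm (t x))\<^sup>2 - 2 * (\<Theta> x \<bullet> t x - F (\<Theta> x))"] by simp
  have eq: "(\<integral>p. (norm (fst p - t (snd p)))\<^sup>2 \<partial>\<pi>) = \<alpha> \<nu> + \<beta> + 2 * (\<integral>p. slack (fst p) (snd p) \<partial>\<pi>)"
    unfolding sq
    using L2_integrable_norm_sq[OF fL] L2_integrable_norm_sq[OF tL] in2 in3 in4 slack A B
    by (subst Bochner_Integration.integral_add, simp, simp)+ simp
  show "0 \<le> \<alpha> \<nu> + \<beta> + 2 * (\<integral>p. slack (fst p) (snd p) \<partial>\<pi>)"
    unfolding eq[symmetric] by simp
  show "(\<integral>\<^sup>+p. ennreal ((norm (fst p - t (snd p)))\<^sup>2) \<partial>\<pi>)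
      = ennreal (\<alpha> \<nu> + \<beta> + 2 * (\<integral>p. slack (fst p) (snd p) \<partial>\<pi>))"
    unfolding eq[symmetric] using int by (intro nn_integral_eq_integral) auto
qed

lemma \<Theta>_P2: "distr \<mu> borel \<Theta> \<in> P2"
  using \<Theta>_L2 unfolding P2_def L2_iff_nn_integral L2_norm_sq_def
  by (auto simp: nn_integral_distr intro: prob_space_distr)

text \<open>The coupling (\<Theta>, id) has slack zero, so its cost is the dual value.\<close>

lemma \<alpha>_\<Theta>: "\<alpha> (distr \<mu> borel \<Theta>) + \<beta> = (L2_norm \<mu> (\<lambda>x. \<Theta> x - t x))\<^sup>2"
proof -
  have "\<alpha> (distr \<mu> borel \<Theta>) = (\<integral>x. (norm (\<Theta> x))\<^sup>2 - 2 * F (\<Theta> x) \<partial>\<mu>)"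
    unfolding \<alpha>_def by (subst integral_distr) auto
  then have "\<alpha> (distr \<mu> borel \<Theta>) + \<beta> = (\<integral>x. ((norm (\<Theta> x))\<^sup>2 - 2 * F (\<Theta> x))
      + ((norm (t x))\<^sup>2 - 2 * (\<Theta> x \<bullet> t x - F (\<Theta> x))) \<partial>\<mu>)"
    unfolding \<beta>_def using \<Theta>_integrable L2_integrable_norm_sq[OF \<Theta>_L2] L2_integrable_norm_sq[OF t_L2]
    by (subst Bochner_Integration.integral_add) auto
  also have "\<dots> = (\<integral>x. (norm (\<Theta> x - t x))\<^sup>2 \<partial>\<mu>)"
    by (intro Bochner_Integration.integral_cong)
      (auto simp: power2_norm_eq_inner inner_diff_left inner_diff_right inner_commute algebra_simps)
  finally show ?thesis by (simp add: L2_norm_sq_real)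
qed

text \<open>Optimal couplings need not be known to exist: a sequence of couplings with vanishing slack
  forces the first coordinate to approach \<open>\<Theta>\<close> of the second in probability.\<close>

lemma slack_small_imp_eq:
  assumes unique: "\<And>x z. x \<in> V \<Longrightarrow> slack z x = 0 \<Longrightarrow> z = \<Theta> x"
    and \<nu>: "\<nu> \<in> P2"
    and small: "\<And>\<delta>. 0 < \<delta> \<Longrightarrow> \<exists>\<pi>\<in>couplings \<nu> \<mu>. (\<integral>p. slack (fst p) (snd p) \<partial>\<pi>) < \<delta>"
  shows "\<nu> = distr \<mu> borel \<Theta>"
proof (rule prob_measure_eqI_closed_neighbourhoods)
  show "prob_space \<nu>" "sets \<nu> = sets borel" using P2_integrable[OF \<nu>] by auto
  show "prob_space (distr \<mu> borel \<Theta>)" by (rule prob_space_distr) measurable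
  show "sets (distr \<mu> borel \<Theta>) = sets borel" by simp
  fix C :: "'a set" and e :: real
  assume C: "closed C" "C \<noteq> {}" and e: "0 < e"
  let ?Ce = "{x. infdist x C \<le> e}"
  \<comment> \<open>Quantifying over a countable dense set keeps \<open>B n\<close> measurable;
    continuity of the slack in z recovers the other points.\<close>
  obtain Q :: "'a set" where Q: "countable Q" "\<And>X. open X \<Longrightarrow> X \<noteq> {} \<Longrightarrow> \<exists>q\<in>Q. q \<in> X"
    using countable_dense_setE by blast
  \<comment> \<open>Those x at which slack below 1 / (n + 1) does not force z to within e of
    \<Theta> x. These sets decrease, and no point of V is in all of them.\<close>
  define B where "B n = {x. \<exists>q\<in>Q. e < norm (q - \<Theta> x) \<and> slack q x < 1 / real (Suc n)}" for n
  have B_sets: "B n \<in> sets borel" for n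
  proof -
    have "B n = (\<Union>q\<in>Q. {x\<in>space borel. e < norm (q - \<Theta> x) \<and> slack q x < 1 / real (Suc n)})"
      by (auto simp: B_def)
    also have "\<dots> \<in> sets borel" using Q(1) by (intro sets.countable_UN'') measurable
    finally show ?thesis .
  qed
  have slack_cont: "continuous_on A (\<lambda>z. slack z x)" for x A
    unfolding slack_def by (intro continuous_intros F_continuous)
  have B_empty: "x \<notin> V" if x: "x \<in> (\<Inter>n. B n)" for x
  proof
    assume xV: "x \<in> V"
    have "\<exists>w\<in>sphere (\<Theta> x) e. slack w x < 1 / real (Suc n)" for n
    proof -
      obtain q where q: "e < norm (q - \<Theta> x)" "slack q x < 1 / real (Suc n)"
        using x by (auto simp: B_def)
      \<comment> \<open>The slack is convex in z and zero at \<Theta> x, so pulling q back to the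
        sphere of radius e does not increase it. On this compact sphere it has a positive
        minimum.\<close>
      define u where "u = e / norm (q - \<Theta> x)"
      have u: "0 \<le> u" "u \<le> 1" using q(1) e by (auto simp: u_def divide_le_eq)
      define w where "w = (1 - u) *\<^sub>R \<Theta> x + u *\<^sub>R q"
      have "w - \<Theta> x = u *\<^sub>R (q - \<Theta> x)" by (simp add: w_def algebra_simps)
      moreover have "0 < norm (q - \<Theta> x)" using q(1) e by linarith
      ultimately have "norm (w - \<Theta> x) = e" using e by (simp add: u_def)
      then have "w \<in> sphere (\<Theta> x) e" by (simp add: dist_norm norm_minus_commute)
      moreover have "slack w x < 1 / real (Suc n)"
      proof -
        have "F w \<le> (1 - u) * F (\<Theta> x) + u * F q"
          unfolding w_def using u by (intro convex_onD[OF F_convex]) auto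
        moreover have "w \<bullet> t x = (1 - u) * (\<Theta> x \<bullet> t x) + u * (q \<bullet> t x)"
          by (simp add: w_def inner_simps)
        ultimately have "slack w x \<le> u * slack q x"
          by (simp add: slack_def algebra_simps)
        also have "\<dots> \<le> slack q x"
          using u slack_nonneg[OF xV, of q] by (simp add: mult_left_le_one_le)
        finally show ?thesis using q(2) by simp
      qed
      ultimately show ?thesis by blast
    qed
    then have "sphere (\<Theta> x) e \<noteq> {}" by blast
    then obtain w where w: "w \<in> sphere (\<Theta> x) e" "\<And>w'. w' \<in> sphere (\<Theta> x) e \<Longrightarrow> slack w x \<le> slack w' x"
      using continuous_attains_inf[OF compact_sphere _ slack_cont, of "\<Theta> x" e x] by blast
    have "w \<noteq> \<Theta> x" using w(1) e by auto
    then have "0 < slack w x" using unique[OF xV, of w] slack_nonneg[OF xV, of w] by fastforce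
    then obtain n where "1 / real (Suc n) < slack w x" using nat_approx_posE by blast
    moreover obtain w' where "w' \<in> sphere (\<Theta> x) e" "slack w' x < 1 / real (Suc n)"
      using \<open>\<exists>w\<in>sphere (\<Theta> x) e. slack w x < 1 / real (Suc n)\<close> by blast
    ultimately show False using w(2)[of w'] by simp
  qed
  have B_lim: "(\<lambda>n. measure \<mu> (B n)) \<longlonglongrightarrow> 0"
  proof -
    have "(\<lambda>n. measure \<mu> (B n)) \<longlonglongrightarrow> measure \<mu> (\<Inter>n. B n)"
    proof (rule finite_Lim_measure_decseq)
      show "range B \<subseteq> events" using B_sets by (auto simp: sets_\<mu>)
      show "decseq B"
      proof (rule decseq_SucI)
        fix n
        have "1 / real (Suc (Suc n)) \<le> 1 / real (Suc n)" by (intro frac_le) auto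
        then show "B (Suc n) \<subseteq> B n" unfolding B_def by (blast intro: less_le_trans)
      qed
    qed
    also have "measure \<mu> (\<Inter>n. B n) = 0"
    proof -
      have "AE x in \<mu>. x \<notin> (\<Inter>n. B n)"
        using AE_V by eventually_elim (use B_empty in blast)
      moreover have "(\<Inter>n. B n) \<in> events" using B_sets by (auto simp: sets_\<mu>)
      ultimately show ?thesis by (simp only: prob_eq_0)
    qed
    finally show ?thesis .
  qed
  have *: "measure \<nu> C \<le> measure (distr \<mu> borel \<Theta>) ?Ce + measure \<mu> (B n)" for n
  proof (rule field_le_epsilon)
    fix \<tau> :: real assume \<tau>: "0 < \<tau>"
    \<comment> \<open>The threshold built into \<open>B n\<close>; the error \<tau> enters through
      Markov's inequality.\<close>
    define \<delta> where "\<delta> = 1 / real (Suc n)"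
    have \<delta>: "0 < \<delta>" by (simp add: \<delta>_def)
    obtain \<pi> where \<pi>: "\<pi> \<in> couplings \<nu> \<mu>" and sm: "(\<integral>p. slack (fst p) (snd p) \<partial>\<pi>) < \<tau> * \<delta>"
      using small[of "\<tau> * \<delta>"] \<tau> \<delta> by auto
    note [measurable_cong] = coupling_sets[OF \<pi>]
    interpret \<pi>: prob_space \<pi> by (rule coupling_prob[OF \<pi>])
    have sp: "space \<pi> = UNIV"
      using sets_eq_imp_space_eq[OF coupling_sets[OF \<pi>]] by (simp add: space_pair_measure)
    note tc = transport_cost[OF \<nu> \<pi>]
    note [measurable] = B_sets
    \<comment> \<open>If z lies in C, then \<Theta> x is within e of C unless x is exceptional or
      the slack is large.\<close>
    let ?A1 = "{p \<in> space \<pi>. \<Theta> (snd p) \<in> ?Ce}" and ?A2 = "{p \<in> space \<pi>. snd p \<in> B n}"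
    let ?A3 = "{p \<in> space \<pi>. \<delta> \<le> slack (fst p) (snd p)}"
    have [measurable]: "C \<in> sets borel" using C by simp
    have [measurable]: "(\<lambda>x. infdist x C) \<in> borel_measurable borel"
      by (intro borel_measurable_continuous_onI continuous_intros)
    have "?A1 \<in> sets \<pi>" by measurable
    moreover have "?A2 \<in> sets \<pi>" by measurable
    moreover have "?A3 \<in> sets \<pi>" by measurable
    ultimately have A_sets: "?A1 \<in> sets \<pi>" "?A2 \<in> sets \<pi>" "?A3 \<in> sets \<pi>" .
    have "measure \<nu> C = measure \<pi> {p \<in> space \<pi>. fst p \<in> C}"
      unfolding coupling_fst[OF \<pi>, symmetric] by (subst measure_distr) (auto intro!: arg_cong[where f = "measure \<pi>"])
    also have "\<dots> \<le> measure \<pi> (?A1 \<union> ?A2 \<union> ?A3)"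
    proof (rule \<pi>.finite_measure_mono)
      show "{p \<in> space \<pi>. fst p \<in> C} \<subseteq> ?A1 \<union> ?A2 \<union> ?A3"
      proof (intro subsetI UnCI)
        fix p assume p: "p \<in> {p \<in> space \<pi>. fst p \<in> C}" "p \<notin> ?A3" "p \<notin> ?A2"
        obtain z x where [simp]: "p = (z, x)" by fastforce
        have zx: "z \<in> C" "slack z x < \<delta>" "x \<notin> B n" using p by (auto simp: sp)
        have "norm (z - \<Theta> x) \<le> e"
        proof (rule ccontr)
          assume "\<not> norm (z - \<Theta> x) \<le> e"
          then have "z \<in> {w. e < norm (w - \<Theta> x)} \<inter> {w. slack w x < \<delta>}" using zx by auto
          moreover have "open ({w. e < norm (w - \<Theta> x)} \<inter> {w. slack w x < \<delta>})"
            by (intro open_Int open_Collect_less continuous_intros slack_cont)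
          ultimately obtain q where "q \<in> Q" "q \<in> {w. e < norm (w - \<Theta> x)} \<inter> {w. slack w x < \<delta>}"
            using Q(2) by blast
          then have "x \<in> B n" by (auto simp: B_def \<delta>_def)
          with zx show False by simp
        qed
        then have "infdist (\<Theta> x) C \<le> e"
          using infdist_le2[OF zx(1), of "\<Theta> x" e] by (simp add: dist_norm norm_minus_commute)
        then show "p \<in> ?A1" by (simp add: sp)
      qed
      show "?A1 \<union> ?A2 \<union> ?A3 \<in> \<pi>.events" using A_sets by auto
    qed
    also have "\<dots> \<le> measure \<pi> ?A1 + measure \<pi> ?A2 + measure \<pi> ?A3"
      using measure_Un_le[OF sets.Un[OF A_sets(1,2)] A_sets(3)] measure_Un_le[OF A_sets(1,2)] by linarith
    also have "measure \<pi> ?A1 = measure (distr \<mu> borel \<Theta>) ?Ce"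
    proof -
      have "measure (distr \<mu> borel \<Theta>) ?Ce = measure \<mu> (\<Theta> -` ?Ce)"
        by (subst measure_distr) (auto simp: sets_eq_imp_space_eq[OF sets_\<mu>])
      also have "\<dots> = measure (distr \<pi> borel snd) (\<Theta> -` ?Ce)" unfolding coupling_snd[OF \<pi>] ..
      also have "\<dots> = measure \<pi> ?A1"
        using measurable_sets[OF \<Theta>_measurable, of ?Ce]
        by (subst measure_distr) (auto intro!: arg_cong[where f = "measure \<pi>"])
      finally show ?thesis by simp
    qed
    also have "measure \<pi> ?A2 = measure \<mu> (B n)"
      unfolding coupling_snd[OF \<pi>, symmetric]
      by (subst measure_distr) (auto intro!: arg_cong[where f = "measure \<pi>"])
    also have "measure \<pi> ?A3 \<le> (\<integral>p. slack (fst p) (snd p) \<partial>\<pi>) / \<delta>"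
      by (rule integral_Markov_inequality_measure[OF tc(1) sets.empty_sets tc(2) \<delta>])
    also have "\<dots> \<le> \<tau>" using sm \<delta> by (simp add: pos_divide_le_eq)
    finally show "measure \<nu> C \<le> measure (distr \<mu> borel \<Theta>) ?Ce + measure \<mu> (B n) + \<tau>" by simp
  qed
  have "(\<lambda>n. measure (distr \<mu> borel \<Theta>) ?Ce + measure \<mu> (B n)) \<longlonglongrightarrow> measure (distr \<mu> borel \<Theta>) ?Ce + 0"
    by (intro tendsto_intros B_lim)
  note lim = this
  show "measure \<nu> C \<le> measure (distr \<mu> borel \<Theta>) ?Ce"
    using LIMSEQ_le_const[OF lim, of "measure \<nu> C"] * by auto
qed

end

text \<open>The easy half of Brenier's theorem: a gradient of a convex function has slack zero along
  its graph, hence is optimal.\<close>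

lemma wasserstein2_sq_gradient:
  assumes "transport_potential \<mu> V (\<lambda>x. x) \<Theta> G"
  shows "wasserstein2_sq (distr \<mu> borel \<Theta>) \<mu> = L2_norm_sq \<mu> (\<lambda>x. \<Theta> x - x)"
proof -
  interpret transport_potential \<mu> V "\<lambda>x. x" \<Theta> G by fact
  have id: "distr \<mu> borel (\<lambda>x. x) = \<mu>" using sets_\<mu> by (simp add: distr_id2)
  show ?thesis
  proof (rule antisym)
    show "wasserstein2_sq (distr \<mu> borel \<Theta>) \<mu> \<le> L2_norm_sq \<mu> (\<lambda>x. \<Theta> x - x)"
      using wasserstein2_sq_distr_le[OF prob_space_axioms L2_measurable[OF \<Theta>_L2] L2_measurable[OF t_L2]]
      unfolding id .
    show "L2_norm_sq \<mu> (\<lambda>x. \<Theta> x - x) \<le> wasserstein2_sq (distr \<mu> borel \<Theta>) \<mu>"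
      unfolding wasserstein2_sq_def
    proof (rule INF_greatest)
      fix \<pi> assume \<pi>: "\<pi> \<in> couplings (distr \<mu> borel \<Theta>) \<mu>"
      note tc = transport_cost[OF \<Theta>_P2 \<pi>]
      have "L2_norm_sq \<mu> (\<lambda>x. \<Theta> x - x) = ennreal (\<alpha> (distr \<mu> borel \<Theta>) + \<beta>)"
        unfolding \<alpha>_\<Theta> by (intro L2_norm_sq_eq L2_diff \<Theta>_L2 t_L2)
      also have "\<dots> \<le> (\<integral>\<^sup>+z. ennreal ((norm (fst z - snd z))\<^sup>2) \<partial>\<pi>)"
        unfolding tc(4) using tc(2) by (intro ennreal_leI) (simp add: integral_nonneg_AE)
      finally show "L2_norm_sq \<mu> (\<lambda>x. \<Theta> x - x) \<le> (\<integral>\<^sup>+z. ennreal ((norm (fst z - snd z))\<^sup>2) \<partial>\<pi>)" .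
    qed
  qed
qed

section \<open>Barycenters of deformed measures\<close>

text \<open>One outcome of the sample: J fixed maps with inverses s on an open set of full measure.
  \<open>\<phi> i j\<close> is a potential of t_i o s_j, known through its subgradient inequality at
  image points.\<close>

locale deformations = prob_space \<mu> for \<mu> :: "'a::euclidean_space measure" +
  fixes U :: "'a set" and J :: nat and t s :: "nat \<Rightarrow> 'a \<Rightarrow> 'a" and \<phi> :: "nat \<Rightarrow> nat \<Rightarrow> 'a \<Rightarrow> real"
  assumes sets_\<mu> [measurable_cong]: "sets \<mu> = sets borel"
    and J_pos: "1 \<le> J"
    and open_U: "open U"
    and AE_U: "AE x in \<mu>. x \<in> U"
    and t_L2: "\<And>j. j \<in> {1..J} \<Longrightarrow> t j \<in> L2 \<mu>"
    and s_measurable: "\<And>j. j \<in> {1..J} \<Longrightarrow> s j \<in> borel_measurable borel"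
    and t_U: "\<And>j x. j \<in> {1..J} \<Longrightarrow> x \<in> U \<Longrightarrow> t j x \<in> U"
    and s_U: "\<And>j y. j \<in> {1..J} \<Longrightarrow> y \<in> U \<Longrightarrow> s j y \<in> U"
    and s_t: "\<And>j x. j \<in> {1..J} \<Longrightarrow> x \<in> U \<Longrightarrow> s j (t j x) = x"
    and t_s: "\<And>j y. j \<in> {1..J} \<Longrightarrow> y \<in> U \<Longrightarrow> t j (s j y) = y"
    and t_continuous: "\<And>j. j \<in> {1..J} \<Longrightarrow> continuous_on U (t j)"
    and s_continuous: "\<And>j. j \<in> {1..J} \<Longrightarrow> continuous_on U (s j)"
    and \<phi>_subgradient: "\<And>i j x x'. i \<in> {1..J} \<Longrightarrow> j \<in> {1..J} \<Longrightarrow> x \<in> U \<Longrightarrow> x' \<in> U \<Longrightarrow>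
      \<phi> i j (t j x') + t i x' \<bullet> (t j x - t j x') \<le> \<phi> i j (t j x)"
begin

definition \<Theta> :: "'a \<Rightarrow> 'a" where
  "\<Theta> x = (1 / real J) *\<^sub>R (\<Sum>j=1..J. t j x)"

text \<open>A potential of \<open>t i \<circ> (t j)\<^sup>-\<^sup>1\<close> at the point \<open>t j x\<close>. The potentials for \<open>i > j\<close> are taken to be
  the convex conjugates of those for \<open>i < j\<close>, so that Fenchel's equality holds along the family.\<close>

definition pot :: "nat \<Rightarrow> nat \<Rightarrow> 'a \<Rightarrow> real" where
  "pot i j x = (if i < j then \<phi> i j (t j x) else if i = j then (t j x \<bullet> t j x) / 2
     else t i x \<bullet> t j x - \<phi> j i (t i x))"

definition G :: "nat \<Rightarrow> 'a \<Rightarrow> real" where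
  "G j x = (1 / real J) * (\<Sum>i=1..J. pot i j x)"

lemma pot_Fenchel: "pot i j x + pot j i x = t i x \<bullet> t j x"
  by (auto simp: pot_def inner_commute)

lemma pot_subgradient:
  assumes ij: "i \<in> {1..J}" "j \<in> {1..J}" and x: "x \<in> U" "x' \<in> U"
  shows "pot i j x' + t i x' \<bullet> (t j x - t j x') \<le> pot i j x"
proof -
  consider "i < j" | "i = j" | "j < i" by linarith
  then show ?thesis
  proof cases
    case 1 then show ?thesis using \<phi>_subgradient[OF ij x] by (simp add: pot_def)
  next
    case 2
    have "0 \<le> (t j x - t j x') \<bullet> (t j x - t j x')" by simp
    then show ?thesis using 2 by (simp add: pot_def inner_diff_left inner_diff_right inner_commute algebra_simps)
  next
    case 3
    \<comment> \<open>Under conjugation the inequality for (i, j) based at x' is the one for (j, i)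
      based at x.\<close>
    then show ?thesis using \<phi>_subgradient[OF ij(2,1) x(2,1)]
      by (simp add: pot_def inner_diff_left inner_diff_right inner_commute algebra_simps)
  qed
qed

lemma J_gt_0: "0 < real J" using J_pos by simp

lemma G_subgradient:
  assumes j: "j \<in> {1..J}" and x: "x \<in> U" "x' \<in> U"
  shows "G j x + \<Theta> x \<bullet> (t j x' - t j x) \<le> G j x'"
proof -
  have "G j x + \<Theta> x \<bullet> (t j x' - t j x) = (1 / real J) * (\<Sum>i=1..J. pot i j x + t i x \<bullet> (t j x' - t j x))"
    by (simp add: G_def \<Theta>_def sum.distrib inner_sum_left distrib_left)
  also have "\<dots> \<le> (1 / real J) * (\<Sum>i=1..J. pot i j x')"
    using j x pot_subgradient by (intro mult_left_mono sum_mono) auto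
  finally show ?thesis by (simp add: G_def)
qed

text \<open>Symmetrization, so that Fenchel's relation between (i, j) and (j, i) applies inside the
  double sum.\<close>

lemma sum_pot_swap: "(\<Sum>j=1..J. \<Sum>i=1..J. pot i j (x j)) = (\<Sum>j=1..J. \<Sum>i=1..J. (pot i j (x j) + pot j i (x i)) / 2)"
proof -
  have "(\<Sum>j=1..J. \<Sum>i=1..J. pot j i (x i)) = (\<Sum>j=1..J. \<Sum>i=1..J. pot i j (x j))"
    by (rule sum.swap)
  then show ?thesis by (simp add: sum.distrib add_divide_distrib flip: sum_divide_distrib)
qed

text \<open>Dual feasibility. The points x_j vary independently because each conjugate has its own
  supremum. Fenchel-Young for all pairs gives |Y|^2 / (2 J) <= sum of G_j, and completing the square
  in z removes Y.\<close>

lemma sum_conjugate_le: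
  assumes x: "\<And>j. j \<in> {1..J} \<Longrightarrow> x j \<in> U"
  shows "(\<Sum>j=1..J. z \<bullet> t j (x j) - G j (x j)) \<le> real J * (norm z)\<^sup>2 / 2"
proof -
  define Y where "Y = (\<Sum>j=1..J. t j (x j))"
  have "Y \<bullet> Y / 2 = (\<Sum>j=1..J. \<Sum>i=1..J. (t i (x i) \<bullet> t j (x j)) / 2)"
    by (simp add: Y_def inner_sum_left inner_sum_right sum_divide_distrib)
  also have "\<dots> \<le> (\<Sum>j=1..J. \<Sum>i=1..J. (pot i j (x j) + pot j i (x i)) / 2)"
  proof (intro sum_mono divide_right_mono)
    fix i j assume ij: "j \<in> {1..J}" "i \<in> {1..J}"
    show "t i (x i) \<bullet> t j (x j) \<le> pot i j (x j) + pot j i (x i)"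
      using pot_subgradient[OF ij(2,1), of "x j" "x i"] pot_Fenchel[of i j "x i"] x ij
      by (simp add: inner_diff_right)
  qed simp
  also have "\<dots> = real J * (\<Sum>j=1..J. G j (x j))"
    unfolding sum_pot_swap[symmetric] using J_gt_0 by (simp add: G_def flip: sum_divide_distrib)
  finally have 1: "Y \<bullet> Y / (2 * real J) \<le> (\<Sum>j=1..J. G j (x j))"
    using J_gt_0 by (simp add: field_simps)
  have "0 \<le> (real J *\<^sub>R z - Y) \<bullet> (real J *\<^sub>R z - Y)" by simp
  then have "2 * real J * (z \<bullet> Y) \<le> real J * (real J * (z \<bullet> z)) + Y \<bullet> Y"
    by (simp add: inner_diff_left inner_diff_right inner_commute algebra_simps)
  then have "z \<bullet> Y - Y \<bullet> Y / (2 * real J) \<le> real J * (z \<bullet> z) / 2"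
    using J_gt_0 by (simp add: field_simps)
  moreover have "(\<Sum>j=1..J. z \<bullet> t j (x j) - G j (x j)) = z \<bullet> Y - (\<Sum>j=1..J. G j (x j))"
    by (simp add: Y_def sum_subtractf inner_sum_right)
  ultimately show ?thesis using 1 by (simp add: power2_norm_eq_inner)
qed

lemma U_nonempty: "U \<noteq> {}"
  using AE_U AE_contr[of "\<lambda>x. x \<in> U"] by auto

lemma \<Theta>_L2: "\<Theta> \<in> L2 \<mu>"
  unfolding \<Theta>_def using t_L2 by (intro L2_scaleR L2_sum) auto

text \<open>The growth bound for one conjugate is \<open>sum_conjugate_le\<close> with all other
  points frozen at x0.\<close>

lemma potential:
  assumes j: "j \<in> {1..J}"
  shows "transport_potential \<mu> U (t j) \<Theta> (G j)"
proof unfold_locales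
  show "sets \<mu> = sets borel" "AE x in \<mu>. x \<in> U" by (fact sets_\<mu> AE_U)+
  show "t j \<in> L2 \<mu>" "\<Theta> \<in> L2 \<mu>" using t_L2 j \<Theta>_L2 by auto
  show "G j x + \<Theta> x \<bullet> (t j x' - t j x) \<le> G j x'" if "x \<in> U" "x' \<in> U" for x x'
    using G_subgradient j that by simp
  obtain x0 where x0: "x0 \<in> U" using U_nonempty by blast
  let ?K = "{1..J} - {j}"
  define c where "c = real J + (\<Sum>i\<in>?K. norm (t i x0) + \<bar>G i x0\<bar>)"
  show "\<exists>c. \<forall>x\<in>U. \<forall>z. z \<bullet> t j x - G j x \<le> c * (1 + (norm z)\<^sup>2)"
  proof (intro exI ballI allI)
    fix x z :: 'a assume x: "x \<in> U"
    let ?q = "1 + (norm z)\<^sup>2"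
    have q: "1 \<le> ?q" "norm z \<le> ?q"
      using sum_squares_bound[of 1 "norm z"] zero_le_power2[of "norm z"] norm_ge_zero[of z] by (auto; linarith)+
    have "(\<Sum>i=1..J. z \<bullet> t i (((\<lambda>_. x0)(j := x)) i) - G i (((\<lambda>_. x0)(j := x)) i)) \<le> real J * (norm z)\<^sup>2 / 2"
      by (rule sum_conjugate_le) (use x x0 in auto)
    also have "(\<Sum>i=1..J. z \<bullet> t i (((\<lambda>_. x0)(j := x)) i) - G i (((\<lambda>_. x0)(j := x)) i))
        = (z \<bullet> t j x - G j x) + (\<Sum>i\<in>?K. z \<bullet> t i x0 - G i x0)"
      using j by (subst sum.remove[of _ j]) (auto intro!: sum.cong)
    finally have "z \<bullet> t j x - G j x \<le> real J * (norm z)\<^sup>2 / 2 + (\<Sum>i\<in>?K. - (z \<bullet> t i x0 - G i x0))"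
      unfolding sum_negf by linarith
    also have "\<dots> \<le> real J * ?q + (\<Sum>i\<in>?K. ?q * (norm (t i x0) + \<bar>G i x0\<bar>))"
    proof (intro add_mono sum_mono)
      show "real J * (norm z)\<^sup>2 / 2 \<le> real J * ?q"
      proof -
        have "real J * ((norm z)\<^sup>2 / 2) \<le> real J * ?q" using J_gt_0 by (intro mult_left_mono) auto
        then show ?thesis by simp
      qed
      fix i
      have "- (z \<bullet> t i x0 - G i x0) \<le> norm z * norm (t i x0) + \<bar>G i x0\<bar>"
        using Cauchy_Schwarz_ineq2[of z "t i x0"] by linarith
      also have "\<dots> \<le> ?q * norm (t i x0) + ?q * \<bar>G i x0\<bar>"
        using q by (intro add_mono mult_right_mono) (auto simp: mult_le_cancel_right1)
      finally show "- (z \<bullet> t i x0 - G i x0) \<le> ?q * (norm (t i x0) + \<bar>G i x0\<bar>)" by (simp add: distrib_left)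
    qed
    also have "\<dots> = c * ?q" by (simp add: c_def sum_distrib_left algebra_simps)
    finally show "z \<bullet> t j x - G j x \<le> c * ?q" .
  qed
qed

section \<open>Weak duality for the barycenter functional and its equality case\<close>

abbreviation F :: "nat \<Rightarrow> 'a \<Rightarrow> real" where
  "F j \<equiv> transport_potential.F U (t j) (G j)"

abbreviation \<alpha> :: "nat \<Rightarrow> 'a measure \<Rightarrow> real" where
  "\<alpha> j \<equiv> transport_potential.\<alpha> U (t j) (G j)"

abbreviation \<beta> :: "nat \<Rightarrow> real" where
  "\<beta> j \<equiv> transport_potential.\<beta> \<mu> U (t j) \<Theta> (G j)"

abbreviation slack :: "nat \<Rightarrow> 'a \<Rightarrow> 'a \<Rightarrow> real" where
  "slack j \<equiv> transport_potential.slack U (t j) \<Theta> (G j)"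

abbreviation deformed :: "nat \<Rightarrow> 'a measure" where
  "deformed j \<equiv> distr \<mu> borel (t j)"

text \<open>The suprema need not be attained; near-maximizers with error e / J each are
  inserted.\<close>

lemma sum_F_le: "(\<Sum>j=1..J. F j z) \<le> real J * (norm z)\<^sup>2 / 2"
proof (rule field_le_epsilon)
  fix e :: real assume e: "0 < e"
  have "\<exists>x\<in>U. F j z - e / real J < z \<bullet> t j x - G j x" if j: "j \<in> {1..J}" for j
  proof -
    interpret T: transport_potential \<mu> U "t j" \<Theta> "G j" by (rule potential[OF j])
    have "F j z - e / real J < F j z" using e J_gt_0 by simp
    then show ?thesis using T.F_le[of z "F j z - e / real J"] by (meson not_less order.asym)
  qed
  then obtain x where x: "\<And>j. j \<in> {1..J} \<Longrightarrow> x j \<in> U"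
      "\<And>j. j \<in> {1..J} \<Longrightarrow> F j z - e / real J < z \<bullet> t j (x j) - G j (x j)"
    by metis
  have "(\<Sum>j=1..J. F j z) - e = (\<Sum>j=1..J. F j z - e / real J)"
    using J_gt_0 by (simp add: sum_subtractf)
  also have "\<dots> \<le> (\<Sum>j=1..J. z \<bullet> t j (x j) - G j (x j))"
    using x(2) by (intro sum_mono less_imp_le)
  also have "\<dots> \<le> real J * (norm z)\<^sup>2 / 2" by (rule sum_conjugate_le[OF x(1)])
  finally show "(\<Sum>j=1..J. F j z) \<le> real J * (norm z)\<^sup>2 / 2 + e" by simp
qed

text \<open>At \<Theta> x all suprema are attained at the same x, so Fenchel's equality holds for
  every pair.\<close>

lemma sum_F_\<Theta>:
  assumes x: "x \<in> U"
  shows "(\<Sum>j=1..J. F j (\<Theta> x)) = real J * (norm (\<Theta> x))\<^sup>2 / 2"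
proof -
  have st: "(\<Sum>j=1..J. t j x) = real J *\<^sub>R \<Theta> x" using J_gt_0 by (simp add: \<Theta>_def)
  have "(\<Sum>j=1..J. F j (\<Theta> x)) = (\<Sum>j=1..J. \<Theta> x \<bullet> t j x - G j x)"
    using transport_potential.F_\<Theta>[OF potential x] by (intro sum.cong) auto
  also have "\<dots> = real J * (\<Theta> x \<bullet> \<Theta> x) - (\<Sum>j=1..J. G j x)"
    by (simp add: sum_subtractf st del: One_nat_def flip: inner_sum_right)
  also have "(\<Sum>j=1..J. G j x) = (1 / real J) * (\<Sum>j=1..J. \<Sum>i=1..J. (t i x \<bullet> t j x) / 2)"
    using sum_pot_swap[of "\<lambda>_. x"] by (simp only: G_def pot_Fenchel sum_distrib_left[symmetric])
  also have "(\<Sum>j=1..J. \<Sum>i=1..J. (t i x \<bullet> t j x) / 2) = (\<Sum>i=1..J. t i x) \<bullet> (\<Sum>j=1..J. t j x) / 2"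
    by (simp add: inner_sum_left inner_sum_right sum_divide_distrib)
  also have "\<dots> = real J * (real J * (\<Theta> x \<bullet> \<Theta> x)) / 2" by (simp add: st del: One_nat_def)
  finally show ?thesis using J_gt_0 by (simp add: power2_norm_eq_inner)
qed

lemma sum_\<alpha>_eq:
  assumes "\<nu> \<in> P2"
  shows "(\<Sum>j=1..J. \<alpha> j \<nu>) = (\<integral>z. real J * (norm z)\<^sup>2 - 2 * (\<Sum>j=1..J. F j z) \<partial>\<nu>)"
proof -
  have eq: "\<alpha> j \<nu> = (\<integral>z. (norm z)\<^sup>2 - 2 * F j z \<partial>\<nu>)"
    "integrable \<nu> (\<lambda>z. (norm z)\<^sup>2 - 2 * F j z)" if "j \<in> {1..J}" for j
  proof -
    interpret T: transport_potential \<mu> U "t j" \<Theta> "G j" by (rule potential[OF that])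
    show "\<alpha> j \<nu> = (\<integral>z. (norm z)\<^sup>2 - 2 * F j z \<partial>\<nu>)" by (rule T.\<alpha>_def)
    show "integrable \<nu> (\<lambda>z. (norm z)\<^sup>2 - 2 * F j z)"
      using T.P2_integrable[OF assms] by simp
  qed
  then have "(\<Sum>j=1..J. \<alpha> j \<nu>) = (\<integral>z. (\<Sum>j=1..J. (norm z)\<^sup>2 - 2 * F j z) \<partial>\<nu>)"
    by (subst Bochner_Integration.integral_sum) auto
  then show ?thesis by (simp add: sum_subtractf sum_distrib_left)
qed

text \<open>Weak duality: the sum of the \<open>\<beta> j\<close> bounds every candidate's total
  cost from below.\<close>

lemma sum_\<alpha>_nonneg: "\<nu> \<in> P2 \<Longrightarrow> 0 \<le> (\<Sum>j=1..J. \<alpha> j \<nu>)"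
  unfolding sum_\<alpha>_eq by (intro integral_nonneg_AE AE_I2) (use sum_F_le in \<open>simp add: field_simps\<close>)

lemma \<Theta>_P2: "distr \<mu> borel \<Theta> \<in> P2"
  using transport_potential.\<Theta>_P2[OF potential[of 1]] J_pos by simp

text \<open>The push-forward by \<Theta> attains the bound of weak duality.\<close>

lemma sum_\<alpha>_\<Theta>: "(\<Sum>j=1..J. \<alpha> j (distr \<mu> borel \<Theta>)) = 0"
proof -
  have F [measurable]: "F j \<in> borel_measurable borel" if "j \<in> {1..J}" for j
    using transport_potential.F_measurable[OF potential[OF that]] .
  have [measurable]: "\<Theta> \<in> borel_measurable borel" using L2_measurable[OF \<Theta>_L2] by simp
  have "(\<Sum>j=1..J. \<alpha> j (distr \<mu> borel \<Theta>))
      = (\<integral>x. real J * (norm (\<Theta> x))\<^sup>2 - 2 * (\<Sum>j=1..J. F j (\<Theta> x)) \<partial>\<mu>)"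
    unfolding sum_\<alpha>_eq[OF \<Theta>_P2] by (subst integral_distr) auto
  also have "\<dots> = (\<integral>x. 0 \<partial>\<mu>)"
    by (rule integral_cong_AE) (use AE_U in \<open>measurable, auto simp: sum_F_\<Theta> simp del: One_nat_def\<close>)
  finally show ?thesis by simp
qed

text \<open>The second part supplies near-optimal couplings over \<mu>, with cost already split into
  dual value and slack. The nonnegativity clauses guard later arithmetic in \<open>ennreal\<close>,
  where negative reals become 0.\<close>

lemma wasserstein2_sq_ge:
  assumes \<nu>: "\<nu> \<in> P2" and j: "j \<in> {1..J}"
  shows "ennreal (\<alpha> j \<nu> + \<beta> j) \<le> wasserstein2_sq \<nu> (deformed j)"
    and "wasserstein2_sq \<nu> (deformed j) < \<infinity> \<Longrightarrow> 0 < \<delta> \<Longrightarrow>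
      \<exists>\<pi>\<in>couplings \<nu> \<mu>. 0 \<le> (\<integral>p. slack j (fst p) (snd p) \<partial>\<pi>) \<and>
        0 \<le> \<alpha> j \<nu> + \<beta> j + 2 * (\<integral>p. slack j (fst p) (snd p) \<partial>\<pi>) \<and>
        ennreal (\<alpha> j \<nu> + \<beta> j + 2 * (\<integral>p. slack j (fst p) (snd p) \<partial>\<pi>))
        \<le> wasserstein2_sq \<nu> (deformed j) + ennreal \<delta>"
proof -
  interpret T: transport_potential \<mu> U "t j" \<Theta> "G j" by (rule potential[OF j])
  have "AE x in \<mu>. s j (t j x) = x" using AE_U by eventually_elim (rule s_t[OF j])
  note lift = coupling_lift[OF prob_space_axioms sets_\<mu> T.t_measurable s_measurable[OF j] this]
  have *: "\<exists>\<pi>'\<in>couplings \<nu> \<mu>. 0 \<le> (\<integral>p. slack j (fst p) (snd p) \<partial>\<pi>') \<and>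
        0 \<le> \<alpha> j \<nu> + \<beta> j + 2 * (\<integral>p. slack j (fst p) (snd p) \<partial>\<pi>') \<and>
        ennreal (\<alpha> j \<nu> + \<beta> j + 2 * (\<integral>p. slack j (fst p) (snd p) \<partial>\<pi>'))
      = (\<integral>\<^sup>+z. ennreal ((norm (fst z - snd z))\<^sup>2) \<partial>\<pi>)" if \<pi>: "\<pi> \<in> couplings \<nu> (deformed j)" for \<pi>
  proof -
    obtain \<pi>' where \<pi>': "\<pi>' \<in> couplings \<nu> \<mu>"
      "(\<integral>\<^sup>+z. ennreal ((norm (fst z - t j (snd z)))\<^sup>2) \<partial>\<pi>') = (\<integral>\<^sup>+z. ennreal ((norm (fst z - snd z))\<^sup>2) \<partial>\<pi>)"
      using lift[OF \<pi>] by blast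
    show ?thesis
      using T.transport_cost[OF \<nu> \<pi>'(1)] \<pi>' by (intro bexI[of _ \<pi>']) (auto intro: integral_nonneg_AE)
  qed
  show "ennreal (\<alpha> j \<nu> + \<beta> j) \<le> wasserstein2_sq \<nu> (deformed j)"
    unfolding wasserstein2_sq_def
  proof (rule INF_greatest)
    fix \<pi> assume "\<pi> \<in> couplings \<nu> (deformed j)"
    from *[OF this] show "ennreal (\<alpha> j \<nu> + \<beta> j) \<le> (\<integral>\<^sup>+z. ennreal ((norm (fst z - snd z))\<^sup>2) \<partial>\<pi>)"
      by (elim bexE conjE) (erule subst, rule ennreal_leI, simp)
  qed
  assume fin: "wasserstein2_sq \<nu> (deformed j) < \<infinity>" and \<delta>: "0 < \<delta>"
  then have "wasserstein2_sq \<nu> (deformed j) < wasserstein2_sq \<nu> (deformed j) + ennreal \<delta>"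
    by (cases "wasserstein2_sq \<nu> (deformed j)") (auto simp: ennreal_plus[symmetric] ennreal_less_iff simp del: ennreal_plus)
  then obtain \<pi> where \<pi>: "\<pi> \<in> couplings \<nu> (deformed j)"
      "(\<integral>\<^sup>+z. ennreal ((norm (fst z - snd z))\<^sup>2) \<partial>\<pi>) < wasserstein2_sq \<nu> (deformed j) + ennreal \<delta>"
    by (subst (asm) wasserstein2_sq_def) (auto simp: INF_less_iff)
  obtain \<pi>' where "\<pi>' \<in> couplings \<nu> \<mu>" "0 \<le> (\<integral>p. slack j (fst p) (snd p) \<partial>\<pi>')"
      "0 \<le> \<alpha> j \<nu> + \<beta> j + 2 * (\<integral>p. slack j (fst p) (snd p) \<partial>\<pi>')"
      "ennreal (\<alpha> j \<nu> + \<beta> j + 2 * (\<integral>p. slack j (fst p) (snd p) \<partial>\<pi>'))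
      = (\<integral>\<^sup>+z. ennreal ((norm (fst z - snd z))\<^sup>2) \<partial>\<pi>)"
    using *[OF \<pi>(1)] by blast
  with \<pi>(2) show "\<exists>\<pi>\<in>couplings \<nu> \<mu>. 0 \<le> (\<integral>p. slack j (fst p) (snd p) \<partial>\<pi>) \<and>
        0 \<le> \<alpha> j \<nu> + \<beta> j + 2 * (\<integral>p. slack j (fst p) (snd p) \<partial>\<pi>) \<and>
        ennreal (\<alpha> j \<nu> + \<beta> j + 2 * (\<integral>p. slack j (fst p) (snd p) \<partial>\<pi>))
        \<le> wasserstein2_sq \<nu> (deformed j) + ennreal \<delta>"
    by (intro bexI[of _ \<pi>'] conjI) auto
qed

text \<open>Slack zero makes z a subgradient at y = t_j x of the convex potential with gradient
  \<Theta> o s_j. Monotonicity against y + c v, v = z - \<Theta> x, and c -> 0 force |v|^2 <=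
  0.\<close>

lemma slack_zero_imp:
  assumes j: "j \<in> {1..J}" and x: "x \<in> U" and z: "slack j z x = 0"
  shows "z = \<Theta> x"
proof (rule ccontr)
  assume ne: "z \<noteq> \<Theta> x"
  interpret T: transport_potential \<mu> U "t j" \<Theta> "G j" by (rule potential[OF j])
  have mono: "0 \<le> (\<Theta> x' - z) \<bullet> (t j x' - t j x)" if x': "x' \<in> U" for x'
  proof -
    have "z \<bullet> t j x' - G j x' \<le> z \<bullet> t j x - G j x"
      using T.F_ge[OF x', of z] z T.slack_eq[OF x, of z] by simp
    moreover have "G j x' + \<Theta> x' \<bullet> (t j x - t j x') \<le> G j x" by (rule G_subgradient[OF j x' x])
    ultimately show ?thesis by (simp add: inner_diff_left inner_diff_right)
  qed
  define v where "v = z - \<Theta> x"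
  have v: "v \<noteq> 0" using ne by (simp add: v_def)
  have y: "t j x \<in> U" using t_U j x by simp
  obtain r where r: "0 < r" "cball (t j x) r \<subseteq> U" using open_U y open_contains_cball by blast
  define y where "y n = t j x + (r / norm v / real (Suc n)) *\<^sub>R v" for n
  have yU: "y n \<in> U" for n
  proof -
    have "r / real (Suc n) \<le> r / 1" using r by (intro divide_left_mono) auto
    then have "y n \<in> cball (t j x) r" using r v by (simp add: y_def dist_norm)
    then show ?thesis using r(2) by blast
  qed
  have "(\<lambda>n. r / norm v / real (Suc n)) \<longlonglongrightarrow> 0"
    using tendsto_mult[OF tendsto_const LIMSEQ_inverse_real_of_nat, of "r / norm v"]
    by (simp add: divide_inverse)
  then have y_lim: "y \<longlonglongrightarrow> t j x"
    unfolding y_def using tendsto_add[OF tendsto_const tendsto_scaleR[OF _ tendsto_const], of "\<lambda>n. r / norm v / real (Suc n)" 0 sequentially "t j x" v] by simp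
  have cont: "continuous_on U (\<lambda>y. \<Theta> (s j y))"
    unfolding \<Theta>_def
    by (intro continuous_intros continuous_on_compose2[OF t_continuous s_continuous]) (use j s_U in auto)
  have "(\<lambda>n. \<Theta> (s j (y n))) \<longlonglongrightarrow> \<Theta> (s j (t j x))"
    using continuous_on_tendsto_compose[OF cont y_lim y] yU by simp
  then have "(\<lambda>n. (\<Theta> (s j (y n)) - z) \<bullet> v) \<longlonglongrightarrow> (\<Theta> x - z) \<bullet> v"
    using s_t[OF j x] by (intro tendsto_intros) auto
  moreover have "0 \<le> (\<Theta> (s j (y n)) - z) \<bullet> v" for n
  proof -
    have c: "0 < r / norm v / real (Suc n)" using r v by simp
    have "0 \<le> (\<Theta> (s j (y n)) - z) \<bullet> ((r / norm v / real (Suc n)) *\<^sub>R v)"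
      using mono[OF s_U[OF j yU[of n]]] t_s[OF j yU[of n]] by (simp add: y_def)
    then have "0 \<le> (r / norm v / real (Suc n)) * ((\<Theta> (s j (y n)) - z) \<bullet> v)" by simp
    then show ?thesis using c by (simp only: zero_le_mult_iff) linarith
  qed
  ultimately have "0 \<le> (\<Theta> x - z) \<bullet> v" by (intro LIMSEQ_le_const) auto
  then have "v \<bullet> v \<le> 0" by (simp add: v_def inner_diff_left)
  then show False using v inner_gt_zero_iff[of v] by linarith
qed

text \<open>The coupling (\<Theta>, t_j) attains the dual bound, for all j at once.\<close>

lemma wasserstein2_sq_\<Theta>:
  assumes j: "j \<in> {1..J}"
  shows "wasserstein2_sq (distr \<mu> borel \<Theta>) (deformed j) = ennreal (\<alpha> j (distr \<mu> borel \<Theta>) + \<beta> j)"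
    and "0 \<le> \<alpha> j (distr \<mu> borel \<Theta>) + \<beta> j"
proof -
  interpret T: transport_potential \<mu> U "t j" \<Theta> "G j" by (rule potential[OF j])
  show "0 \<le> \<alpha> j (distr \<mu> borel \<Theta>) + \<beta> j" unfolding T.\<alpha>_\<Theta> by simp
  have "wasserstein2_sq (distr \<mu> borel \<Theta>) (deformed j) \<le> L2_norm_sq \<mu> (\<lambda>x. \<Theta> x - t j x)"
    by (intro wasserstein2_sq_distr_le prob_space_axioms L2_measurable \<Theta>_L2 t_L2 j)
  also have "\<dots> = ennreal (\<alpha> j (distr \<mu> borel \<Theta>) + \<beta> j)"
    unfolding T.\<alpha>_\<Theta> by (intro L2_norm_sq_eq L2_diff \<Theta>_L2 t_L2 j)
  finally show "wasserstein2_sq (distr \<mu> borel \<Theta>) (deformed j) = ennreal (\<alpha> j (distr \<mu> borel \<Theta>) + \<beta> j)"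
    using wasserstein2_sq_ge(1)[OF \<Theta>_P2 j] by (rule antisym)
qed

lemma sum_wasserstein2_sq_\<Theta>:
  "(\<Sum>j=1..J. wasserstein2_sq (distr \<mu> borel \<Theta>) (deformed j)) = ennreal (\<Sum>j=1..J. \<beta> j)"
  "0 \<le> (\<Sum>j=1..J. \<beta> j)"
proof -
  have "(\<Sum>j=1..J. wasserstein2_sq (distr \<mu> borel \<Theta>) (deformed j))
      = (\<Sum>j=1..J. ennreal (\<alpha> j (distr \<mu> borel \<Theta>) + \<beta> j))"
    using wasserstein2_sq_\<Theta>(1) by (intro sum.cong) auto
  also have "\<dots> = ennreal (\<Sum>j=1..J. \<alpha> j (distr \<mu> borel \<Theta>) + \<beta> j)"
    using wasserstein2_sq_\<Theta>(2) by (intro sum_ennreal) auto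
  also have eq: "(\<Sum>j=1..J. \<alpha> j (distr \<mu> borel \<Theta>) + \<beta> j) = (\<Sum>j=1..J. \<beta> j)"
    by (simp add: sum.distrib sum_\<alpha>_\<Theta> del: One_nat_def)
  finally show "(\<Sum>j=1..J. wasserstein2_sq (distr \<mu> borel \<Theta>) (deformed j)) = ennreal (\<Sum>j=1..J. \<beta> j)" .
  show "0 \<le> (\<Sum>j=1..J. \<beta> j)"
    unfolding eq[symmetric] using wasserstein2_sq_\<Theta>(2) by (intro sum_nonneg) auto
qed

lemma sum_wasserstein2_sq_ge:
  assumes \<nu>: "\<nu> \<in> P2"
  shows "ennreal (\<Sum>j=1..J. \<beta> j) \<le> (\<Sum>j=1..J. wasserstein2_sq \<nu> (deformed j))"
proof -
  \<comment> \<open>Single dual values may a priori be negative; the maximum makes the sum commute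
    with \<open>ennreal\<close>.\<close>
  have "ennreal (\<Sum>j=1..J. \<beta> j) \<le> ennreal (\<Sum>j=1..J. max 0 (\<alpha> j \<nu> + \<beta> j))"
    using sum_\<alpha>_nonneg[OF \<nu>] sum_mono[of "{1..J}" "\<lambda>j. \<alpha> j \<nu> + \<beta> j" "\<lambda>j. max 0 (\<alpha> j \<nu> + \<beta> j)"]
    by (intro ennreal_leI) (simp add: sum.distrib)
  also have "\<dots> = (\<Sum>j=1..J. ennreal (max 0 (\<alpha> j \<nu> + \<beta> j)))"
    by (rule sum_ennreal[symmetric]) simp
  also have "\<dots> \<le> (\<Sum>j=1..J. wasserstein2_sq \<nu> (deformed j))"
    using wasserstein2_sq_ge(1)[OF \<nu>] by (intro sum_mono) (auto simp: max_def ennreal_neg)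
  finally show ?thesis .
qed

text \<open>Couplings within \<delta> / J of optimal have slacks of sum at most \<delta> / 2,
  because the \<open>\<alpha>\<close> parts sum to a nonnegative number. Slacks have nonnegative
  mean, so index 1 alone identifies \<nu>.\<close>

lemma barycenter_unique:
  assumes \<nu>: "\<nu> \<in> P2" and le: "(\<Sum>j=1..J. wasserstein2_sq \<nu> (deformed j)) \<le> ennreal (\<Sum>j=1..J. \<beta> j)"
  shows "\<nu> = distr \<mu> borel \<Theta>"
proof -
  have one: "1 \<in> {1..J}" using J_pos by simp
  interpret T: transport_potential \<mu> U "t 1" \<Theta> "G 1" by (rule potential[OF one])
  have fin: "wasserstein2_sq \<nu> (deformed j) < \<infinity>" if "j \<in> {1..J}" for j
  proof -
    have "wasserstein2_sq \<nu> (deformed j) \<le> (\<Sum>j=1..J. wasserstein2_sq \<nu> (deformed j))"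
      using that by (intro member_le_sum) auto
    also have "\<dots> < \<infinity>" using le by (rule le_less_trans) simp
    finally show ?thesis .
  qed
  show ?thesis
  proof (rule T.slack_small_imp_eq[OF _ \<nu>])
    show "z = \<Theta> x" if "x \<in> U" "slack 1 z x = 0" for x z using slack_zero_imp[OF one] that by simp
    fix \<delta> :: real assume \<delta>: "0 < \<delta>"
    define \<delta>' where "\<delta>' = \<delta> / real J"
    have \<delta>': "0 < \<delta>'" using \<delta> J_gt_0 by (simp add: \<delta>'_def)
    define \<sigma> where "\<sigma> j \<pi> = (\<integral>p. slack j (fst p) (snd p) \<partial>\<pi>)" for j \<pi>
    have "\<forall>j\<in>{1..J}. \<exists>\<pi>. \<pi> \<in> couplings \<nu> \<mu> \<and> 0 \<le> \<sigma> j \<pi> \<and> 0 \<le> \<alpha> j \<nu> + \<beta> j + 2 * \<sigma> j \<pi> \<and>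
        ennreal (\<alpha> j \<nu> + \<beta> j + 2 * \<sigma> j \<pi>) \<le> wasserstein2_sq \<nu> (deformed j) + ennreal \<delta>'"
      using wasserstein2_sq_ge(2)[OF \<nu> _ fin \<delta>'] unfolding \<sigma>_def Bex_def by blast
    from bchoice[OF this] obtain \<pi> where \<pi>: "\<And>j. j \<in> {1..J} \<Longrightarrow> \<pi> j \<in> couplings \<nu> \<mu> \<and> 0 \<le> \<sigma> j (\<pi> j) \<and>
        0 \<le> \<alpha> j \<nu> + \<beta> j + 2 * \<sigma> j (\<pi> j) \<and>
        ennreal (\<alpha> j \<nu> + \<beta> j + 2 * \<sigma> j (\<pi> j)) \<le> wasserstein2_sq \<nu> (deformed j) + ennreal \<delta>'"
      by blast
    have "ennreal (\<Sum>j=1..J. \<alpha> j \<nu> + \<beta> j + 2 * \<sigma> j (\<pi> j)) = (\<Sum>j=1..J. ennreal (\<alpha> j \<nu> + \<beta> j + 2 * \<sigma> j (\<pi> j)))"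
      using \<pi> by (intro sum_ennreal[symmetric]) auto
    also have "\<dots> \<le> (\<Sum>j=1..J. wasserstein2_sq \<nu> (deformed j) + ennreal \<delta>')"
      using \<pi> by (intro sum_mono) auto
    also have "\<dots> = (\<Sum>j=1..J. wasserstein2_sq \<nu> (deformed j)) + (\<Sum>j=1..J. ennreal \<delta>')"
      by (rule sum.distrib)
    also have "\<dots> \<le> ennreal (\<Sum>j=1..J. \<beta> j) + (\<Sum>j=1..J. ennreal \<delta>')"
      by (intro add_right_mono le)
    also have "(\<Sum>j=1..J. ennreal \<delta>') = ennreal (\<Sum>j=1..J. \<delta>')"
      using \<delta>' by (intro sum_ennreal) auto
    also have "(\<Sum>j=1..J. \<delta>') = \<delta>" using J_gt_0 by (simp add: \<delta>'_def)
    also have "ennreal (\<Sum>j=1..J. \<beta> j) + ennreal \<delta> = ennreal ((\<Sum>j=1..J. \<beta> j) + \<delta>)"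
      using sum_wasserstein2_sq_\<Theta>(2) \<delta> by (simp add: ennreal_plus)
    finally have "(\<Sum>j=1..J. \<alpha> j \<nu> + \<beta> j + 2 * \<sigma> j (\<pi> j)) \<le> (\<Sum>j=1..J. \<beta> j) + \<delta>"
      using sum_wasserstein2_sq_\<Theta>(2) \<delta> by (subst (asm) ennreal_le_iff) auto
    then have "2 * (\<Sum>j=1..J. \<sigma> j (\<pi> j)) \<le> \<delta>"
      using sum_\<alpha>_nonneg[OF \<nu>] by (simp add: sum.distrib sum_distrib_left)
    moreover have "\<sigma> 1 (\<pi> 1) \<le> (\<Sum>j=1..J. \<sigma> j (\<pi> j))"
      using \<pi> one by (intro member_le_sum) auto
    ultimately have "\<sigma> 1 (\<pi> 1) < \<delta>" using \<delta> by linarith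
    then show "\<exists>\<pi>\<in>couplings \<nu> \<mu>. (\<integral>p. slack 1 (fst p) (snd p) \<partial>\<pi>) < \<delta>"
      using \<pi>[OF one] unfolding \<sigma>_def by blast
  qed
qed

lemma barycenter_eq: "barycenter J deformed = distr \<mu> borel \<Theta>"
proof -
  have le_iff: "barycenter_cost J deformed \<nu> \<le> barycenter_cost J deformed \<nu>' \<longleftrightarrow>
      (\<Sum>j=1..J. wasserstein2_sq \<nu> (deformed j)) \<le> (\<Sum>j=1..J. wasserstein2_sq \<nu>' (deformed j))" for \<nu> \<nu>'
    unfolding barycenter_cost_def using J_gt_0
    by (intro ennreal_mult_le_mult_iff) (auto simp: ennreal_eq_0_iff)
  show ?thesis
    unfolding barycenter_def
  proof (rule the_equality)
    show "is_barycenter J deformed (distr \<mu> borel \<Theta>)"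
      using \<Theta>_P2 sum_wasserstein2_sq_ge by (simp add: is_barycenter_def le_iff sum_wasserstein2_sq_\<Theta> del: One_nat_def)
    fix \<nu> assume "is_barycenter J deformed \<nu>"
    then show "\<nu> = distr \<mu> borel \<Theta>"
      using \<Theta>_P2 by (intro barycenter_unique) (auto simp: is_barycenter_def le_iff sum_wasserstein2_sq_\<Theta> simp del: One_nat_def)
  qed
qed

end

section \<open>Admissible families\<close>

context
  fixes A :: "'i set" and S :: "'i \<Rightarrow> 'a::euclidean_space \<Rightarrow> 'a" and I :: "'a set"
  assumes adm: "admissible_family A S I"
begin

lemma family_bij: "i \<in> A \<Longrightarrow> bij_betw (S i) I I"
  using adm by (simp add: admissible_family_def)

lemma family_inv:
  "i \<in> A \<Longrightarrow> x \<in> I \<Longrightarrow> inv_into I (S i) (S i x) = x"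
  "i \<in> A \<Longrightarrow> y \<in> I \<Longrightarrow> S i (inv_into I (S i) y) = y"
  "i \<in> A \<Longrightarrow> y \<in> I \<Longrightarrow> inv_into I (S i) y \<in> I"
  "i \<in> A \<Longrightarrow> x \<in> I \<Longrightarrow> S i x \<in> I"
  using family_bij[of i] by (auto simp: bij_betw_def f_inv_into_f inv_into_into)

lemma family_gradient:
  "i \<in> A \<Longrightarrow> j \<in> A \<Longrightarrow> \<exists>\<phi>. convex_gradient I \<phi> (S i \<circ> inv_into I (S j))"
  using adm by (intro GCF_convex_gradient) (simp add: admissible_family_def)

text \<open>Admissibility speaks of compositions; pairing with the index of the identity isolates a
  map and its inverse.\<close>

lemma map_gradient:
  assumes i: "i \<in> A"
  shows "\<exists>\<phi>. convex_gradient I \<phi> (S i)" "\<exists>\<phi>. convex_gradient I \<phi> (inv_into I (S i))"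
proof -
  obtain i0 where i0: "i0 \<in> A" "\<And>x. x \<in> I \<Longrightarrow> S i0 x = x"
    using adm by (auto simp: admissible_family_def)
  have inv: "inv_into I (S i0) x = x" if "x \<in> I" for x
    using family_inv(1)[OF i0(1) that] i0(2) that by simp
  obtain \<phi> where "convex_gradient I \<phi> (S i \<circ> inv_into I (S i0))" using family_gradient[OF i i0(1)] by blast
  then have "convex_gradient I \<phi> (S i)" by (rule convex_gradient_cong) (simp add: inv)
  then show "\<exists>\<phi>. convex_gradient I \<phi> (S i)" by blast
  obtain \<psi> where "convex_gradient I \<psi> (S i0 \<circ> inv_into I (S i))" using family_gradient[OF i0(1) i] by blast
  then have "convex_gradient I \<psi> (inv_into I (S i))"
    by (rule convex_gradient_cong) (simp add: i0(2) family_inv(3)[OF i])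
  then show "\<exists>\<phi>. convex_gradient I \<phi> (inv_into I (S i))" by blast
qed

lemma family_convex: "convex I"
  using adm gradient_convex map_gradient(1) by (fastforce simp: admissible_family_def)

lemma family_continuous:
  "i \<in> A \<Longrightarrow> continuous_on (interior I) (S i)"
  "i \<in> A \<Longrightarrow> continuous_on (interior I) (inv_into I (S i))"
  using map_gradient gradient_continuous by blast+

lemma family_interior:
  "i \<in> A \<Longrightarrow> x \<in> interior I \<Longrightarrow> S i x \<in> interior I"
  "i \<in> A \<Longrightarrow> x \<in> interior I \<Longrightarrow> inv_into I (S i) x \<in> interior I"
proof -
  assume i: "i \<in> A" and x: "x \<in> interior I"
  obtain \<phi> \<psi> where g: "convex_gradient I \<phi> (S i)" "convex_gradient I \<psi> (inv_into I (S i))"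
    using map_gradient[OF i] by blast
  show "S i x \<in> interior I"
    by (rule gradient_maps_interior[OF g(1) _ _ x]) (use family_bij[OF i] in \<open>auto simp: bij_betw_def\<close>)
  show "inv_into I (S i) x \<in> interior I"
    by (rule gradient_maps_interior[OF g(2) _ _ x])
      (use family_bij[OF i] in \<open>auto simp: bij_betw_def inj_on_inv_into inv_into_into\<close>)
qed

lemma family_measurable:
  "i \<in> A \<Longrightarrow> interior I \<noteq> {} \<Longrightarrow> S i \<in> borel_measurable (restrict_space borel I)"
  using map_gradient(1) gradient_measurable by blast

end

section \<open>Measures on a convex set\<close>

lemma extend_measure_measurable:
  assumes "prob_measure_on I \<mu>"
  shows "(\<lambda>x. x) \<in> borel_measurable \<mu>" "space \<mu> = I" "prob_space \<mu>"
    "prob_space (extend_measure_to_space \<mu>)" "sets (extend_measure_to_space \<mu>) = sets borel"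
proof -
  have s: "sets \<mu> = sets (restrict_space borel I)" and p: "prob_space \<mu>"
    using assms by (auto simp: prob_measure_on_def)
  show m: "(\<lambda>x. x) \<in> borel_measurable \<mu>"
    using measurable_restrict_space1[of "\<lambda>x. x" borel borel I] s by (simp cong: measurable_cong_sets)
  show "space \<mu> = I" using sets_eq_imp_space_eq[OF s] by (simp add: space_restrict_space)
  show "prob_space \<mu>" by fact
  show "prob_space (extend_measure_to_space \<mu>)"
    unfolding extend_measure_to_space_def by (rule prob_space.prob_space_distr[OF p m])
qed (simp add: extend_measure_to_space_def)

text \<open>The frontier of a convex set is negligible, so absolute continuity leaves all mass in
  the interior.\<close>

lemma AE_interior:
  assumes \<mu>: "prob_measure_on I \<mu>" and I: "convex I"
    and ac: "absolutely_continuous lborel (extend_measure_to_space \<mu>)"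
  shows "AE x in \<mu>. x \<in> interior I" "interior I \<noteq> {}"
proof -
  note m = extend_measure_measurable[OF \<mu>]
  interpret prob_space \<mu> by fact
  have "negligible (frontier I)" by (rule negligible_convex_frontier[OF I])
  then have "frontier I \<in> null_sets lborel"
    by (simp add: negligible_iff_null_sets null_sets_completion_iff)
  then have "frontier I \<in> null_sets (extend_measure_to_space \<mu>)"
    using ac by (auto simp: absolutely_continuous_def)
  then have "AE x in extend_measure_to_space \<mu>. x \<notin> frontier I" by (rule AE_not_in)
  then have "AE x in \<mu>. x \<notin> frontier I"
    unfolding extend_measure_to_space_def by (rule AE_distrD[OF m(1)])
  then show *: "AE x in \<mu>. x \<in> interior I"
    using AE_space
  proof eventually_elim
    case (elim x)
    then show ?case using closure_subset[of I] m(2) by (auto simp: frontier_def)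
  qed
  then show "interior I \<noteq> {}" using AE_contr[of "\<lambda>x. x \<in> interior I"] by auto
qed

lemma barycenter_cong:
  assumes "\<And>j. j \<in> {1..J} \<Longrightarrow> m j = m' j"
  shows "barycenter J m = barycenter J m'"
proof -
  have "barycenter_cost J m = barycenter_cost J m'"
    using assms by (intro ext) (auto simp: barycenter_cost_def intro!: sum.cong)
  then show ?thesis by (simp add: barycenter_def is_barycenter_def)
qed

text \<open>The cost is constantly infinite on \<open>P2\<close>, so the description depends neither
  on J nor on m.\<close>

lemma barycenter_infinite:
  fixes m :: "nat \<Rightarrow> 'a::euclidean_space measure"
  assumes j: "j \<in> {1..J}" and inf: "(\<integral>\<^sup>+y. ennreal ((norm y)\<^sup>2) \<partial>m j) = \<infinity>"
  shows "barycenter J m = (THE \<nu>. \<nu> \<in> P2)"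
proof -
  have "barycenter_cost J m \<nu> = \<infinity>" if \<nu>: "\<nu> \<in> P2" for \<nu>
  proof -
    have "wasserstein2_sq \<nu> (m j) \<le> (\<Sum>j\<in>{1..J}. wasserstein2_sq \<nu> (m j))"
      using j by (intro member_le_sum) auto
    then have eq: "(\<Sum>j\<in>{1..J}. wasserstein2_sq \<nu> (m j)) = \<infinity>"
      using wasserstein2_sq_infinite[OF \<nu> inf] by (simp add: top_unique)
    show ?thesis unfolding barycenter_cost_def eq using j by (simp add: ennreal_mult_top)
  qed
  then have "is_barycenter J m \<nu> \<longleftrightarrow> \<nu> \<in> P2" for \<nu>
    by (auto simp: is_barycenter_def)
  then show ?thesis by (simp add: barycenter_def)
qed

section \<open>Barycenters of realizations\<close>

locale realizations =
  fixes I :: "'a::euclidean_space set" and A :: "'i set" and S :: "'i \<Rightarrow> 'a \<Rightarrow> 'a" and \<mu> :: "'a measure"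
  assumes adm: "admissible_family A S I" and \<mu>: "prob_measure_on I \<mu>"
    and ac: "absolutely_continuous lborel (extend_measure_to_space \<mu>)"
    and cpt: "compactly_supported \<mu>"
begin

abbreviation "U \<equiv> interior I"
abbreviation "\<mu>' \<equiv> extend_measure_to_space \<mu>"

lemmas extension = extend_measure_measurable[OF \<mu>]
lemmas interior_mass = AE_interior[OF \<mu> family_convex[OF adm] ac]

lemma AE_ext: "AE x in \<mu>'. x \<in> U"
  unfolding extend_measure_to_space_def using interior_mass(1) extension(1) by (subst AE_distr_iff) auto

lemma L2_norm_sq_ext:
  assumes "f \<in> borel_measurable borel" and "\<And>x. x \<in> U \<Longrightarrow> f x = g x"
  shows "L2_norm_sq \<mu>' f = L2_norm_sq \<mu> g"
proof -
  have "L2_norm_sq \<mu>' f = (\<integral>\<^sup>+x. ennreal ((norm (f x))\<^sup>2) \<partial>\<mu>)"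
    unfolding L2_norm_sq_def extend_measure_to_space_def
    using extension(1) assms(1) by (subst nn_integral_distr) auto
  also have "\<dots> = L2_norm_sq \<mu> g"
    unfolding L2_norm_sq_def using interior_mass(1) by (intro nn_integral_cong_AE) (auto simp: assms(2))
  finally show ?thesis .
qed

lemma bounded_support: "\<exists>R\<ge>0. AE x in \<mu>'. x \<in> U \<inter> cball 0 R"
proof -
  obtain K where K: "compact K" "AE x in \<mu>. x \<in> K" using cpt by (auto simp: compactly_supported_def)
  obtain R where R: "\<And>x. x \<in> K \<Longrightarrow> norm x \<le> R" using compact_imp_bounded[OF K(1)] by (auto simp: bounded_iff)
  have "AE x in \<mu>. x \<in> cball 0 \<bar>R\<bar>"
    using K(2) by eventually_elim (use R in fastforce)
  then have "AE x in \<mu>'. x \<in> cball 0 \<bar>R\<bar>"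
    unfolding extend_measure_to_space_def using extension(1) by (subst AE_distr_iff) auto
  then have "AE x in \<mu>'. x \<in> U \<inter> cball 0 \<bar>R\<bar>" using AE_ext by eventually_elim auto
  then show ?thesis by (intro exI[of _ "\<bar>R\<bar>"]) auto
qed

lemma id_L2: "(\<lambda>x. x) \<in> L2 \<mu>'"
proof -
  obtain R where R: "AE x in \<mu>'. x \<in> U \<inter> cball 0 R" using bounded_support by blast
  interpret prob_space \<mu>' by (rule extension)
  have [measurable_cong]: "sets \<mu>' = sets borel" by (rule extension)
  have "integrable \<mu>' (\<lambda>x. (norm x)\<^sup>2)"
  proof (rule integrable_const_bound[of _ "R\<^sup>2"])
    show "AE x in \<mu>'. norm ((norm x)\<^sup>2) \<le> R\<^sup>2"
      using R by eventually_elim (simp add: power_mono)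
  qed measurable
  then show ?thesis by (simp add: L2_def)
qed

text \<open>\<open>T\<close> are the given maps, controlled on \<open>I\<close> only;
  \<open>t\<close> are Borel versions on the whole space that agree with them on the interior, hence
  almost everywhere.\<close>

context
  fixes J :: nat and T t :: "nat \<Rightarrow> 'a \<Rightarrow> 'a"
  assumes J: "1 \<le> J"
    and T: "\<And>j. j \<in> {1..J} \<Longrightarrow> \<exists>i\<in>A. \<forall>x\<in>I. T j x = S i x"
    and t_meas: "\<And>j. j \<in> {1..J} \<Longrightarrow> t j \<in> borel_measurable borel"
    and t_eq: "\<And>j x. j \<in> {1..J} \<Longrightarrow> x \<in> U \<Longrightarrow> t j x = T j x"
begin

lemma distr_eq: "j \<in> {1..J} \<Longrightarrow> distr \<mu> borel (T j) = distr \<mu>' borel (t j)"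
proof -
  assume j: "j \<in> {1..J}"
  obtain i where i: "i \<in> A" "\<And>x. x \<in> I \<Longrightarrow> T j x = S i x" using T[OF j] by blast
  have "S i \<in> borel_measurable \<mu>"
    using family_measurable[OF adm i(1) interior_mass(2)] \<mu> by (simp add: prob_measure_on_def cong: measurable_cong_sets)
  then have "T j \<in> borel_measurable \<mu>"
    using measurable_cong[of \<mu> "T j" "S i" borel] i(2) extension(2) by simp
  moreover have "AE x in \<mu>. T j x = t j x" using interior_mass(1) by eventually_elim (simp add: t_eq[OF j])
  ultimately have "distr \<mu> borel (T j) = distr \<mu> borel (\<lambda>x. t j x)"
    using measurable_compose[OF extension(1) t_meas[OF j]] by (intro distr_cong_AE) auto
  also have "\<dots> = distr \<mu>' borel (t j)"
    unfolding extend_measure_to_space_def using extension(1) t_meas[OF j] by (simp add: distr_distr comp_def)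
  finally show ?thesis .
qed

lemma wasserstein2_barycenter_infinite:
  assumes j: "j \<in> {1..J}" and inf: "\<not> L2_norm_sq \<mu>' (t j) < \<infinity>"
  shows "barycenter J (\<lambda>j. distr \<mu> borel (T j)) = (THE \<nu>. \<nu> \<in> P2)"
proof (rule barycenter_infinite[OF j])
  have "t j \<in> borel_measurable \<mu>'" using t_meas[OF j] extension(5) by (simp cong: measurable_cong_sets)
  then show "(\<integral>\<^sup>+y. ennreal ((norm y)\<^sup>2) \<partial>distr \<mu> borel (T j)) = \<infinity>"
    unfolding distr_eq[OF j] using inf by (subst nn_integral_distr) (simp_all add: L2_norm_sq_def less_top[symmetric])
qed

text \<open>Duality enters twice: through \<open>deformations\<close> for the barycenter, and with t
  = id for its distance from \<mu>.\<close>

lemma wasserstein2_barycenter: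
  assumes fin: "\<And>j. j \<in> {1..J} \<Longrightarrow> L2_norm_sq \<mu>' (t j) < \<infinity>"
  shows "wasserstein2 (barycenter J (\<lambda>j. distr \<mu> borel (T j))) \<mu>'
    = L2_norm \<mu>' (\<lambda>x. (1 / real J) *\<^sub>R (\<Sum>j=1..J. t j x - x))"
proof -
  have "\<forall>j\<in>{1..J}. \<exists>i. i \<in> A \<and> (\<forall>x\<in>I. T j x = S i x)" using T by blast
  from bchoice[OF this] obtain ix where ix: "\<And>j. j \<in> {1..J} \<Longrightarrow> ix j \<in> A"
      "\<And>j x. j \<in> {1..J} \<Longrightarrow> x \<in> I \<Longrightarrow> T j x = S (ix j) x"
    by blast
  have UI: "x \<in> I" if "x \<in> U" for x using that interior_subset by blast
  have t: "t j x = S (ix j) x" if "j \<in> {1..J}" "x \<in> U" for j x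
    using t_eq[OF that] ix(2)[OF that(1) UI[OF that(2)]] by simp
  \<comment> \<open>The value 0 off the interior makes the inverse Borel on the whole space.\<close>
  define s where "s j y = (if y \<in> U then inv_into I (S (ix j)) y else 0)" for j y
  have "\<forall>p\<in>{1..J}\<times>{1..J}. \<exists>\<phi>. convex_gradient I \<phi> (S (ix (fst p)) \<circ> inv_into I (S (ix (snd p))))"
    using family_gradient[OF adm] ix(1) by auto
  from bchoice[OF this] obtain \<phi> where \<phi>: "\<And>i j. i \<in> {1..J} \<Longrightarrow> j \<in> {1..J} \<Longrightarrow>
      convex_gradient I (\<phi> (i, j)) (S (ix i) \<circ> inv_into I (S (ix j)))"
    by fastforce
  interpret D: deformations \<mu>' U J t s "\<lambda>i j. \<phi> (i, j)"
  proof (intro deformations.intro deformations_axioms.intro)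
    show "prob_space \<mu>'" "sets \<mu>' = sets borel" by (rule extension)+
    show "1 \<le> J" "open U" "AE x in \<mu>'. x \<in> U" by (fact J open_interior AE_ext)+
    fix j assume j: "j \<in> {1..J}"
    show "t j \<in> L2 \<mu>'" using fin[OF j] t_meas[OF j] extension(5) by (simp add: L2_iff_nn_integral cong: measurable_cong_sets)
    show "s j \<in> borel_measurable borel"
      unfolding s_def by (intro borel_measurable_continuous_on_if family_continuous[OF adm] ix(1) j) auto
    show "continuous_on U (t j)"
      using family_continuous(1)[OF adm ix(1)[OF j]] by (rule continuous_on_eq) (simp add: t[OF j])
    show "continuous_on U (s j)"
      using family_continuous(2)[OF adm ix(1)[OF j]] by (rule continuous_on_eq) (simp add: s_def)
    fix x assume x: "x \<in> U"
    show tU: "t j x \<in> U" and sU: "s j x \<in> U"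
      using family_interior[OF adm ix(1)[OF j] x] t[OF j x] x by (auto simp: s_def)
    show "s j (t j x) = x" using tU t[OF j x] family_inv(1)[OF adm ix(1)[OF j] UI[OF x]] by (simp add: s_def)
    show "t j (s j x) = x"
      using t[OF j sU] x family_inv(2)[OF adm ix(1)[OF j] UI[OF x]] by (simp add: s_def)
  next
    fix i j x x' assume ij: "i \<in> {1..J}" "j \<in> {1..J}" and x: "x \<in> U" "x' \<in> U"
    have tI: "t j x \<in> I" "t j x' \<in> I"
      using family_inv(4)[OF adm ix(1)[OF ij(2)]] UI x t[OF ij(2)] by auto
    show "\<phi> (i, j) (t j x') + t i x' \<bullet> (t j x - t j x') \<le> \<phi> (i, j) (t j x)"
      using subgradient[OF \<phi>[OF ij] tI(2,1)] family_inv(1)[OF adm ix(1)[OF ij(2)] UI[OF x(2)]]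
        t[OF ij(2) x(2)] t[OF ij(1) x(2)] by simp
  qed
  have bary: "barycenter J (\<lambda>j. distr \<mu> borel (T j)) = distr \<mu>' borel D.\<Theta>"
    unfolding D.barycenter_eq[symmetric] by (rule barycenter_cong[OF distr_eq])
  obtain R where R: "0 \<le> R" "AE x in \<mu>'. x \<in> U \<inter> cball 0 R" using bounded_support by blast
  have "\<forall>j\<in>{1..J}. \<exists>\<psi>. convex_gradient I \<psi> (S (ix j))" using map_gradient(1)[OF adm] ix(1) by blast
  from bchoice[OF this] obtain \<psi> where \<psi>: "\<And>j. j \<in> {1..J} \<Longrightarrow> convex_gradient I (\<psi> j) (S (ix j))" by blast
  define \<Psi> where "\<Psi> x = (1 / real J) * (\<Sum>j=1..J. \<psi> j x)" for x
  have sub: "\<Psi> x + D.\<Theta> x \<bullet> (x' - x) \<le> \<Psi> x'" if x: "x \<in> U" "x' \<in> U" for x x'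
  proof -
    have "\<Psi> x + D.\<Theta> x \<bullet> (x' - x) = (1 / real J) * (\<Sum>j=1..J. \<psi> j x + t j x \<bullet> (x' - x))"
      by (simp add: \<Psi>_def D.\<Theta>_def sum.distrib inner_sum_left distrib_left)
    also have "\<dots> \<le> \<Psi> x'"
      unfolding \<Psi>_def
    proof (intro mult_left_mono sum_mono)
      fix j assume j: "j \<in> {1..J}"
      show "\<psi> j x + t j x \<bullet> (x' - x) \<le> \<psi> j x'"
        using subgradient[OF \<psi>[OF j] UI[OF x(1)] UI[OF x(2)]] t[OF j x(1)] by simp
    qed simp
    finally show ?thesis .
  qed
  \<comment> \<open>Restricting to a ball that carries \<mu> makes z . x - \<Psi> x grow at most
    linearly in z; compact support supplies the radius.\<close>
  have "transport_potential \<mu>' (U \<inter> cball 0 R) (\<lambda>x. x) D.\<Theta> \<Psi>"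
  proof (intro transport_potential.intro transport_potential_axioms.intro)
    show "prob_space \<mu>'" "sets \<mu>' = sets borel" by (rule extension)+
    show "AE x in \<mu>'. x \<in> U \<inter> cball 0 R" "(\<lambda>x. x) \<in> L2 \<mu>'" "D.\<Theta> \<in> L2 \<mu>'" by (fact R(2) id_L2 D.\<Theta>_L2)+
    show "\<Psi> x + D.\<Theta> x \<bullet> (x' - x) \<le> \<Psi> x'" if "x \<in> U \<inter> cball 0 R" "x' \<in> U \<inter> cball 0 R" for x x'
      using sub that by auto
    obtain x0 where x0: "x0 \<in> U" using interior_mass(2) by blast
    \<comment> \<open>R bounds |x|; the other terms bound - \<Psi> on the ball through the affine
      minorant at x0.\<close>
    define c where "c = R + \<bar>\<Psi> x0\<bar> + norm (D.\<Theta> x0) * (R + norm x0)"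
    show "\<exists>c. \<forall>x\<in>U \<inter> cball 0 R. \<forall>z. z \<bullet> x - \<Psi> x \<le> c * (1 + (norm z)\<^sup>2)"
    proof (intro exI ballI allI)
      fix x z :: 'a assume x: "x \<in> U \<inter> cball 0 R"
      let ?q = "1 + (norm z)\<^sup>2"
      have q: "1 \<le> ?q" "norm z \<le> ?q"
        using sum_squares_bound[of 1 "norm z"] zero_le_power2[of "norm z"] norm_ge_zero[of z] by (auto; linarith)+
      have xR: "norm x \<le> R" using x by simp
      have "z \<bullet> x \<le> norm z * norm x" by (rule norm_cauchy_schwarz)
      also have "\<dots> \<le> ?q * R" using q xR by (intro mult_mono) auto
      finally have 1: "z \<bullet> x \<le> ?q * R" .
      have "- \<Psi> x \<le> - \<Psi> x0 - D.\<Theta> x0 \<bullet> (x - x0)" using sub[OF x0, of x] x by simp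
      also have "\<dots> \<le> \<bar>\<Psi> x0\<bar> + norm (D.\<Theta> x0) * norm (x - x0)"
        using Cauchy_Schwarz_ineq2[of "D.\<Theta> x0" "x - x0"] by linarith
      also have "\<dots> \<le> \<bar>\<Psi> x0\<bar> + norm (D.\<Theta> x0) * (R + norm x0)"
        using norm_triangle_ineq4[of x x0] xR by (intro add_left_mono mult_left_mono) auto
      also have "\<dots> \<le> ?q * (\<bar>\<Psi> x0\<bar> + norm (D.\<Theta> x0) * (R + norm x0))"
        using mult_right_mono[OF q(1), of "\<bar>\<Psi> x0\<bar> + norm (D.\<Theta> x0) * (R + norm x0)"] R(1) by simp
      finally show "z \<bullet> x - \<Psi> x \<le> c * ?q" using 1 by (simp add: c_def algebra_simps)
    qed
  qed
  from wasserstein2_sq_gradient[OF this]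
  have "wasserstein2 (distr \<mu>' borel D.\<Theta>) \<mu>' = L2_norm \<mu>' (\<lambda>x. D.\<Theta> x - x)"
    using L2_measurable[OF L2_diff[OF D.\<Theta>_L2 id_L2]] by (simp add: wasserstein2_def L2_norm_eq_enn2real)
  moreover have "(\<lambda>x. D.\<Theta> x - x) = (\<lambda>x. (1 / real J) *\<^sub>R (\<Sum>j=1..J. t j x - x))"
    using J by (auto simp: D.\<Theta>_def sum_subtractf scaleR_diff_right sum_constant_scaleR)
  ultimately show ?thesis unfolding bary by simp
qed

end

end

section \<open>Measurable evaluation of continuous paths\<close>

text \<open>Evaluation \<open>(f, x) \<mapsto> f x\<close> is not measurable on the product of the cylinder
  \<open>\<sigma>\<close>-algebra with the Borel \<open>\<sigma>\<close>-algebra. For continuous \<open>f\<close> it is a limit of evaluations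
  at the points of a dense sequence, which are.\<close>

definition path_value :: "(nat \<Rightarrow> 'a::euclidean_space) \<Rightarrow> ('a \<Rightarrow> 'a) \<Rightarrow> 'a \<Rightarrow> 'a" where
  "path_value d f x = lim (\<lambda>n. f (d (LEAST k. dist (d k) x < 1 / real (Suc n))))"

text \<open>The index into the sequence depends measurably on x and has countably many values, so
  only coordinate evaluations at the points d k remain.\<close>

lemma path_value_measurable:
  fixes d :: "nat \<Rightarrow> 'a::euclidean_space"
  assumes d: "\<And>k. d k \<in> I"
  shows "(\<lambda>p. path_value d (fst p) (snd p)) \<in> borel_measurable (paths I \<Otimes>\<^sub>M borel)"
  unfolding path_value_def
proof (rule borel_measurable_lim_metric)
  fix n
  have 1: "(\<lambda>p. fst p (d i)) \<in> borel_measurable (paths I \<Otimes>\<^sub>M (borel :: 'a measure))" for i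
    unfolding paths_def using d by measurable
  have 2: "(\<lambda>p. LEAST k. dist (d k) (snd p) < 1 / real (Suc n))
      \<in> measurable (paths I \<Otimes>\<^sub>M borel) (count_space UNIV)"
    by measurable
  show "(\<lambda>p. fst p (d (LEAST k. dist (d k) (snd p) < 1 / real (Suc n))))
      \<in> borel_measurable (paths I \<Otimes>\<^sub>M borel)"
    by (rule measurable_compose_countable[OF 1 2])
qed

lemma path_value_eq:
  assumes "open U" and d: "range d \<subseteq> U" "U \<subseteq> closure (range d)"
    and f: "continuous_on U f" and x: "x \<in> U"
  shows "path_value d f x = f x"
proof -
  let ?k = "\<lambda>n. LEAST k. dist (d k) x < 1 / real (Suc n)"
  have k: "dist (d (?k n)) x < 1 / real (Suc n)" for n
  proof (rule LeastI_ex)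
    have "x \<in> closure (range d)" using d(2) x by blast
    then show "\<exists>k. dist (d k) x < 1 / real (Suc n)"
      unfolding closure_approachable by (metis of_nat_0_less_iff rangeE zero_less_Suc zero_less_divide_1_iff)
  qed
  have "(\<lambda>n. d (?k n)) \<longlonglongrightarrow> x"
  proof (rule tendsto_dist_iff[THEN iffD2], rule tendsto_sandwich[where f = "\<lambda>_. 0" and h = "\<lambda>n. 1 / real (Suc n)"])
    show "(\<lambda>n. 1 / real (Suc n)) \<longlonglongrightarrow> 0" using LIMSEQ_inverse_real_of_nat by (simp add: inverse_eq_divide)
    show "\<forall>\<^sub>F n in sequentially. dist (d (?k n)) x \<le> 1 / real (Suc n)"
      using k by (intro always_eventually allI less_imp_le)
  qed auto
  from continuous_on_tendsto_compose[OF f this x] have "(\<lambda>n. f (d (?k n))) \<longlonglongrightarrow> f x"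
    using d(1) by (auto intro!: always_eventually)
  then show ?thesis unfolding path_value_def by (rule limI)
qed


section \<open>Consistency and deviation of the barycenter\<close>

locale random_realizations = realizations I A S \<mu> + P: prob_space P
  for I :: "'a::euclidean_space set" and A :: "'i set" and S \<mu> and P :: "'w measure" +
  fixes T :: "'w \<Rightarrow> 'a \<Rightarrow> 'a" and Ts :: "nat \<Rightarrow> 'w \<Rightarrow> 'a \<Rightarrow> 'a" and d :: "nat \<Rightarrow> 'a"
  assumes process: "deformation_process P I A S T"
    and processes: "\<And>j. 1 \<le> j \<Longrightarrow> deformation_process P I A S (Ts j)"
    and sample: "random_sample P I T Ts"
    and T_integrable: "\<And>x. x \<in> I \<Longrightarrow> integrable P (\<lambda>\<omega>. T \<omega> x)"
    and T_mean: "\<And>x. x \<in> I \<Longrightarrow> (\<integral>\<omega>. T \<omega> x \<partial>P) = x"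
    and dense: "range d \<subseteq> interior I" "interior I \<subseteq> closure (range d)"
begin

section \<open>The law of the process on path space\<close>

definition "Q = distr P (paths I) (path I T)"

definition "D f x = path_value d f x - x"

definition "Z j = path I (Ts j)"

lemma process_measurable: "deformation_process P I A S X \<Longrightarrow> path I X \<in> measurable P (paths I)"
  by (simp add: deformation_process_def)

lemma sets_Q: "sets (paths I) = sets Q"
  by (simp add: Q_def)

sublocale Q: prob_space Q
  unfolding Q_def by (intro P.prob_space_distr process_measurable process)

sublocale \<mu>': prob_space "\<mu>'" by (rule extension)

lemma value_measurable:
  "(\<lambda>p. path_value d (fst p) (snd p)) \<in> borel_measurable (Q \<Otimes>\<^sub>M \<mu>')"
proof -
  have "d k \<in> I" for k using dense(1) interior_subset by blast
  from path_value_measurable[of d, OF this] show ?thesis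
    using measurable_cong_sets[OF sets_pair_measure_cong[OF sets_Q extension(5)[symmetric]] refl] by blast
qed

lemma value_measurable' [measurable (raw)]:
  assumes "f \<in> measurable N Q" "g \<in> measurable N \<mu>'"
  shows "(\<lambda>p. path_value d (f p) (g p)) \<in> borel_measurable N"
  using measurable_compose[OF measurable_Pair[OF assms] value_measurable] by simp

lemma id_measurable [measurable]: "(\<lambda>x. x) \<in> borel_measurable \<mu>'"
  using id_L2 by (rule L2_measurable)

lemma D_measurable: "case_prod D \<in> borel_measurable (Q \<Otimes>\<^sub>M \<mu>')"
proof -
  have "(\<lambda>p. path_value d (fst p) (snd p) - snd p) \<in> borel_measurable (Q \<Otimes>\<^sub>M \<mu>')"
    by (intro borel_measurable_diff value_measurable measurable_compose[OF measurable_snd id_measurable])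
  then show ?thesis by (simp add: D_def case_prod_unfold)
qed

lemma path_in_Q: "deformation_process P I A S X \<Longrightarrow> \<omega> \<in> space P \<Longrightarrow> path I X \<omega> \<in> space Q"
  using measurable_space[OF process_measurable] sets_eq_imp_space_eq[OF sets_Q] by blast

lemma value_borel:
  assumes "f \<in> space Q"
  shows "path_value d f \<in> borel_measurable borel"
proof -
  have "path_value d f \<in> borel_measurable \<mu>'"
    using value_measurable'[of "\<lambda>_. f" \<mu>' "\<lambda>x. x"] assms by simp
  then show ?thesis unfolding measurable_cong_sets[OF extension(5) refl] .
qed

lemma value_path:
  assumes X: "deformation_process P I A S X" and \<omega>: "\<omega> \<in> space P" and x: "x \<in> U"
  shows "path_value d (path I X \<omega>) x = X \<omega> x"
proof -
  obtain i where i: "i \<in> A" "\<And>x. x \<in> I \<Longrightarrow> X \<omega> x = S i x"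
    using X \<omega> by (auto simp: deformation_process_def)
  have path: "path I X \<omega> x = X \<omega> x" "X \<omega> x = S i x" if "x \<in> U" for x
    using that interior_subset[of I] i(2) by (auto simp: path_def)
  have "continuous_on U (path I X \<omega>)"
    using family_continuous(1)[OF adm i(1)] by (rule continuous_on_eq) (simp add: path)
  from path_value_eq[OF open_interior dense this x] path[OF x] show ?thesis by simp
qed

lemma L2_norm_sq_D_measurable [measurable]: "(\<lambda>f. L2_norm_sq \<mu>' (D f)) \<in> borel_measurable Q"
  unfolding L2_norm_sq_def using D_measurable
  by (intro \<mu>'.borel_measurable_nn_integral) (simp add: case_prod_unfold)

lemma L2_norm_sq_value_measurable [measurable]:
  "(\<lambda>f. L2_norm_sq \<mu>' (path_value d f)) \<in> borel_measurable Q"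
  unfolding L2_norm_sq_def using value_measurable
  by (intro \<mu>'.borel_measurable_nn_integral) (simp add: case_prod_unfold)

text \<open>Carries the hypotheses on T over to its law, which is all the concentration bounds see.
  On the interior \<open>path_value\<close> returns the path, and \<mu> has no mass
  elsewhere.\<close>

lemma centered_field:
  assumes M: "0 < M" and bound: "AE \<omega> in P. L2_norm_sq \<mu> (\<lambda>x. T \<omega> x - x) \<le> ennreal (M\<^sup>2)"
  shows "centered_field Q \<mu>' D M"
proof (intro centered_field.intro centered_field_axioms.intro)
  show "prob_space Q" "prob_space \<mu>'" "case_prod D \<in> borel_measurable (Q \<Otimes>\<^sub>M \<mu>')" "0 < M"
    by (fact Q.prob_space_axioms \<mu>'.prob_space_axioms D_measurable M)+
  have "L2_norm_sq \<mu>' (D (path I T \<omega>)) = L2_norm_sq \<mu> (\<lambda>x. T \<omega> x - x)" if \<omega>: "\<omega> \<in> space P" for \<omega>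
    unfolding D_def
    by (intro L2_norm_sq_ext borel_measurable_diff value_borel path_in_Q process \<omega>)
      (simp_all add: value_path[OF process \<omega>])
  note eq = this
  have "AE \<omega> in P. L2_norm_sq \<mu>' (D (path I T \<omega>)) \<le> ennreal (M\<^sup>2)"
    using bound AE_space by eventually_elim (simp add: eq)
  \<comment> \<open>An almost sure statement passes to the image measure once this event is known to
    be measurable.\<close>
  moreover have "{f \<in> space (paths I). L2_norm_sq \<mu>' (D f) \<le> ennreal (M\<^sup>2)} \<in> sets (paths I)"
  proof -
    have "{f \<in> space Q. L2_norm_sq \<mu>' (D f) \<le> ennreal (M\<^sup>2)} \<in> sets Q" by measurable
    then show ?thesis unfolding sets_Q sets_eq_imp_space_eq[OF sets_Q] .
  qed
  ultimately show "AE f in Q. L2_norm_sq \<mu>' (D f) \<le> ennreal (M\<^sup>2)"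
    unfolding Q_def by (subst AE_distr_iff[OF process_measurable[OF process]]) auto
  show "AE x in \<mu>'. integrable Q (\<lambda>f. D f x) \<and> (\<integral>f. D f x \<partial>Q) = 0"
    using AE_ext
  proof eventually_elim
    case (elim x)
    have xI: "x \<in> I" using elim interior_subset by blast
    have "x \<in> space \<mu>'" using sets_eq_imp_space_eq[OF extension(5)] by simp
    then have "(\<lambda>f. D f x) \<in> borel_measurable Q"
      unfolding D_def by (intro borel_measurable_diff value_measurable') auto
    then have m: "(\<lambda>f. D f x) \<in> borel_measurable (paths I)"
      by (simp add: measurable_cong_sets[OF sets_Q refl])
    have eq: "D (path I T \<omega>) x = T \<omega> x - x" if "\<omega> \<in> space P" for \<omega>
      using value_path[OF process that elim] by (simp add: D_def)
    have i: "integrable P (\<lambda>\<omega>. D (path I T \<omega>) x) \<longleftrightarrow> integrable P (\<lambda>\<omega>. T \<omega> x - x)"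
      "(\<integral>\<omega>. D (path I T \<omega>) x \<partial>P) = (\<integral>\<omega>. T \<omega> x - x \<partial>P)"
      using eq by (auto intro!: Bochner_Integration.integrable_cong Bochner_Integration.integral_cong)
    show ?case
      unfolding Q_def integrable_distr_eq[OF process_measurable[OF process] m]
        integral_distr[OF process_measurable[OF process] m] i
      using T_integrable[OF xI] T_mean[OF xI] by (simp add: P.prob_space)
  qed
qed

section \<open>The distance of the random barycenter from \<mu>\<close>

definition "W J \<omega> = wasserstein2 (barycenter J (\<lambda>j. distr \<mu> borel (Ts j \<omega>))) \<mu>'"

definition "V J \<omega> = L2_norm \<mu>' (\<lambda>x. (1 / real J) *\<^sub>R (\<Sum>j=1..J. D (Z j \<omega>) x))"

definition "good J \<omega> \<longleftrightarrow> (\<forall>j\<in>{1..J}. L2_norm_sq \<mu>' (path_value d (Z j \<omega>)) < \<infinity>)"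

text \<open>When some deformed measure has infinite second moment, every element of \<open>P2\<close> is a barycenter
  and the definite description is a junk value, the same for all such \<open>\<omega>\<close>. The exceptional set is
  null, but it matters for the measurability of the deviation event.\<close>

lemma W_eq:
  assumes J: "1 \<le> J" and \<omega>: "\<omega> \<in> space P"
  shows "W J \<omega> = (if good J \<omega> then V J \<omega> else wasserstein2 (THE \<nu>. \<nu> \<in> P2) \<mu>')"
proof -
  have T: "\<exists>i\<in>A. \<forall>x\<in>I. Ts j \<omega> x = S i x" if "j \<in> {1..J}" for j
    using processes[of j] that \<omega> by (simp add: deformation_process_def)
  have m: "path_value d (Z j \<omega>) \<in> borel_measurable borel" if "j \<in> {1..J}" for j
    unfolding Z_def using processes[of j] that \<omega> by (intro value_borel path_in_Q) auto
  have eq: "path_value d (Z j \<omega>) x = Ts j \<omega> x" if "j \<in> {1..J}" "x \<in> U" for j x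
    unfolding Z_def using processes[of j] that \<omega> by (intro value_path) auto
  show ?thesis
  proof (cases "good J \<omega>")
    case True
    then show ?thesis
      using wasserstein2_barycenter[where T = "\<lambda>j. Ts j \<omega>", OF J T m eq] by (simp add: W_def V_def D_def good_def del: One_nat_def)
  next
    case False
    then obtain j where "j \<in> {1..J}" "\<not> L2_norm_sq \<mu>' (path_value d (Z j \<omega>)) < \<infinity>"
      unfolding good_def by blast
    from wasserstein2_barycenter_infinite[where T = "\<lambda>j. Ts j \<omega>" and t = "\<lambda>j. path_value d (Z j \<omega>)",
        OF J T m eq this] False show ?thesis by (simp add: W_def)
  qed
qed

lemma indep: "P.indep_vars (\<lambda>_. paths I) Z {1..}"
  using sample by (simp add: random_sample_def Z_def [abs_def])

lemma law: "1 \<le> j \<Longrightarrow> distr P (paths I) (Z j) = Q"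
  using sample by (simp add: random_sample_def Z_def Q_def)

lemma Z_measurable: "1 \<le> j \<Longrightarrow> Z j \<in> measurable P Q"
  using process_measurable[OF processes[of j]] measurable_cong_sets[OF refl sets_Q, of P]
  by (simp add: Z_def [abs_def])

lemma good_sets: "{\<omega> \<in> space P. good J \<omega>} \<in> sets P"
proof -
  have "{\<omega> \<in> space P. L2_norm_sq \<mu>' (path_value d (Z j \<omega>)) < \<infinity>} \<in> sets P" if "j \<in> {1..J}" for j
  proof -
    have [measurable]: "(\<lambda>\<omega>. L2_norm_sq \<mu>' (path_value d (Z j \<omega>))) \<in> borel_measurable P"
      using that by (intro measurable_compose[OF Z_measurable L2_norm_sq_value_measurable]) auto
    show ?thesis by measurable
  qed
  then show ?thesis unfolding good_def by (intro sets.sets_Collect_finite_All) auto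
qed

context
  fixes M assumes M: "0 < M" and bound: "AE \<omega> in P. L2_norm_sq \<mu> (\<lambda>x. T \<omega> x - x) \<le> ennreal (M\<^sup>2)"
begin

interpretation F: centered_field Q \<mu>' D M by (rule centered_field[OF M bound])

text \<open>The centered field is almost surely in \<open>L2\<close>; adding back the identity,
  square integrable by compact support, stays there.\<close>

lemma AE_good: "AE \<omega> in P. \<forall>J. good J \<omega>"
proof -
  have fin: "AE f in Q. L2_norm_sq \<mu>' (path_value d f) < \<infinity>"
    using F.AE_field_L2
  proof eventually_elim
    case (elim f)
    then have "(\<lambda>x. D f x + x) \<in> L2 \<mu>'" using id_L2 by auto
    then show ?case by (simp add: L2_iff_nn_integral D_def)
  qed
  have "AE \<omega> in P. L2_norm_sq \<mu>' (path_value d (Z (Suc j) \<omega>)) < \<infinity>" for j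
  proof (rule AE_distrD[of "Z (Suc j)" P "paths I"])
    show "Z (Suc j) \<in> measurable P (paths I)"
      using process_measurable[OF processes[of "Suc j"]] by (simp add: Z_def [abs_def])
    have "distr P (paths I) (Z (Suc j)) = Q" by (rule law) simp
    then show "AE f in distr P (paths I) (Z (Suc j)). L2_norm_sq \<mu>' (path_value d f) < \<infinity>"
      using fin by metis
  qed
  then have "AE \<omega> in P. \<forall>j. L2_norm_sq \<mu>' (path_value d (Z (Suc j) \<omega>)) < \<infinity>"
    by (simp add: AE_all_countable)
  then show ?thesis
  proof eventually_elim
    case (elim \<omega>)
    have "L2_norm_sq \<mu>' (path_value d (Z j \<omega>)) < \<infinity>" if "1 \<le> j" for j
      using elim[rule_format, of "j - 1"] that by simp
    then show ?case by (simp add: good_def)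
  qed
qed

lemma AE_W_eq: "AE \<omega> in P. \<forall>J\<ge>1. W J \<omega> = V J \<omega>"
  using AE_good AE_space by eventually_elim (simp add: W_eq)

lemma consistency: "AE \<omega> in P. (\<lambda>J. (W J \<omega>)\<^sup>2) \<longlonglongrightarrow> 0"
proof -
  have "AE \<omega> in P. (\<lambda>J. V J \<omega>) \<longlonglongrightarrow> 0"
    unfolding V_def by (rule F.average_tendsto_0[OF P.prob_space_axioms sets_Q indep law])
  then show ?thesis
    using AE_W_eq
  proof eventually_elim
    case (elim \<omega>)
    have "(\<lambda>J. (V J \<omega>)\<^sup>2) \<longlonglongrightarrow> 0\<^sup>2"
      by (intro tendsto_power elim(1))
    moreover have "\<forall>\<^sub>F J in sequentially. (V J \<omega>)\<^sup>2 = (W J \<omega>)\<^sup>2"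
      using elim(2) by (intro eventually_sequentiallyI[of 1]) simp
    ultimately show ?case using tendsto_cong by fastforce
  qed
qed

lemma deviation:
  assumes \<epsilon>: "0 < \<epsilon>" and J: "1 \<le> J"
  shows "{\<omega> \<in> space P. \<epsilon> \<le> W J \<omega>} \<in> sets P"
    and "measure P {\<omega> \<in> space P. \<epsilon> \<le> W J \<omega>}
      \<le> 2 * exp (- (real J * ((\<epsilon> / M)\<^sup>2 / (2 + \<epsilon> / M))))"
proof -
  have r: "0 < \<epsilon> / M" "\<epsilon> / M * M = \<epsilon>" using \<epsilon> M by auto
  note tail = F.tail_bound[OF P.prob_space_axioms sets_Q indep law J r(1), unfolded r(2), folded V_def]
  let ?c = "wasserstein2 (THE \<nu>. \<nu> \<in> P2) \<mu>'"
  \<comment> \<open>Where \<open>good\<close> fails the distance is the constant \<open>?c\<close>,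
    so the event there is everything or nothing.\<close>
  have "{\<omega> \<in> space P. \<epsilon> \<le> W J \<omega>} = ({\<omega> \<in> space P. good J \<omega>} \<inter> {\<omega> \<in> space P. \<epsilon> \<le> V J \<omega>})
      \<union> (if \<epsilon> \<le> ?c then space P - {\<omega> \<in> space P. good J \<omega>} else {})"
    by (auto simp: W_eq[OF J] split: if_splits)
  also have "\<dots> \<in> sets P" using good_sets tail(1) by auto
  finally show W: "{\<omega> \<in> space P. \<epsilon> \<le> W J \<omega>} \<in> sets P" .
  have "measure P {\<omega> \<in> space P. \<epsilon> \<le> W J \<omega>} = measure P {\<omega> \<in> space P. \<epsilon> \<le> V J \<omega>}"
    using AE_W_eq J by (intro P.finite_measure_eq_AE W tail(1)) (auto elim: eventually_mono)
  with tail(2) show "measure P {\<omega> \<in> space P. \<epsilon> \<le> W J \<omega>}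
      \<le> 2 * exp (- (real J * ((\<epsilon> / M)\<^sup>2 / (2 + \<epsilon> / M))))" by simp
qed

end

text \<open>Minkowski's inequality turns boundedness of T into some M for the consistency claim,
  which comes without one.\<close>

lemma bounded_deviation:
  assumes K: "AE \<omega> in P. L2_norm_sq \<mu> (T \<omega>) \<le> ennreal (K\<^sup>2)"
  shows "\<exists>M>0. AE \<omega> in P. L2_norm_sq \<mu> (\<lambda>x. T \<omega> x - x) \<le> ennreal (M\<^sup>2)"
proof -
  \<comment> \<open>K may be negative, and the 1 keeps M positive.\<close>
  define M where "M = \<bar>K\<bar> + L2_norm \<mu>' (\<lambda>x. x) + 1"
  have M: "0 < M" by (simp add: M_def add_nonneg_pos)
  have "AE \<omega> in P. L2_norm_sq \<mu> (\<lambda>x. T \<omega> x - x) \<le> ennreal (M\<^sup>2)"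
    using K AE_space
  proof eventually_elim
    case (elim \<omega>)
    let ?f = "path_value d (path I T \<omega>)" and ?i = "\<lambda>x::'a. (-1) *\<^sub>R x"
    have m: "?f \<in> borel_measurable borel" by (intro value_borel path_in_Q process elim)
    have "L2_norm_sq \<mu>' ?f \<le> ennreal (K\<^sup>2)"
      using L2_norm_sq_ext[OF m, of "T \<omega>"] value_path[OF process elim(2)] elim(1) by simp
    moreover from this have fL: "?f \<in> L2 \<mu>'"
      using m unfolding L2_iff_nn_integral measurable_cong_sets[OF extension(5) refl]
      by (auto intro: le_less_trans)
    ultimately have "(L2_norm \<mu>' ?f)\<^sup>2 \<le> \<bar>K\<bar>\<^sup>2" by (simp add: L2_norm_sq_eq ennreal_le_iff)
    then have fK: "L2_norm \<mu>' ?f \<le> \<bar>K\<bar>" by (rule power2_le_imp_le) simp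
    have iL: "?i \<in> L2 \<mu>'" using id_L2 by (rule L2_scaleR)
    have "(L2_norm \<mu>' (\<lambda>x. ?f x + ?i x))\<^sup>2
        \<le> (L2_norm \<mu>' ?f)\<^sup>2 + 2 * (L2_norm \<mu>' ?f * L2_norm \<mu>' ?i) + (L2_norm \<mu>' ?i)\<^sup>2"
      unfolding L2_norm_add_sq[OF fL iL] using L2_Cauchy_Schwarz[OF fL iL] by linarith
    also have "\<dots> = (L2_norm \<mu>' ?f + L2_norm \<mu>' (\<lambda>x. x))\<^sup>2"
      unfolding L2_norm_scaleR by (simp add: power2_sum)
    also have "\<dots> \<le> M\<^sup>2" using fK by (intro power_mono) (auto simp: M_def)
    finally have "L2_norm_sq \<mu>' (\<lambda>x. ?f x + ?i x) \<le> ennreal (M\<^sup>2)"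
      unfolding L2_norm_sq_eq[OF L2_add[OF fL iL]] by (rule ennreal_leI)
    moreover have "L2_norm_sq \<mu>' (\<lambda>x. ?f x + ?i x) = L2_norm_sq \<mu> (\<lambda>x. T \<omega> x - x)"
      using m by (intro L2_norm_sq_ext) (auto simp: value_path[OF process elim(2)])
    ultimately show ?case by simp
  qed
  with M show ?thesis by blast
qed

end

theorem theorem4p3:
  shows "\<exists>(c::real \<Rightarrow> real) C. (\<forall>r>0. 0 < c r \<and> c r \<le> 1 / r + C) \<and>
    (\<forall>(P::'w measure) (I::'a::euclidean_space set) (A::'i set) S T Ts \<mu>.
       prob_space P \<longrightarrow>
       admissible_family A S I \<longrightarrow>
       deformation_process P I A S T \<longrightarrow>
       prob_measure_on I \<mu> \<longrightarrow>
       absolutely_continuous lborel (extend_measure_to_space \<mu>) \<longrightarrow>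
       compactly_supported \<mu> \<longrightarrow>
       (\<exists>K. AE \<omega> in P. L2_norm_sq \<mu> (T \<omega>) \<le> ennreal (K\<^sup>2)) \<longrightarrow>
       (\<forall>x\<in>I. integrable P (\<lambda>\<omega>. T \<omega> x)) \<longrightarrow>
       (\<forall>j\<ge>1. deformation_process P I A S (Ts j)) \<longrightarrow>
       random_sample P I T Ts \<longrightarrow>
       (\<forall>x\<in>I. (\<integral>\<omega>. T \<omega> x \<partial>P) = x) \<longrightarrow>
       (let \<mu>\<^sub>B = (\<lambda>J \<omega>. barycenter J (\<lambda>j. distr \<mu> borel (Ts j \<omega>)));
            W = (\<lambda>J \<omega>. wasserstein2 (\<mu>\<^sub>B J \<omega>) (extend_measure_to_space \<mu>))
        in (AE \<omega> in P. (\<lambda>J. (W J \<omega>)\<^sup>2) \<longlonglongrightarrow> 0) \<and>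
           (\<forall>M>0. (AE \<omega> in P. L2_norm_sq \<mu> (\<lambda>x. T \<omega> x - x) \<le> ennreal (M\<^sup>2)) \<longrightarrow>
              (\<forall>\<epsilon>>0. \<forall>J\<ge>1.
                 {\<omega> \<in> space P. \<epsilon> \<le> W J \<omega>} \<in> sets P \<and>
                 measure P {\<omega> \<in> space P. \<epsilon> \<le> W J \<omega>}
                   \<le> 2 * exp (- (real J * (\<epsilon>\<^sup>2 / (M\<^sup>2 * (1 + c (\<epsilon> / M) * \<epsilon> / M)))))))))"
proof (intro exI[of _ "\<lambda>r. 1 / r + 1"] exI[of _ 1] conjI allI impI)
  fix P :: "'w measure" and I :: "'a set" and A :: "'i set" and S T Ts \<mu>
  assume P: "prob_space P" and adm: "admissible_family A S I" and T: "deformation_process P I A S T"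
    and \<mu>: "prob_measure_on I \<mu>" and ac: "absolutely_continuous lborel (extend_measure_to_space \<mu>)"
    and cpt: "compactly_supported \<mu>" and bdd: "\<exists>K. AE \<omega> in P. L2_norm_sq \<mu> (T \<omega>) \<le> ennreal (K\<^sup>2)"
    and int: "\<forall>x\<in>I. integrable P (\<lambda>\<omega>. T \<omega> x)" and Ts: "\<forall>j\<ge>1. deformation_process P I A S (Ts j)"
    and sample: "random_sample P I T Ts" and mean: "\<forall>x\<in>I. (\<integral>\<omega>. T \<omega> x \<partial>P) = x"
  interpret realizations I A S \<mu> by (rule realizations.intro[OF adm \<mu> ac cpt])
  obtain D where D: "countable D" "D \<subseteq> interior I" "interior I \<subseteq> closure D"
    using separable[of "interior I"] by blast
  \<comment> \<open>\<open>from_nat_into\<close> enumerates D only if D is nonempty.\<close>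
  have "D \<noteq> {}" using D(3) interior_mass(2) by auto
  with D have "range (from_nat_into D) = D" by (simp add: range_from_nat_into)
  with D interpret random_realizations I A S \<mu> P T Ts "from_nat_into D"
    using T Ts sample int mean
    by (intro random_realizations.intro random_realizations_axioms.intro P realizations_axioms) auto
  obtain M0 where "0 < M0" "AE \<omega> in P. L2_norm_sq \<mu> (\<lambda>x. T \<omega> x - x) \<le> ennreal (M0\<^sup>2)"
    using bdd bounded_deviation by blast
  note cons = consistency[OF this]
  have dev: "{\<omega> \<in> space P. \<epsilon> \<le> W J \<omega>} \<in> sets P \<and> measure P {\<omega> \<in> space P. \<epsilon> \<le> W J \<omega>}
      \<le> 2 * exp (- (real J * (\<epsilon>\<^sup>2 / (M\<^sup>2 * (1 + (1 / (\<epsilon> / M) + 1) * \<epsilon> / M)))))"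
    if "0 < M" "AE \<omega> in P. L2_norm_sq \<mu> (\<lambda>x. T \<omega> x - x) \<le> ennreal (M\<^sup>2)" "0 < \<epsilon>" "1 \<le> J" for M \<epsilon> J
  proof -
    \<comment> \<open>For r = \<epsilon> / M and c(r) = 1 / r + 1 this is 1 + c(r) r = 2 + r, the
      denominator in the tail bound.\<close>
    have "1 + (1 / (\<epsilon> / M) + 1) * \<epsilon> / M = 2 + \<epsilon> / M"
      using that by (simp add: field_simps)
    then have "\<epsilon>\<^sup>2 / (M\<^sup>2 * (1 + (1 / (\<epsilon> / M) + 1) * \<epsilon> / M)) = (\<epsilon> / M)\<^sup>2 / (2 + \<epsilon> / M)"
      by (simp only: power_divide divide_divide_eq_left)
    then show ?thesis using deviation[OF that] by simp
  qed
  show "let \<mu>\<^sub>B = (\<lambda>J \<omega>. barycenter J (\<lambda>j. distr \<mu> borel (Ts j \<omega>)));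
            W = (\<lambda>J \<omega>. wasserstein2 (\<mu>\<^sub>B J \<omega>) (extend_measure_to_space \<mu>))
        in (AE \<omega> in P. (\<lambda>J. (W J \<omega>)\<^sup>2) \<longlonglongrightarrow> 0) \<and>
           (\<forall>M>0. (AE \<omega> in P. L2_norm_sq \<mu> (\<lambda>x. T \<omega> x - x) \<le> ennreal (M\<^sup>2)) \<longrightarrow>
              (\<forall>\<epsilon>>0. \<forall>J\<ge>1.
                 {\<omega> \<in> space P. \<epsilon> \<le> W J \<omega>} \<in> sets P \<and>
                 measure P {\<omega> \<in> space P. \<epsilon> \<le> W J \<omega>}
                   \<le> 2 * exp (- (real J * (\<epsilon>\<^sup>2 / (M\<^sup>2 * (1 + (1 / (\<epsilon> / M) + 1) * \<epsilon> / M)))))))"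
    unfolding Let_def W_def[symmetric] using cons dev by blast
qed (auto intro: add_pos_pos)

end
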